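(* Let $N\geq 2$, $d\geq 1$ and $i\geq 2$ be integers such that $N=\frac{d(d+i)}{i-1}$, and let $\alpha\in\overline{X}_{N,d,i}$ be arbitrary. Let $\Omega_\alpha$ be the polygon and $A,B,C,D,E,F$ the numbers defined in the context. Consider the measure $\bar\mu_\alpha$ on $\Omega_\alpha$ with density $$d_\alpha(x,y)=H\cdot\frac{N}{(N+xy)^2}\,\mathbf 1_{\Omega_\alpha}(x,y),\qquad H^{-1}=2\log A+2\log(B+1)-\log\big(N-(A+1)d\big)-\log\big(N-(d+i)B\big).$$ Then $H$ is the normalising constant of $\bar\mu_\alpha$ (so that $\bar\mu_\alpha$ is a probability measure) and $\bar\mu_\alpha$ is $\mathcal T_\alpha$-invariant. Let $\bar{\mathcal B}_\alpha$ be the collection of Borel sets of $\Omega_\alpha$, $\mathcal B_\alpha$ the collection of Borel sets of $I_\alpha$, and $\mu_\alpha$ the projection of $\bar\mu_\alpha$ on the first coordinate (i.e. on $I_\alpha$). Then the dynamical system $(\Omega_\alpha,\bar{\mathcal B}_\alpha,\bar\mu_\alpha,\mathcal T_\alpha)$ is ergodic, and it is the natural extension of the ergodic system $(I_\alpha,\mathcal B_\alpha,\mu_\alpha,T_\alpha)$. Furthermore, the density $f_\alpha$ of the $T_\alpha$-invariant measure $\mu_\alpha$ is given by $$\begin{aligned} f_\alpha(x)=H\Big(&\tfrac{D}{N+Dx}\mathbf 1_{(\alpha,T_\alpha(\alpha+1))}(x)+\tfrac{E}{N+Ex}\mathbf 1_{(T_\alpha(\alpha+1),T_\alpha^2(\alpha))}(x)+\tfrac{F}{N+Fx}\mathbf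 1_{(T_\alpha^2(\alpha),\alpha+1)}(x)\\ &-\tfrac{A}{N+Ax}\mathbf 1_{(\alpha,T_\alpha^2(\alpha+1))}(x)-\tfrac{B}{N+Bx}\mathbf 1_{(T_\alpha^2(\alpha+1),T_\alpha(\alpha))}(x)-\tfrac{C}{N+Cx}\mathbf 1_{(T_\alpha(\alpha),\alpha+1)}(x)\Big).\end{aligned}$$
   Context: For an integer $N\ge 2$ and a real $\alpha$ with $0<\alpha\le\sqrt N-1$, put $I_\alpha=[\alpha,\alpha+1]$ and define $T_\alpha:I_\alpha\to[\alpha,\alpha+1)$ by $T_\alpha(x)=\frac Nx-d(x)$, where $d(x)=\lfloor \frac Nx-\alpha\rfloor$ (the dependence on $N$ is suppressed). The values of $d(\cdot)$ are the digits; they form a finite set of consecutive integers $\{d,d+1,\dots,d+i\}$ with smallest digit $d=d(\alpha+1)$ and largest digit $d+i$. The cylinders are $I_k=\{x\in I_\alpha : d(x)=k\}$; the largest digit is always chosen so that every cylinder is an interval (in the exceptional case that $N/\alpha-\alpha$ is an integer, the single point $\alpha$ is given the digit $N/\alpha-\alpha-1$, so that $T_\alpha(\alpha)=\alpha+1$). The interior of $I_k$ is denoted $I_k^{o}$. For positive integers $d,i$, let $\mathcal A_{N,d,i}$ be the set of all $\alpha\in(0,\sqrt N-1]$ for which $T_\alpha$ has digit set $\{d,d+1,\dots,d+i\}$, and let $X_{N,d,i}=\{\alpha\in\mathcal A_{N,d,i} : T_\alpha(\alpha)\in I_d^{o},\ T_\alpha(\alpha+1)\in I_{d+i}^{o}\}$;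 $\overline X_{N,d,i}$ is its closure. Put $A=\frac{-(d+i+1)+\sqrt{(d+i+1)^2+4N}}{2}$, $E=A+1$, $B=\frac{-(d+1)+\sqrt{(d-1)^2+4N}}{2}$, $F=B+1$, $C=\frac{N(-(d+i-1)+\sqrt{(d+i+1)^2+4N})}{2(d+i+N)}$, $D=\frac{N(-(d+1)+\sqrt{(d-1)^2+4N})}{2(N-d)}$. $\Omega_\alpha$ is the polygon bounded by the straight line segments between the vertices (in clockwise order) $(\alpha,A)$, $(T_\alpha^2(\alpha+1),A)$, $(T_\alpha^2(\alpha+1),B)$, $(T_\alpha(\alpha),B)$, $(T_\alpha(\alpha),C)$, $(\alpha+1,C)$, $(\alpha+1,F)$, $(T_\alpha^2(\alpha),F)$, $(T_\alpha^2(\alpha),E)$, $(T_\alpha(\alpha+1),E)$, $(T_\alpha(\alpha+1),D)$, $(\alpha,D)$, and back to $(\alpha,A)$. For $\alpha\in X_{N,d,i}$ the orbit points here are $T_\alpha(\alpha)=\frac N\alpha-(d+i)$, $T_\alpha^2(\alpha)=\frac{N}{T_\alpha(\alpha)}-d$, $T_\alpha(\alpha+1)=\frac{N}{\alpha+1}-d$, $T_\alpha^2(\alpha+1)=\frac{N}{T_\alpha(\alpha+1)}-(d+i)$; for $\alpha\in\overline X_{N,d,i}\setminus X_{N,d,i}$ these four symbols (in the polygon and in the density) are understood to be given by the same formulas, and the polygon may be degenerate in that some consecutive vertices coincide. The map $\mathcal T_\alpha:\Omega_\alpha\to\Omega_\alpha$ is $\mathcal T_\alpha(x,y)=\left(T_\alpha(x),\frac{N}{d(x)+y}\right)$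 (defined almost everywhere). A natural extension of a measure-preserving system is an almost surely minimal invertible system which has the original system as a factor. *)

theory Defs
  imports "HOL-Probability.Probability"
begin

text \<open>
  All notions below are modulo null sets: a map need only be defined, as a measurable map into the
  target space, off a null set of the source.
\<close>

definition ae_measure_preserving :: "'a measure \<Rightarrow> 'b measure \<Rightarrow> ('a \<Rightarrow> 'b) \<Rightarrow> bool" where
  "ae_measure_preserving M M' f \<longleftrightarrow>
     (\<exists>Z \<in> null_sets M.
        f \<in> measurable (restrict_space M (space M - Z)) M' \<and>
        distr (restrict_space M (space M - Z)) M' f = M')"

definition ergodic_system :: "'a measure \<Rightarrow> ('a \<Rightarrow> 'a) \<Rightarrow> bool" where
  "ergodic_system M T \<longleftrightarrow>
     prob_space M \<and> ae_measure_preserving M M T \<and>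
     (\<forall>S \<in> sets M. (AE x in M. T x \<in> S \<longleftrightarrow> x \<in> S) \<longrightarrow> measure M S = 0 \<or> measure M S = 1)"

definition invertible_system :: "'a measure \<Rightarrow> ('a \<Rightarrow> 'a) \<Rightarrow> bool" where
  "invertible_system M T \<longleftrightarrow>
     ae_measure_preserving M M T \<and>
     (\<exists>S. ae_measure_preserving M M S \<and> (AE x in M. S (T x) = x) \<and> (AE x in M. T (S x) = x))"

definition factor_map ::
  "'a measure \<Rightarrow> ('a \<Rightarrow> 'a) \<Rightarrow> 'b measure \<Rightarrow> ('b \<Rightarrow> 'b) \<Rightarrow> ('a \<Rightarrow> 'b) \<Rightarrow> bool" where
  "factor_map M T M' T' p \<longleftrightarrow>
     ae_measure_preserving M M' p \<and> (AE x in M. p (T x) = T' (p x))"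

text \<open>
  \<open>(M, T)\<close> is the natural extension of \<open>(M', T')\<close> with factor map \<open>p\<close>: it is invertible and has
  \<open>(M', T')\<close> as a factor, and it is almost surely minimal with these two properties. A system
  lying between the two is given by a sub-\<open>\<sigma>\<close>-algebra \<open>F\<close> of \<open>M\<close>; requiring \<open>F\<close> to contain the
  null sets of \<open>M\<close> amounts to comparing sub-\<open>\<sigma>\<close>-algebras up to null sets.
\<close>

definition natural_extension ::
  "'a measure \<Rightarrow> ('a \<Rightarrow> 'a) \<Rightarrow> 'b measure \<Rightarrow> ('b \<Rightarrow> 'b) \<Rightarrow> ('a \<Rightarrow> 'b) \<Rightarrow> bool" where
  "natural_extension M T M' T' p \<longleftrightarrow>
     invertible_system M T \<and> factor_map M T M' T' p \<and>
     (\<forall>F. subalgebra M F \<and> null_sets M \<subseteq> sets F \<and>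
          invertible_system (restr_to_subalg M F) T \<and>
          factor_map (restr_to_subalg M F) T M' T' p
        \<longrightarrow> sets F = sets M)"

text \<open>
  The first case keeps \<open>{\<alpha>}\<close> from being a cylinder of its own; the point \<open>\<alpha>\<close> then satisfies
  \<open>T\<^sub>\<alpha> \<alpha> = \<alpha> + 1\<close>.
\<close>

definition digit :: "nat \<Rightarrow> real \<Rightarrow> real \<Rightarrow> int" where
  "digit N \<alpha> x =
     (if x = \<alpha> \<and> real N / \<alpha> - \<alpha> \<in> \<int> then \<lfloor>real N / \<alpha> - \<alpha>\<rfloor> - 1 else \<lfloor>real N / x - \<alpha>\<rfloor>)"

definition Tmap :: "nat \<Rightarrow> real \<Rightarrow> real \<Rightarrow> real" where
  "Tmap N \<alpha> x = real N / x - of_int (digit N \<alpha> x)"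

definition cylinder :: "nat \<Rightarrow> real \<Rightarrow> int \<Rightarrow> real set" where
  "cylinder N \<alpha> k = {x \<in> {\<alpha>..\<alpha> + 1}. digit N \<alpha> x = k}"

definition A_set :: "nat \<Rightarrow> nat \<Rightarrow> nat \<Rightarrow> real set" where
  "A_set N d i =
     {\<alpha> \<in> {0<..sqrt (real N) - 1}. digit N \<alpha> ` {\<alpha>..\<alpha> + 1} = {int d..int (d + i)}}"

definition X_set :: "nat \<Rightarrow> nat \<Rightarrow> nat \<Rightarrow> real set" where
  "X_set N d i =
     {\<alpha> \<in> A_set N d i. Tmap N \<alpha> \<alpha> \<in> interior (cylinder N \<alpha> (int d)) \<and>
                      Tmap N \<alpha> (\<alpha> + 1) \<in> interior (cylinder N \<alpha> (int (d + i)))}"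

context
  fixes N d i :: nat
begin

definition cA :: real where
  "cA = (- real (d + i + 1) + sqrt (real (d + i + 1) ^ 2 + 4 * real N)) / 2"

definition cE :: real where
  "cE = cA + 1"

definition cB :: real where
  "cB = (- real (d + 1) + sqrt ((real d - 1) ^ 2 + 4 * real N)) / 2"

definition cF :: real where
  "cF = cB + 1"

definition cC :: real where
  "cC = real N * (- (real (d + i) - 1) + sqrt (real (d + i + 1) ^ 2 + 4 * real N))
          / (2 * real (d + i + N))"

definition cD :: real where
  "cD = real N * (- real (d + 1) + sqrt ((real d - 1) ^ 2 + 4 * real N))
          / (2 * (real N - real d))"

text \<open>
  \<open>orbl\<^sub>1, orbl\<^sub>2\<close> and \<open>orbr\<^sub>1, orbr\<^sub>2\<close> stand for \<open>T\<^sub>\<alpha> \<alpha>, T\<^sub>\<alpha>\<^sup>2 \<alpha>\<close> and \<open>T\<^sub>\<alpha> (\<alpha> + 1), T\<^sub>\<alpha>\<^sup>2 (\<alpha> + 1)\<close>.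
  They are defined by formulas that agree with the iterates of \<open>T\<^sub>\<alpha>\<close> for \<open>\<alpha> \<in> X\<close> and are kept
  on the closure of \<open>X\<close>, where the iterates of \<open>T\<^sub>\<alpha>\<close> may have other digits.
\<close>

definition orbl1 :: "real \<Rightarrow> real" where
  "orbl1 \<alpha> = real N / \<alpha> - real (d + i)"

definition orbl2 :: "real \<Rightarrow> real" where
  "orbl2 \<alpha> = real N / orbl1 \<alpha> - real d"

definition orbr1 :: "real \<Rightarrow> real" where
  "orbr1 \<alpha> = real N / (\<alpha> + 1) - real d"

definition orbr2 :: "real \<Rightarrow> real" where
  "orbr2 \<alpha> = real N / orbr1 \<alpha> - real (d + i)"

end

definition closed_polyline :: "(real \<times> real) list \<Rightarrow> (real \<times> real) set" where
  "closed_polyline vs =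
     (\<Union>k<length vs. closed_segment (vs ! k) (vs ! (Suc k mod length vs)))"

definition polygon :: "(real \<times> real) list \<Rightarrow> (real \<times> real) set" where
  "polygon vs = closed_polyline vs \<union> inside (closed_polyline vs)"

definition \<Omega> :: "nat \<Rightarrow> nat \<Rightarrow> nat \<Rightarrow> real \<Rightarrow> (real \<times> real) set" where
  "\<Omega> N d i \<alpha> = polygon
     [(\<alpha>, cA N d i),
      (orbr2 N d i \<alpha>, cA N d i),
      (orbr2 N d i \<alpha>, cB N d),
      (orbl1 N d i \<alpha>, cB N d),
      (orbl1 N d i \<alpha>, cC N d i),
      (\<alpha> + 1, cC N d i),
      (\<alpha> + 1, cF N d),
      (orbl2 N d i \<alpha>, cF N d),
      (orbl2 N d i \<alpha>, cE N d i),
      (orbr1 N d \<alpha>, cE N d i),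
      (orbr1 N d \<alpha>, cD N d),
      (\<alpha>, cD N d)]"

definition TTmap :: "nat \<Rightarrow> real \<Rightarrow> real \<times> real \<Rightarrow> real \<times> real" where
  "TTmap N \<alpha> = (\<lambda>(x, y). (Tmap N \<alpha> x, real N / (of_int (digit N \<alpha> x) + y)))"

definition Hconst :: "nat \<Rightarrow> nat \<Rightarrow> nat \<Rightarrow> real" where
  "Hconst N d i = inverse
     (2 * ln (cA N d i) + 2 * ln (cB N d + 1)
       - ln (real N - (cA N d i + 1) * real d) - ln (real N - real (d + i) * cB N d))"

definition dens2 :: "nat \<Rightarrow> nat \<Rightarrow> nat \<Rightarrow> real \<Rightarrow> real \<times> real \<Rightarrow> real" where
  "dens2 N d i \<alpha> = (\<lambda>(x, y).
     Hconst N d i * (real N / (real N + x * y) ^ 2) * indicator (\<Omega> N d i \<alpha>) (x, y))"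

definition mubar :: "nat \<Rightarrow> nat \<Rightarrow> nat \<Rightarrow> real \<Rightarrow> (real \<times> real) measure" where
  "mubar N d i \<alpha> =
     density (restrict_space lborel (\<Omega> N d i \<alpha>)) (\<lambda>z. ennreal (dens2 N d i \<alpha> z))"

definition mu :: "nat \<Rightarrow> nat \<Rightarrow> nat \<Rightarrow> real \<Rightarrow> real measure" where
  "mu N d i \<alpha> = distr (mubar N d i \<alpha>) (restrict_space borel {\<alpha>..\<alpha> + 1}) fst"

definition dens1 :: "nat \<Rightarrow> nat \<Rightarrow> nat \<Rightarrow> real \<Rightarrow> real \<Rightarrow> real" where
  "dens1 N d i \<alpha> x = Hconst N d i *
     (cD N d / (real N + cD N d * x) * indicator {\<alpha><..<orbr1 N d \<alpha>} x
    + cE N d i / (real N + cE N d i * x) * indicator {orbr1 N d \<alpha><..<orbl2 N d i \<alpha>} x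
    + cF N d / (real N + cF N d * x) * indicator {orbl2 N d i \<alpha><..<\<alpha> + 1} x
    - cA N d i / (real N + cA N d i * x) * indicator {\<alpha><..<orbr2 N d i \<alpha>} x
    - cB N d / (real N + cB N d * x) * indicator {orbr2 N d i \<alpha><..<orbl1 N d i \<alpha>} x
    - cC N d i / (real N + cC N d i * x) * indicator {orbl1 N d i \<alpha><..<\<alpha> + 1} x)"

end

theory Submission
  imports Defs
begin

text \<open>
  Write \<open>n\<close> for \<open>N\<close> and \<open>\<kappa>\<close> for \<open>d + i\<close>. Over the cylinder of the digit \<open>k\<close> the map acts as
  \<open>(x, y) \<mapsto> (n / x - k, n / (k + y))\<close>. In the coordinates \<open>x\<close> and \<open>- n / y\<close> both components are the same
  Moebius map, so every branch preserves the measure with density \<open>n / (n + x y)^2\<close>, whose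
  value on a rectangle is the logarithm of a cross ratio (\<open>branch_image_rect\<close>).

  Invariance is therefore a statement about tilings: the parts of the polygon above the cylinders
  must be mapped to pieces that fill the polygon. The heights satisfy \<open>E = A + 1\<close>,
  \<open>F = B + 1\<close> and \<open>A = n / (\<kappa> + E)\<close>, \<open>B = n / (\<kappa> + D)\<close>, \<open>C = n / (\<kappa> + A)\<close>, \<open>D = n / (d + F)\<close>,
  \<open>E = n / (d + C)\<close>, \<open>F = n / (d + B)\<close>: each edge of the staircase goes to another edge, or to the line
  along which two neighbouring images are glued. Two of these equations use
  \<open>N (i - 1) = d (d + i)\<close>, and so does the gluing at the steps of the staircase: there
  \<open>L2 = T\<^sup>2 \<alpha>\<close> and \<open>R2 = T\<^sup>2 (\<alpha> + 1)\<close> must satisfy \<open>n / R2 = n / L2 + 1\<close> (\<open>orbit_matching\<close>), that is, the two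
  endpoint orbits merge in the third step. It is enough to see that the images stay in the
  region (\<open>branch_maps_stairs\<close>) and do not overlap (\<open>branch_disjoint\<close>); that they exhaust
  it follows because they have the right total mass. The same edge relations make the mass
  of the polygon telescope to the logarithm that defines \<open>H\<close> (\<open>stairs_density_integral\<close>). All of
  this holds as soon as \<open>A \<le> \<alpha> \<le> B\<close>, and every \<open>\<alpha>\<close> in the closure of \<open>X\<close> has this property.

  Ergodicity is proved by a Hopf argument, carried out with inner and outer regularity in place of
  the ergodic theorem (\<open>hopf_argument\<close>): if the iterates of two points that differ by a fixed
  translation approach each other, then an invariant set cannot distinguish them.
  The map contracts vertical lines, so an invariant set is a union of vertical lines
  (\<open>invariant_is_strip\<close>). The inverse contracts horizontal segments for as long as they do not
  leave the polygon, and by a summable estimate almost every point lies on a horizontal segment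
  of positive length that never does (\<open>measure_not_roomy\<close>). Hence the base of an invariant
  union of vertical lines contains an interval. The points around which the base has full measure
  form an open set, invariant under \<open>x \<mapsto> n / x\<close> and under integer translations. Its longest component would
  be expanded to a longer one, and where \<open>T\<close> jumps, at \<open>\<alpha>\<close> on the circle, the matching of the endpoint orbits
  glues the images of the two sides after three steps. So the open set is everything
  (\<open>invariant_open_set_is_everything\<close>).

  The natural extension is minimal because almost surely the second coordinate is the
  continued fraction of the past digits, and these are determined by the first
  coordinates of the past (\<open>minimal_M\<close>).
\<close>

section \<open>Heights and endpoint orbits\<close>

locale matching_parameters =
  fixes N d i :: nat
  assumes d_pos: "d \<ge> 1" and i_ge: "i \<ge> 2"
    and matching: "real N * (real i - 1) = real d * (real d + real i)"
begin

abbreviation "n \<equiv> real N"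
abbreviation "\<delta> \<equiv> real d"
abbreviation "\<kappa> \<equiv> real d + real i"
abbreviation "A \<equiv> cA N d i"
abbreviation "B \<equiv> cB N d"
abbreviation "C \<equiv> cC N d i"
abbreviation "D \<equiv> cD N d"
abbreviation "E \<equiv> cE N d i"
abbreviation "F \<equiv> cF N d"

lemma half_quotient: "n * u / (2 * v) * w = n" if "v > 0" "u * w = 2 * v" for n u v w :: real
proof -
  have "n * u / (2 * v) * w = n * (u * w) / (2 * v)" by simp
  then show ?thesis using that by simp
qed

lemma \<delta>_ge: "\<delta> \<ge> 1" and \<kappa>_ge: "\<kappa> \<ge> \<delta> + 2" and i_ge': "real i \<ge> 2"
  using d_pos i_ge by auto

lemma N_gt_d: "n > \<delta>"
proof -
  have "\<delta> * (real i - 1) < \<delta> * \<kappa>" using \<delta>_ge i_ge' by simp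
  then have "\<delta> * (real i - 1) < n * (real i - 1)" using matching by simp
  then show ?thesis using i_ge' by simp
qed

lemma n_gt_1: "n > 1" using N_gt_d \<delta>_ge by linarith

lemma A_eq: "A * (A + \<kappa> + 1) = n" and A_pos: "A > 0"
proof -
  define s where "s = sqrt ((\<kappa>+1)^2 + 4 * n)"
  have s2: "s^2 = (\<kappa>+1)^2 + 4 * n" unfolding s_def by simp
  have A: "A = (s - (\<kappa>+1))/2" unfolding cA_def s_def by (simp add: algebra_simps)
  have "A * (A + \<kappa> + 1) = (s^2 - (\<kappa>+1)^2)/4" unfolding A by (simp add: field_simps power2_eq_square)
  then show "A * (A + \<kappa> + 1) = n" using s2 by simp
  have "s > \<kappa>+1" unfolding s_def using n_gt_1 \<kappa>_ge \<delta>_ge by (intro real_less_rsqrt) auto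
  then show "A > 0" using A by simp
qed

lemma B_eq: "(B + 1) * (B + \<delta>) = n" and B_pos: "B > 0"
proof -
  define s where "s = sqrt ((\<delta>-1)^2 + 4 * n)"
  have s2: "s^2 = (\<delta>-1)^2 + 4 * n" unfolding s_def by simp
  have B: "B = (s - (\<delta>+1))/2" unfolding cB_def s_def by (simp add: algebra_simps)
  have "(B + 1) * (B + \<delta>) = (s^2 - (\<delta>-1)^2)/4" unfolding B by (simp add: field_simps power2_eq_square)
  then show "(B + 1) * (B + \<delta>) = n" using s2 by simp
  have "s > \<delta>+1" unfolding s_def using N_gt_d
    by (intro real_less_rsqrt) (auto simp: power2_eq_square algebra_simps)
  then show "B > 0" using B by simp
qed

lemma C_eq: "C * (\<kappa> + A) = n"
proof -
  define s where "s = sqrt ((\<kappa>+1)^2 + 4 * n)"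
  have s2: "s^2 = (\<kappa>+1)^2 + 4 * n" unfolding s_def by simp
  have A: "A = (s - (\<kappa>+1))/2" unfolding cA_def s_def by (simp add: algebra_simps)
  have C: "C = n * (s - (\<kappa> - 1)) / (2 * (\<kappa> + n))" unfolding cC_def s_def by (simp add: algebra_simps)
  have p: "\<kappa> + n > 0" using \<kappa>_ge \<delta>_ge n_gt_1 by linarith
  have "(s - (\<kappa> - 1)) * (\<kappa> + A) = (s^2 - (\<kappa>-1)^2)/2" unfolding A by (simp add: field_simps power2_eq_square)
  also have "\<dots> = 2 * (\<kappa> + n)" unfolding s2 by (simp add: power2_eq_square field_simps)
  finally have "(s - (\<kappa> - 1)) * (\<kappa> + A) = 2 * (\<kappa> + n)" .
  then show ?thesis unfolding C using p by (intro half_quotient) auto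
qed

lemma D_eq: "D * (\<delta> + 1 + B) = n"
proof -
  define s where "s = sqrt ((\<delta>-1)^2 + 4 * n)"
  have s2: "s^2 = (\<delta>-1)^2 + 4 * n" unfolding s_def by simp
  have B: "B = (s - (\<delta>+1))/2" unfolding cB_def s_def by (simp add: algebra_simps)
  have D: "D = n * (s - (\<delta> + 1)) / (2 * (n - \<delta>))" unfolding cD_def s_def by (simp add: algebra_simps)
  have "(s - (\<delta> + 1)) * (\<delta> + 1 + B) = (s^2 - (\<delta>+1)^2)/2" unfolding B by (simp add: field_simps power2_eq_square)
  also have "\<dots> = 2 * (n - \<delta>)" unfolding s2 by (simp add: power2_eq_square field_simps)
  finally have "(s - (\<delta> + 1)) * (\<delta> + 1 + B) = 2 * (n - \<delta>)" .
  then show ?thesis unfolding D using N_gt_d by (intro half_quotient) auto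
qed

lemma E_def': "E = A + 1" and F_def': "F = B + 1"
  unfolding cE_def cF_def by auto

lemma E_matched: "E * (\<delta> + C) = n"
proof -
  have p: "\<kappa> + A > 0" using \<kappa>_ge \<delta>_ge A_pos by linarith
  have "(\<kappa> + A) * (E * (\<delta> + C)) = (A + 1) * (\<delta> * (\<kappa> + A) + C * (\<kappa> + A))"
    unfolding E_def' by algebra
  also have "\<dots> = (A + 1) * (\<delta> * \<kappa> + \<delta> * A + n)" unfolding C_eq by (simp add: distrib_left add.assoc)
  also have "\<delta> * \<kappa> = n * (real i - 1)" using matching by simp
  also have "(A + 1) * (n * (real i - 1) + \<delta> * A + n) =
     A * (n * (real i - 1)) + \<delta> * (A * (A + \<kappa> + 1)) - A * (\<delta> * \<kappa>) + n * real i + n * A"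
    by (simp add: algebra_simps)
  also have "\<dots> = n * (\<kappa> + A)"
    unfolding A_eq using matching by (simp add: algebra_simps)
  finally show ?thesis using p by simp
qed

lemma B_matched: "B * (\<kappa> + D) = n"
proof -
  have p: "\<delta> + 1 + B > 0" using \<delta>_ge B_pos by linarith
  have "(\<delta> + 1 + B) * (B * (\<kappa> + D)) = B * (\<kappa> * (\<delta> + 1 + B) + D * (\<delta> + 1 + B))"
    by (simp add: algebra_simps)
  also have "\<dots> = B * (\<kappa> * (\<delta> + 1 + B)  + n)" by (simp only: D_eq)
  also have "\<dots> = \<kappa> * ((B+1) * (B + \<delta>)) - \<delta> * \<kappa> + B * n" by (simp add: algebra_simps)
  also have "\<dots> = n * (\<delta> + 1 + B)" unfolding B_eq using matching by (simp add: algebra_simps)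
  finally show ?thesis using p by simp
qed

text \<open>
  The digit is decreasing in \<open>x\<close>; the exceptional digit at the left endpoint does not disturb this, since
  it is only lowered to the largest digit that occurs elsewhere.
\<close>

lemma digit_between_endpoints:
  assumes "0 < a" "x \<in> {a..a + 1}"
  shows "digit N a (a + 1) \<le> digit N a x" "digit N a x \<le> digit N a a"
proof -
  have strict: "\<lfloor>n / y - a\<rfloor> \<le> \<lfloor>n / a - a\<rfloor> - 1" if "n / a - a \<in> \<int>" "a < y" for y
  proof -
    have "n / y < n / a" using that assms n_gt_1 by (intro divide_strict_left_mono) auto
    moreover have "real_of_int \<lfloor>n / a - a\<rfloor> = n / a - a" using that(1) by (simp add: of_int_floor)
    ultimately have "\<lfloor>n / y - a\<rfloor> < \<lfloor>n / a - a\<rfloor>" unfolding floor_less_iff by linarith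
    then show ?thesis by simp
  qed
  have mono: "\<lfloor>n / y - a\<rfloor> \<le> \<lfloor>n / z - a\<rfloor>" if "z \<le> y" "0 < z" for y z
    using that n_gt_1 by (intro floor_mono) (auto intro!: divide_left_mono)
  show "digit N a (a + 1) \<le> digit N a x"
    using assms strict[of "a + 1"] mono[of x "a + 1"] unfolding digit_def by auto
  show "digit N a x \<le> digit N a a"
    using assms strict[of x] mono[of a x] unfolding digit_def by auto
qed

text \<open>
  Both bounds come from the extreme digits: \<open>d\<close> is the digit of \<open>\<alpha> + 1\<close> and
  \<open>d + i\<close> that of \<open>\<alpha>\<close>, which gives \<open>(\<alpha> + 1) (\<alpha> + d) \<le> n\<close>
  and \<open>n \<le> \<alpha> (\<alpha> + d + i + 1)\<close>, with equality for \<open>\<alpha> = B\<close> and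
  \<open>\<alpha> = A\<close>. The bounds are closed conditions and so pass to the closure.
\<close>

lemma closure_X_set_subset: "closure (X_set N d i) \<subseteq> {A..B}"
proof (rule closure_minimal)
  show "X_set N d i \<subseteq> {A..B}"
  proof
    fix a assume "a \<in> X_set N d i"
    then have a: "0 < a" and digits: "digit N a ` {a..a + 1} = {int d..int (d + i)}"
      unfolding X_set_def A_set_def by auto
    have in_range: "digit N a x \<in> {int d..int (d + i)}" if "x \<in> {a..a + 1}" for x
      using that digits by blast
    have "int d \<in> digit N a ` {a..a + 1}" "int (d + i) \<in> digit N a ` {a..a + 1}" unfolding digits by auto
    then obtain x y where "x \<in> {a..a + 1}" "digit N a x = int d" "y \<in> {a..a + 1}" "digit N a y = int (d + i)"
      by auto
    then have right: "digit N a (a + 1) = int d" and left: "digit N a a = int (d + i)"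
      using digit_between_endpoints[OF a, of x] digit_between_endpoints[OF a, of y]
        in_range[of a] in_range[of "a + 1"] by auto
    have "\<lfloor>n / (a + 1) - a\<rfloor> = int d" using right unfolding digit_def by simp
    then have "\<delta> \<le> n / (a + 1) - a" by linarith
    then have upper: "(a + 1) * (a + \<delta>) \<le> n" using a by (simp add: field_simps)
    have "n / a - a \<le> \<kappa> + 1"
    proof (cases "n / a - a \<in> \<int>")
      case True
      then have "real_of_int \<lfloor>n / a - a\<rfloor> = n / a - a" by (simp add: of_int_floor)
      moreover have "\<lfloor>n / a - a\<rfloor> = int (d + i) + 1" using left True unfolding digit_def by simp
      ultimately show ?thesis by simp
    next
      case False
      then have "\<lfloor>n / a - a\<rfloor> = int (d + i)" using left unfolding digit_def by simp
      then show ?thesis by linarith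
    qed
    then have lower: "n \<le> a * (a + \<kappa> + 1)" using a by (simp add: field_simps)
    have "A \<le> a"
    proof (rule ccontr)
      assume "\<not> A \<le> a"
      then have "a * (a + \<kappa> + 1) < A * (A + \<kappa> + 1)"
        using a \<kappa>_ge \<delta>_ge by (intro mult_strict_mono) auto
      then show False using lower A_eq by simp
    qed
    moreover have "a \<le> B"
    proof (rule ccontr)
      assume "\<not> a \<le> B"
      then have "(B + 1) * (B + \<delta>) < (a + 1) * (a + \<delta>)"
        using B_pos \<delta>_ge by (intro mult_strict_mono) auto
      then show False using upper B_eq by simp
    qed
    ultimately show "a \<in> {A..B}" by simp
  qed
qed simp

end

text \<open>
  In terms of the endpoint orbits, the bounds on \<open>\<alpha>\<close> say that \<open>R2\<close> and
  \<open>R1\<close> are at least \<open>\<alpha>\<close>; equivalently, \<open>L1\<close> and \<open>L2\<close> are at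
  most \<open>\<alpha> + 1\<close>.
\<close>

locale matched_expansion = matching_parameters +
  fixes \<alpha> :: real
  assumes A_le: "cA N d i \<le> \<alpha>" and le_B: "\<alpha> \<le> cB N d"
begin

abbreviation "L1 \<equiv> orbl1 N d i \<alpha>"
abbreviation "L2 \<equiv> orbl2 N d i \<alpha>"
abbreviation "R1 \<equiv> orbr1 N d \<alpha>"
abbreviation "R2 \<equiv> orbr2 N d i \<alpha>"

lemma \<alpha>_pos: "\<alpha> > 0" using A_pos A_le by linarith

lemma \<alpha>_lower: "\<alpha> * (\<alpha> + \<kappa> + 1) \<ge> n"
proof -
  have "A * (A + \<kappa> + 1) \<le> \<alpha> * (\<alpha> + \<kappa> + 1)"
    using A_le A_pos \<kappa>_ge \<delta>_ge by (intro mult_mono) linarith+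
  then show ?thesis using A_eq by simp
qed

lemma \<alpha>_upper: "(\<alpha> + 1) * (\<alpha> + \<delta>) \<le> n"
proof -
  have "(\<alpha> + 1) * (\<alpha> + \<delta>) \<le> (B + 1) * (B + \<delta>)"
    using le_B \<alpha>_pos \<delta>_ge by (intro mult_mono) linarith+
  then show ?thesis using B_eq by simp
qed

lemma \<alpha>_sqr: "(\<alpha> + 1)^2 \<le> n"
proof -
  have "(\<alpha> + 1) * (\<alpha> + 1) \<le> (\<alpha> + 1) * (\<alpha> + \<delta>)" using \<alpha>_pos \<delta>_ge by (intro mult_left_mono) auto
  then show ?thesis using \<alpha>_upper by (simp add: power2_eq_square)
qed

text \<open>
  \<open>R2\<close> and \<open>L2\<close> are positive multiples of \<open>i \<alpha> - d\<close>, so their positivity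
  depends on this inequality. It holds because \<open>x = d / i\<close> satisfies
  \<open>x (x + \<kappa> + 1) < n\<close>, whereas \<open>\<alpha>\<close> satisfies the opposite inequality.
\<close>

lemma i\<alpha>_gt: "real i * \<alpha> > \<delta>"
proof (rule ccontr)
  assume "\<not> ?thesis"
  then have le: "\<alpha> \<le> \<delta> / real i" using i_ge' by (simp add: field_simps)
  define x where "x = \<delta> / real i"
  have xi: "x * real i = \<delta>" using i_ge' unfolding x_def by simp
  have x: "x > 0" using \<delta>_ge i_ge' unfolding x_def by simp
  have "n \<le> x * (x + \<kappa> + 1)"
    using \<alpha>_lower mult_mono[of \<alpha> x "\<alpha> + \<kappa> + 1" "x + \<kappa> + 1"] le \<alpha>_pos x \<kappa>_ge \<delta>_ge unfolding x_def by linarith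
  then have "n * (real i - 1) \<le> x * (x + \<kappa> + 1) * (real i - 1)" using i_ge' by (intro mult_right_mono) auto
  then have "x * real i * (x * real i + real i) \<le> x * (x + x * real i + real i + 1) * (real i - 1)"
    unfolding matching xi[symmetric] by (simp add: mult.commute add_ac)
  then have "x * real i * (x * real i + real i) \<le> x * real i * (x * real i + real i) - x * (x + 1)"
    by (simp add: algebra_simps)
  then have "x * (x + 1) \<le> 0" by linarith
  moreover have "x * (x + 1) > 0" using x by (intro mult_pos_pos) auto
  ultimately show False by linarith
qed

lemma A_less_B: "A < B"
proof (rule ccontr)
  assume "\<not> ?thesis"
  then have eq: "A = \<alpha>" "B = \<alpha>" using A_le le_B by auto
  have "\<alpha> * (\<alpha> + \<kappa> + 1) = (\<alpha> + 1) * (\<alpha> + \<delta>)" using A_eq B_eq eq by simp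
  then have "real i * \<alpha> = \<delta>" by (simp add: algebra_simps)
  then show False using i\<alpha>_gt by simp
qed

lemma C_less_E: "C < E"
proof -
  have p: "\<kappa> + A > 0" using \<kappa>_ge \<delta>_ge A_pos by linarith
  have "C * (\<kappa> + A) < E * (\<kappa> + A)" unfolding C_eq unfolding E_def' 
    using A_eq \<kappa>_ge \<delta>_ge A_pos by (simp add: algebra_simps)
  then show ?thesis using p by simp
qed

lemma E_less_F: "E < F" using A_less_B E_def' F_def' by simp

lemma B_less_C: "B < C"
proof -
  have "E * (\<delta> + C) = F * (\<delta> + B)" using E_matched B_eq F_def' by (simp add: algebra_simps)
  moreover have "F * (\<delta> + B) > E * (\<delta> + B)"
    using E_less_F \<delta>_ge B_pos by (intro mult_strict_right_mono) auto
  ultimately have "E * (\<delta> + B) < E * (\<delta> + C)" by simp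
  then show ?thesis using E_def' A_pos by simp
qed

lemma D_pos: "D > 0"
  using D_eq \<delta>_ge B_pos n_gt_1 by (smt (verit) zero_less_mult_pos2)

lemma B_less_D: "B < D"
proof -
  have "B * (\<delta> + 1 + B) < D * (\<delta> + 1 + B)" unfolding D_eq using B_eq \<delta>_ge by (simp add: algebra_simps)
  then show ?thesis using \<delta>_ge B_pos by simp
qed

lemma D_less_E: "D < E"
proof -
  have "A * (\<kappa> + E) = B * (\<kappa> + D)" using A_eq B_matched E_def' by (simp add: algebra_simps)
  also have "\<dots> > A * (\<kappa> + D)" using A_less_B D_pos \<delta>_ge \<kappa>_ge by (intro mult_strict_right_mono) auto
  finally show ?thesis using A_pos by simp
qed

lemmas heights = A_pos A_less_B B_less_C B_less_D C_less_E D_less_E E_less_F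

lemma L1_eq: "\<alpha> * (L1 + \<kappa>) = n"
  using \<alpha>_pos by (simp add: orbl1_def)

lemma R1_eq: "(\<alpha> + 1) * (R1 + \<delta>) = n"
  using \<alpha>_pos by (simp add: orbr1_def)

lemma R1_ge: "R1 \<ge> \<alpha>"
  using \<alpha>_upper \<alpha>_pos by (simp add: orbr1_def field_simps)

lemma L1_le: "L1 \<le> \<alpha> + 1"
  using \<alpha>_lower \<alpha>_pos by (simp add: orbl1_def field_simps)

lemma R1_pos: "R1 > 0" using R1_ge \<alpha>_pos by linarith

lemma \<alpha>L1: "\<alpha> * L1 = n - \<kappa> * \<alpha>" using L1_eq by (simp add: algebra_simps)
lemma \<alpha>R1: "(\<alpha> + 1) * R1 = n - \<delta> * (\<alpha> + 1)" using R1_eq by (simp add: algebra_simps)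

lemma R2_eq: "R1 * (R2 + \<kappa>) = n"
  using R1_pos by (simp add: orbr2_def)

lemma R2_ge: "R2 \<ge> \<alpha>"
proof -
  have "R1 * (\<alpha> + \<kappa>) \<le> n"
  proof -
    have "(\<alpha> + 1) * R1 * (\<alpha> + \<kappa>) = (n - \<delta> * (\<alpha> + 1)) * (\<alpha> + \<kappa>)" using \<alpha>R1 by simp
    also have "\<dots> = n * (\<alpha> + \<kappa>) - \<delta> * (\<alpha> * (\<alpha> + \<kappa> + 1)) - \<delta> * \<kappa>" by (simp add: algebra_simps)
    also have "\<dots> = n * (\<alpha> + \<delta> + 1) - \<delta> * (\<alpha> * (\<alpha> + \<kappa> + 1))" using matching by (simp add: algebra_simps)
    also have "\<dots> \<le> n * (\<alpha> + \<delta> + 1) - \<delta> * n"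
      using \<alpha>_lower \<delta>_ge by (simp add: mult_left_mono)
    also have "\<dots> = (\<alpha> + 1) * n" by (simp add: algebra_simps)
    finally have "(\<alpha> + 1) * (R1 * (\<alpha> + \<kappa>)) \<le> (\<alpha> + 1) * n" by (simp add: algebra_simps)
    then show ?thesis using \<alpha>_pos by simp
  qed
  then have "R1 * (\<alpha> + \<kappa>) \<le> R1 * (R2 + \<kappa>)" using R2_eq by simp
  then show ?thesis using R1_pos by simp
qed

lemma R2_pos: "R2 > 0" using R2_ge \<alpha>_pos by linarith

lemma \<alpha>\<kappa>_less: "\<kappa> * \<alpha> < n"
proof -
  have "\<kappa> * \<alpha> \<le> \<kappa> * B" using le_B \<kappa>_ge \<delta>_ge by (intro mult_left_mono) auto
  also have "\<dots> = n - B * D" using B_matched by (simp add: algebra_simps)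
  also have "\<dots> < n" using B_pos D_pos by simp
  finally show ?thesis .
qed

lemma L1_pos: "L1 > 0"
proof -
  have "\<alpha> * L1 > 0" using \<alpha>L1 \<alpha>\<kappa>_less by simp
  then show ?thesis using \<alpha>_pos by (simp add: zero_less_mult_iff)
qed

lemma L2_eq: "L1 * (L2 + \<delta>) = n"
  using L1_pos by (simp add: orbl2_def)

lemma \<alpha>L1L2: "\<alpha> * L1 * L2 = n * (real i * \<alpha> - \<delta>)"
proof -
  have "\<alpha> * L1 * L2 = \<alpha> * (L1 * (L2 + \<delta>)) - \<delta> * (\<alpha> * L1)" by (simp add: algebra_simps)
  also have "\<dots> = \<alpha> * n - \<delta> * (n - \<kappa> * \<alpha>)" by (simp only: L2_eq \<alpha>L1)
  also have "\<dots> = \<alpha> * n - \<delta> * n + (\<delta> * \<kappa>) * \<alpha>" by (simp add: algebra_simps)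
  also have "\<dots> = n * (real i * \<alpha> - \<delta>)" unfolding matching[symmetric] by (simp add: algebra_simps)
  finally show ?thesis .
qed

lemma \<alpha>R1R2: "(\<alpha> + 1) * R1 * R2 = n * (real i * \<alpha> - \<delta>)"
proof -
  have "(\<alpha> + 1) * R1 * R2 = (\<alpha> + 1) * (R1 * (R2 + \<kappa>)) - \<kappa> * ((\<alpha> + 1) * R1)" by (simp add: algebra_simps)
  also have "\<dots> = (\<alpha> + 1) * n - \<kappa> * (n - \<delta> * (\<alpha> + 1))" by (simp only: R2_eq \<alpha>R1)
  also have "\<dots> = (\<alpha> + 1) * n - \<kappa> * n + (\<delta> * \<kappa>) * (\<alpha> + 1)" by (simp add: algebra_simps)
  also have "\<dots> = n * (real i * \<alpha> - \<delta>)" unfolding matching[symmetric] by (simp add: algebra_simps)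
  finally show ?thesis .
qed

lemma L2_pos: "L2 > 0"
proof -
  have "\<alpha> * L1 * L2 > 0" unfolding \<alpha>L1L2 using i\<alpha>_gt n_gt_1 by simp
  then show ?thesis using \<alpha>_pos L1_pos by (metis zero_less_mult_pos mult_pos_pos)
qed

text \<open>
  The matching condition: \<open>n / L2\<close> and \<open>n / R2\<close> differ by an integer, so the orbits of the two
  endpoints merge in the third step.
\<close>

lemma orbit_matching: "n / R2 = n / L2 + 1"
proof -
  define q where "q = real i * \<alpha> - \<delta>"
  have q: "q > 0" using i\<alpha>_gt q_def by simp
  have "R2 = n * q / ((\<alpha> + 1) * R1)" using \<alpha>R1R2 \<alpha>_pos R1_pos unfolding q_def
    by (metis add_pos_pos less_irrefl mult_eq_0_iff nonzero_mult_div_cancel_left zero_less_one)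
  then have 1: "n / R2 = (\<alpha> + 1) * R1 / q" using n_gt_1 by simp
  have "L2 = n * q / (\<alpha> * L1)" using \<alpha>L1L2 \<alpha>_pos L1_pos unfolding q_def
    by (metis less_irrefl mult_eq_0_iff nonzero_mult_div_cancel_left)
  then have 2: "n / L2 = \<alpha> * L1 / q" using n_gt_1 by simp
  have "(\<alpha> + 1) * R1 = \<alpha> * L1 + q" unfolding \<alpha>R1 \<alpha>L1 q_def by (simp add: algebra_simps)
  then show ?thesis unfolding 1 2 using q by (simp add: field_simps)
qed

lemma L2_le: "L2 \<le> \<alpha> + 1"
proof -
  have "n \<le> L1 * (\<alpha> + 1 + \<delta>)"
  proof -
    have "\<alpha> * (L1 * (\<alpha> + 1 + \<delta>)) = (n - \<kappa> * \<alpha>) * (\<alpha> + 1 + \<delta>)" by (simp add: \<alpha>L1[symmetric] mult.assoc)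
    also have "\<dots> = n * (\<alpha> + 1 + \<delta>) - \<kappa> * ((\<alpha> + 1) * (\<alpha> + \<delta>)) + \<kappa> * \<delta>" by (simp add: algebra_simps)
    also have "\<dots> \<ge> n * (\<alpha> + 1 + \<delta>) - \<kappa> * n + \<kappa> * \<delta>"
      using \<alpha>_upper \<kappa>_ge \<delta>_ge by (simp add: mult_left_mono)
    finally have "\<alpha> * n \<le> \<alpha> * (L1 * (\<alpha> + 1 + \<delta>))" using matching by (simp add: algebra_simps)
    then show ?thesis using \<alpha>_pos by simp
  qed
  then have "L1 * (L2 + \<delta>) \<le> L1 * (\<alpha> + 1 + \<delta>)" using L2_eq by simp
  then show ?thesis using L1_pos by simp
qed

lemma inverse_orbits:
  "n / \<alpha> = L1 + \<kappa>" "n / L1 = L2 + \<delta>" "n / (\<alpha> + 1) = R1 + \<delta>" "n / R1 = R2 + \<kappa>"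
  using L1_eq L2_eq R1_eq R2_eq \<alpha>_pos L1_pos R1_pos by (simp_all add: field_simps)

lemma n_div_less_iff: "0 < x \<Longrightarrow> 0 < y \<Longrightarrow> n / x < n / y \<longleftrightarrow> y < x"
  using n_gt_1 by (simp add: field_simps)

lemma n_div_le_iff: "0 < x \<Longrightarrow> 0 < y \<Longrightarrow> n / x \<le> n / y \<longleftrightarrow> y \<le> x"
  using n_gt_1 by (simp add: field_simps)

lemma R1_less_L1: "R1 < L1"
proof -
  have "n / L1 < n / R1" unfolding inverse_orbits using L2_le R2_ge \<kappa>_ge by linarith
  then show ?thesis using n_div_less_iff L1_pos R1_pos by blast
qed

lemma R2_le_L1: "R2 \<le> L1"
proof -
  have "n / (\<alpha> + 1) \<le> n / L2" using n_div_le_iff[of "\<alpha> + 1" L2] L2_pos L2_le \<alpha>_pos by simp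
  then have "n / L1 \<le> n / R2" using L2_le R1_ge inverse_orbits orbit_matching by linarith
  then show ?thesis using n_div_le_iff L1_pos R2_pos by blast
qed

lemma R1_le_L2: "R1 \<le> L2"
proof -
  have "n / R2 \<le> n / \<alpha>" using n_div_le_iff[of R2 \<alpha>] R2_pos R2_ge \<alpha>_pos by simp
  then have "n / L2 \<le> n / R1" using R2_ge L1_le inverse_orbits orbit_matching by linarith
  then show ?thesis using n_div_le_iff L2_pos R1_pos by blast
qed

lemma R2_less_L2: "R2 < L2"
  using orbit_matching n_div_less_iff[of L2 R2] L2_pos R2_pos by simp

lemmas orbit_order = R2_ge R2_le_L1 L1_le R1_ge R1_le_L2 L2_le R1_less_L1 R2_less_L2

end

section \<open>The polygon is a staircase region\<close>

lemma axis_parallel_segment: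
  fixes a b y :: real
  assumes "a \<le> b"
  shows "closed_segment (a, y) (b, y) = {a..b} \<times> {y}" "closed_segment (b, y) (a, y) = {a..b} \<times> {y}"
    "closed_segment (y, a) (y, b) = {y} \<times> {a..b}" "closed_segment (y, b) (y, a) = {y} \<times> {a..b}"
  using assms closed_segment_commute[of a b]
  by (auto simp: closed_segment_same_fst closed_segment_same_snd closed_segment_eq_real_ivl)

context matched_expansion begin

text \<open>
  The open and the closed staircase differ only by the lines that carry the sides of the polygon. Both are written as
  conditions on points, because then the position of \<open>x\<close> relative to the steps can be handled by case
  distinction, and coinciding vertices need no separate treatment.
\<close>

definition open_stairs :: "(real \<times> real) set" where
  "open_stairs = {z. \<alpha> < fst z \<and> fst z < \<alpha> + 1 \<and> A < snd z \<and> snd z < F \<and>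
     (R2 \<le> fst z \<longrightarrow> B < snd z) \<and> (L1 \<le> fst z \<longrightarrow> C < snd z) \<and>
     (fst z \<le> L2 \<longrightarrow> snd z < E) \<and> (fst z \<le> R1 \<longrightarrow> snd z < D)}"

definition closed_stairs :: "(real \<times> real) set" where
  "closed_stairs = {z. \<alpha> \<le> fst z \<and> fst z \<le> \<alpha> + 1 \<and> A \<le> snd z \<and> snd z \<le> F \<and>
     (R2 < fst z \<longrightarrow> B \<le> snd z) \<and> (L1 < fst z \<longrightarrow> C \<le> snd z) \<and>
     (fst z < L2 \<longrightarrow> snd z \<le> E) \<and> (fst z < R1 \<longrightarrow> snd z \<le> D)}"

definition outline :: "(real \<times> real) set" where
  "outline = closed_polyline
     [(\<alpha>, A), (R2, A), (R2, B), (L1, B), (L1, C), (\<alpha> + 1, C),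
      (\<alpha> + 1, F), (L2, F), (L2, E), (R1, E), (R1, D), (\<alpha>, D)]"

lemma \<Omega>_outline: "\<Omega> N d i \<alpha> = outline \<union> inside outline"
  unfolding \<Omega>_def polygon_def outline_def ..

lemma open_open_stairs: "open open_stairs"
  unfolding open_stairs_def imp_conv_disj not_le
  by (intro open_Collect_conj open_Collect_disj open_Collect_less continuous_intros)

lemma closed_closed_stairs: "closed closed_stairs"
  unfolding closed_stairs_def imp_conv_disj not_less
  by (intro closed_Collect_conj closed_Collect_disj closed_Collect_le continuous_intros)

lemma open_stairs_subset: "open_stairs \<subseteq> closed_stairs"
  unfolding open_stairs_def closed_stairs_def by auto

lemma bounded_closed_stairs: "bounded closed_stairs"
proof (rule bounded_subset)
  show "bounded ({\<alpha>..\<alpha>+1} \<times> {A..F})" by (intro bounded_Times) auto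
  show "closed_stairs \<subseteq> {\<alpha>..\<alpha>+1} \<times> {A..F}" unfolding closed_stairs_def by auto
qed

lemma mem_outline:
  "(x, y) \<in> outline \<longleftrightarrow>
     y = A \<and> \<alpha> \<le> x \<and> x \<le> R2 \<or> x = R2 \<and> A \<le> y \<and> y \<le> B \<or> y = B \<and> R2 \<le> x \<and> x \<le> L1 \<or>
     x = L1 \<and> B \<le> y \<and> y \<le> C \<or> y = C \<and> L1 \<le> x \<and> x \<le> \<alpha> + 1 \<or> x = \<alpha> + 1 \<and> C \<le> y \<and> y \<le> F \<or>
     y = F \<and> L2 \<le> x \<and> x \<le> \<alpha> + 1 \<or> x = L2 \<and> E \<le> y \<and> y \<le> F \<or> y = E \<and> R1 \<le> x \<and> x \<le> L2 \<or>
     x = R1 \<and> D \<le> y \<and> y \<le> E \<or> y = D \<and> \<alpha> \<le> x \<and> x \<le> R1 \<or> x = \<alpha> \<and> A \<le> y \<and> y \<le> D"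
proof -
  have le: "A \<le> B" "B \<le> C" "C \<le> F" "E \<le> F" "D \<le> E" "A \<le> D" using heights by auto
  have "outline = {\<alpha>..R2} \<times> {A} \<union> {R2} \<times> {A..B} \<union> {R2..L1} \<times> {B} \<union> {L1} \<times> {B..C} \<union> {L1..\<alpha>+1} \<times> {C} \<union>
     {\<alpha>+1} \<times> {C..F} \<union> {L2..\<alpha>+1} \<times> {F} \<union> {L2} \<times> {E..F} \<union> {R1..L2} \<times> {E} \<union> {R1} \<times> {D..E} \<union>
     {\<alpha>..R1} \<times> {D} \<union> {\<alpha>} \<times> {A..D}"
    unfolding outline_def closed_polyline_def list.size add_0 add_Suc lessThan_Suc lessThan_0
    by (simp add: axis_parallel_segment orbit_order le) (simp only: Un_ac)
  then show ?thesis
    by (simp only: Un_iff mem_Times_iff fst_conv snd_conv atLeastAtMost_iff singleton_iff conj_ac disj_assoc)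
qed

lemma outline_subset: "outline \<subseteq> closed_stairs"
proof
  fix z assume z: "z \<in> outline"
  obtain x y where xy: "z = (x, y)" by (cases z)
  show "z \<in> closed_stairs"
    using z orbit_order heights unfolding xy mem_outline closed_stairs_def mem_Collect_eq fst_conv snd_conv
    by (elim disjE conjE; intro conjI impI; linarith)
qed

lemma stairs_diff_subset_outline: "closed_stairs - open_stairs \<subseteq> outline"
proof
  fix z assume z: "z \<in> closed_stairs - open_stairs"
  obtain x y where xy: "z = (x, y)" by (cases z)
  have cl: "\<alpha> \<le> x" "x \<le> \<alpha> + 1" "A \<le> y" "y \<le> F" "R2 < x \<Longrightarrow> B \<le> y" "L1 < x \<Longrightarrow> C \<le> y"
    "x < L2 \<Longrightarrow> y \<le> E" "x < R1 \<Longrightarrow> y \<le> D"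
    using z unfolding xy closed_stairs_def by auto
  have "(x, y) \<notin> open_stairs" using z xy by blast
  then have "x \<le> \<alpha> \<or> \<alpha> + 1 \<le> x \<or> y \<le> A \<or> F \<le> y \<or> R2 \<le> x \<and> y \<le> B \<or> L1 \<le> x \<and> y \<le> C \<or>
    x \<le> L2 \<and> E \<le> y \<or> x \<le> R1 \<and> D \<le> y"
    unfolding open_stairs_def mem_Collect_eq fst_conv snd_conv de_Morgan_conj not_imp not_less .
  then have "y = A \<and> \<alpha> \<le> x \<and> x \<le> R2 \<or> x = R2 \<and> A \<le> y \<and> y \<le> B \<or> y = B \<and> R2 \<le> x \<and> x \<le> L1 \<or>
     x = L1 \<and> B \<le> y \<and> y \<le> C \<or> y = C \<and> L1 \<le> x \<and> x \<le> \<alpha> + 1 \<or> x = \<alpha> + 1 \<and> C \<le> y \<and> y \<le> F \<or>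
     y = F \<and> L2 \<le> x \<and> x \<le> \<alpha> + 1 \<or> x = L2 \<and> E \<le> y \<and> y \<le> F \<or> y = E \<and> R1 \<le> x \<and> x \<le> L2 \<or>
     x = R1 \<and> D \<le> y \<and> y \<le> E \<or> y = D \<and> \<alpha> \<le> x \<and> x \<le> R1 \<or> x = \<alpha> \<and> A \<le> y \<and> y \<le> D"
  proof (elim disjE, goal_cases)
    case 1
    then have "x = R1 \<and> D \<le> y \<and> y \<le> E \<or> x = \<alpha> \<and> A \<le> y \<and> y \<le> D"
      using cl R1_ge R2_ge R2_less_L2 by linarith
    then show ?case by (elim disjE) simp_all
  next
    case 2
    then have "x = L1 \<and> B \<le> y \<and> y \<le> C \<or> x = \<alpha> + 1 \<and> C \<le> y \<and> y \<le> F"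
      using cl L1_le L2_le R2_less_L2 by linarith
    then show ?case by (elim disjE) simp_all
  next
    case 3
    then have "y = A \<and> \<alpha> \<le> x \<and> x \<le> R2"
      using cl heights by linarith
    then show ?case by simp
  next
    case 4
    then have "y = F \<and> L2 \<le> x \<and> x \<le> \<alpha> + 1"
      using cl heights by linarith
    then show ?case by simp
  next
    case 5
    then have "x = R2 \<and> A \<le> y \<and> y \<le> B \<or> y = B \<and> R2 \<le> x \<and> x \<le> L1"
      using cl heights by linarith
    then show ?case by (elim disjE) simp_all
  next
    case 6
    then have "x = R2 \<and> A \<le> y \<and> y \<le> B \<or> x = L1 \<and> B \<le> y \<and> y \<le> C \<or> y = C \<and> L1 \<le> x \<and> x \<le> \<alpha> + 1"
      using cl R2_le_L1 by linarith
    then show ?case by (elim disjE) simp_all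
  next
    case 7
    then have "x = L2 \<and> E \<le> y \<and> y \<le> F \<or> y = E \<and> R1 \<le> x \<and> x \<le> L2"
      using cl heights by linarith
    then show ?case by (elim disjE) simp_all
  next
    case 8
    then have "x = L2 \<and> E \<le> y \<and> y \<le> F \<or> x = R1 \<and> D \<le> y \<and> y \<le> E \<or> y = D \<and> \<alpha> \<le> x \<and> x \<le> R1"
      using cl R1_le_L2 by linarith
    then show ?case by (elim disjE) simp_all
  qed
  then show "z \<in> outline" unfolding xy mem_outline .
qed

lemma frontier_subset_outline: "frontier closed_stairs \<subseteq> outline"
proof -
  have "open_stairs \<subseteq> interior closed_stairs" by (simp add: interior_maximal open_open_stairs open_stairs_subset)
  then show ?thesis
    using stairs_diff_subset_outline closed_closed_stairs by (auto simp: frontier_def)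
qed

text \<open>
  A component of the complement of the outline that leaves the closed staircase would meet its frontier, hence the
  outline. So the components of interior points stay in the staircase and are bounded.
\<close>

lemma open_stairs_subset_\<Omega>: "open_stairs \<subseteq> \<Omega> N d i \<alpha>"
proof
  fix z assume z: "z \<in> open_stairs"
  show "z \<in> \<Omega> N d i \<alpha>"
  proof (cases "z \<in> outline")
    case False
    let ?K = "connected_component_set (- outline) z"
    have "?K \<subseteq> closed_stairs"
    proof (rule ccontr)
      assume "\<not> ?thesis"
      moreover have "z \<in> ?K" using False by simp
      ultimately have "?K \<inter> frontier closed_stairs \<noteq> {}"
        using z open_stairs_subset by (intro connected_Int_frontier connected_connected_component) blast+
      moreover have "?K \<subseteq> - outline" by (rule connected_component_subset)
      ultimately show False using frontier_subset_outline by blast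
    qed
    then have "bounded ?K" using bounded_closed_stairs bounded_subset by blast
    then show ?thesis using False unfolding \<Omega>_outline inside_def by auto
  qed (simp add: \<Omega>_outline)
qed

lemma in_outside_if_ray:
  fixes S :: "('a::euclidean_space) set"
  assumes "v \<noteq> 0" "\<And>t. t \<ge> 0 \<Longrightarrow> z + t *\<^sub>R v \<notin> S"
  shows "z \<in> outside S"
proof -
  let ?ray = "(\<lambda>t. z + t *\<^sub>R v) ` {0..}"
  have "connected ?ray" by (intro connected_continuous_image continuous_intros) auto
  moreover have "z \<in> ?ray" by (auto intro!: image_eqI[of _ _ 0])
  moreover have "?ray \<subseteq> - S" using assms by auto
  ultimately have sub: "?ray \<subseteq> connected_component_set (- S) z"
    by (intro connected_component_maximal) auto
  have "\<not> bounded ?ray"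
  proof
    assume "bounded ?ray"
    then obtain b where b: "\<And>t. t \<ge> 0 \<Longrightarrow> norm (z + t *\<^sub>R v) \<le> b" by (auto simp: bounded_iff)
    define t where "t = (b + norm z + 1) / norm v"
    have "b \<ge> 0" using order_trans[OF norm_ge_zero b[of 0]] by simp
    then have t: "t \<ge> 0" using assms(1) by (simp add: t_def)
    have "norm (t *\<^sub>R v) = b + norm z + 1" using assms(1) \<open>b \<ge> 0\<close> by (simp add: t_def)
    moreover have "norm (t *\<^sub>R v) \<le> norm (z + t *\<^sub>R v) + norm z" by (metis add_diff_cancel_left' norm_triangle_ineq4)
    ultimately show False using b[OF t] by linarith
  qed
  then show ?thesis using sub bounded_subset by (auto simp: outside)
qed

text \<open>
  From any point outside the staircase one can escape to infinity along an axis-parallel ray.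
\<close>

lemma \<Omega>_subset_closed_stairs: "\<Omega> N d i \<alpha> \<subseteq> closed_stairs"
proof
  fix z assume z: "z \<in> \<Omega> N d i \<alpha>"
  show "z \<in> closed_stairs"
  proof (rule ccontr)
    assume notin: "z \<notin> closed_stairs"
    obtain x y where xy: "z = (x, y)" by (cases z)
    have "\<exists>v. v \<noteq> 0 \<and> (\<forall>t\<ge>0. z + t *\<^sub>R v \<notin> closed_stairs)"
    proof -
      have out: ?thesis if "v \<noteq> 0" "\<And>t. t \<ge> 0 \<Longrightarrow> (x + t * fst v, y + t * snd v) \<notin> closed_stairs" for v :: "real \<times> real"
        using that by (intro exI[of _ v]) (auto simp: xy scaleR_prod_def)
      have 1: ?thesis if "x < \<alpha>"
        using that by (intro out[of "(-1, 0)"]) (auto simp: closed_stairs_def zero_prod_def)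
      have 2: ?thesis if "x > \<alpha> + 1"
        using that by (intro out[of "(1, 0)"]) (auto simp: closed_stairs_def zero_prod_def)
      have 3: ?thesis if "y < A \<or> R2 < x \<and> y < B \<or> L1 < x \<and> y < C"
        using that by (intro out[of "(0, -1)"]) (auto simp: closed_stairs_def zero_prod_def)
      have 4: ?thesis if "y > F \<or> x < L2 \<and> y > E \<or> x < R1 \<and> y > D"
        using that by (intro out[of "(0, 1)"]) (auto simp: closed_stairs_def zero_prod_def)
      have "x < \<alpha> \<or> x > \<alpha> + 1 \<or> (y < A \<or> R2 < x \<and> y < B \<or> L1 < x \<and> y < C) \<or>
        (y > F \<or> x < L2 \<and> y > E \<or> x < R1 \<and> y > D)"
        using notin xy by (auto simp: closed_stairs_def not_le)
      then show ?thesis using 1 2 3 4 by argo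
    qed
    then obtain v where "v \<noteq> 0" "\<And>t. t \<ge> 0 \<Longrightarrow> z + t *\<^sub>R v \<notin> outline" using outline_subset by blast
    then have "z \<in> outside outline" by (rule in_outside_if_ray)
    then show False using z notin outline_subset unfolding \<Omega>_outline inside_outside by blast
  qed
qed

lemma vertical_line_null: "{z::real \<times> real. fst z = c} \<in> null_sets lborel"
proof -
  have "negligible {z::real\<times>real. z \<bullet> (1, 0) = c}" by (rule negligible_standard_hyperplane) (simp add: Basis_prod_def)
  then have "{z::real\<times>real. fst z = c} \<in> null_sets lebesgue"
    by (simp add: negligible_iff_null_sets inner_prod_def)
  moreover have "{z::real\<times>real. fst z = c} \<in> sets borel" by (intro borel_closed closed_Collect_eq continuous_intros)
  ultimately show ?thesis by (simp add: null_sets_def)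
qed

lemma horizontal_line_null: "{z::real \<times> real. snd z = c} \<in> null_sets lborel"
proof -
  have "negligible {z::real\<times>real. z \<bullet> (0, 1) = c}" by (rule negligible_standard_hyperplane) (simp add: Basis_prod_def)
  then have "{z::real\<times>real. snd z = c} \<in> null_sets lebesgue"
    by (simp add: negligible_iff_null_sets inner_prod_def)
  moreover have "{z::real\<times>real. snd z = c} \<in> sets borel" by (intro borel_closed closed_Collect_eq continuous_intros)
  ultimately show ?thesis by (simp add: null_sets_def)
qed

lemma AE_\<Omega>_iff: "AE z in lborel. z \<in> \<Omega> N d i \<alpha> \<longleftrightarrow> z \<in> open_stairs"
proof -
  have v: "AE z :: real \<times> real in lborel. fst z \<noteq> c" for c 
    using AE_not_in[OF vertical_line_null[of c]] by simp
  have h: "AE z :: real \<times> real in lborel. snd z \<noteq> c" for c 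
    using AE_not_in[OF horizontal_line_null[of c]] by simp
  show ?thesis
    using v[of \<alpha>] v[of "\<alpha>+1"] v[of L1] v[of L2] v[of R1] v[of R2]
      h[of A] h[of B] h[of C] h[of D] h[of E] h[of F]
  proof eventually_elim
    case (elim z)
    then have "z \<in> closed_stairs \<longleftrightarrow> z \<in> open_stairs"
      using elim[symmetric] by (simp add: closed_stairs_def open_stairs_def le_less)
    then show ?case using open_stairs_subset_\<Omega> \<Omega>_subset_closed_stairs by auto
  qed
qed

lemma closed_\<Omega>: "closed (\<Omega> N d i \<alpha>)"
proof -
  have "compact outline"
    unfolding outline_def closed_polyline_def by (intro compact_UN) auto
  then have "open (outside outline)" by (intro open_outside compact_imp_closed)
  moreover have "\<Omega> N d i \<alpha> = - outside outline"
    using outside_no_overlap[of outline] unfolding \<Omega>_outline inside_outside by blast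
  ultimately show ?thesis by (simp add: closed_Compl)
qed

end

section \<open>The measure preserved by all branches\<close>

definition mobius_density :: "real \<Rightarrow> real \<times> real \<Rightarrow> real" where
  "mobius_density n z = n / (n + fst z * snd z)^2"

definition mobius_measure :: "real \<Rightarrow> (real \<times> real) measure" where
  "mobius_measure n = density lborel (\<lambda>z. ennreal (mobius_density n z))"

definition branch :: "real \<Rightarrow> real \<Rightarrow> real \<times> real \<Rightarrow> real \<times> real" where
  "branch n k z = (n / fst z - k, n / (k + snd z))"

text \<open>
  The inverse of \<open>branch n k\<close>: the roles of the two coordinates are exchanged.
\<close>

definition cobranch :: "real \<Rightarrow> real \<Rightarrow> real \<times> real \<Rightarrow> real \<times> real" where
  "cobranch n k z = (n / (k + fst z), n / snd z - k)"

lemma borel_pair_fst_snd [measurable]: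
  "fst \<in> borel_measurable (borel :: (real \<times> real) measure)"
  "snd \<in> borel_measurable (borel :: (real \<times> real) measure)"
  by (simp_all add: borel_measurable_continuous_onI continuous_on_fst continuous_on_snd)

lemma borel_measurable_pair [measurable (raw)]:
  fixes f g :: "'a \<Rightarrow> real"
  assumes "f \<in> borel_measurable M" "g \<in> borel_measurable M"
  shows "(\<lambda>x. (f x, g x)) \<in> borel_measurable M"
  using assms unfolding borel_prod[symmetric] by measurable

lemma mobius_density_measurable [measurable]: "mobius_density n \<in> borel_measurable borel"
  unfolding mobius_density_def by measurable

lemma branch_measurable [measurable]: "branch n k \<in> borel_measurable borel"
  unfolding branch_def by measurable

lemma cobranch_measurable [measurable]: "cobranch n k \<in> borel_measurable borel"
  unfolding cobranch_def by measurable

lemma sets_mobius_measure [measurable_cong, simp]: "sets (mobius_measure n) = sets borel"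
  and space_mobius_measure [simp]: "space (mobius_measure n) = UNIV"
  by (simp_all add: mobius_measure_def)

text \<open>
  The logarithm of the cross ratio of \<open>a, b, - n / e, - n / c\<close>, which is the measure of
  \<open>{a<..<b} \<times> {c<..<e}\<close>.
\<close>

definition log_cross :: "real \<Rightarrow> real \<Rightarrow> real \<Rightarrow> real \<Rightarrow> real \<Rightarrow> real" where
  "log_cross n a b c e = ln (n + b * e) - ln (n + a * e) - (ln (n + b * c) - ln (n + a * c))"

lemma nn_integral_open_interval:
  fixes f g :: "real \<Rightarrow> real"
  assumes [measurable]: "f \<in> borel_measurable borel"
    and f: "\<And>x. a \<le> x \<Longrightarrow> x \<le> b \<Longrightarrow> (g has_real_derivative f x) (at x)" "\<And>x. a \<le> x \<Longrightarrow> x \<le> b \<Longrightarrow> 0 \<le> f x"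
    and "a \<le> b"
  shows "(\<integral>\<^sup>+x. ennreal (f x) * indicator {a<..<b} x \<partial>lborel) = ennreal (g b - g a)"
proof -
  have "(\<integral>\<^sup>+x. ennreal (f x) * indicator {a<..<b} x \<partial>lborel) = (\<integral>\<^sup>+x. ennreal (f x) * indicator {a..b} x \<partial>lborel)"
    using AE_lborel_singleton[of a] AE_lborel_singleton[of b]
    by (intro nn_integral_cong_AE, eventually_elim) (auto simp: indicator_def)
  also have "\<dots> = ennreal (g b - g a)" using assms by (intro nn_integral_FTC_Icc) auto
  finally show ?thesis .
qed

lemma nn_integral_mobius_fibre:
  assumes "n > 0" "x \<ge> 0" "0 \<le> c" "c \<le> e"
  shows "(\<integral>\<^sup>+y. ennreal (mobius_density n (x, y)) * indicator {c<..<e} y \<partial>lborel)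
       = ennreal (e / (n + e * x) - c / (n + c * x))"
proof (rule nn_integral_open_interval[where g = "\<lambda>y. y / (n + y * x)"])
  fix y assume y: "c \<le> y" "y \<le> e"
  have p: "n + y * x > 0" using assms y by (intro add_pos_nonneg mult_nonneg_nonneg) auto
  show "((\<lambda>y. y / (n + y * x)) has_real_derivative mobius_density n (x, y)) (at y)"
    using p unfolding mobius_density_def
    by (auto intro!: derivative_eq_intros simp: power2_eq_square field_simps)
  show "0 \<le> mobius_density n (x, y)" using assms by (simp add: mobius_density_def)
qed (use assms in \<open>measurable\<close>)

lemma emeasure_mobius_rect:
  assumes "n > 0" "0 \<le> a" "a \<le> b" "0 \<le> c" "c \<le> e"
  shows "emeasure (mobius_measure n) ({a<..<b} \<times> {c<..<e}) = ennreal (log_cross n a b c e)"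
proof -
  have "{a<..<b} \<times> {c<..<e} \<in> sets borel" by (intro borel_open open_Times) auto
  then have "emeasure (mobius_measure n) ({a<..<b} \<times> {c<..<e}) =
      (\<integral>\<^sup>+z. ennreal (mobius_density n z) * indicator ({a<..<b} \<times> {c<..<e}) z \<partial>lborel)"
    unfolding mobius_measure_def by (subst emeasure_density) auto
  also have "\<dots> = (\<integral>\<^sup>+x. \<integral>\<^sup>+y. ennreal (mobius_density n (x,y)) * indicator ({a<..<b} \<times> {c<..<e}) (x,y) \<partial>lborel \<partial>lborel)"
  proof -
    have "(\<lambda>z. ennreal (mobius_density n z) * indicator ({a<..<b} \<times> {c<..<e}) z) \<in> borel_measurable (lborel \<Otimes>\<^sub>M lborel)"
      unfolding lborel_prod using \<open>_ \<in> sets borel\<close> by simp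
    from lborel.nn_integral_fst[OF this, symmetric] show ?thesis by (simp only: lborel_prod)
  qed
  also have "\<dots> = (\<integral>\<^sup>+x. ennreal (e / (n + e * x) - c / (n + c * x)) * indicator {a<..<b} x \<partial>lborel)"
  proof (rule nn_integral_cong)
    fix x :: real
    show "(\<integral>\<^sup>+y. ennreal (mobius_density n (x,y)) * indicator ({a<..<b} \<times> {c<..<e}) (x,y) \<partial>lborel)
       = ennreal (e / (n + e * x) - c / (n + c * x)) * indicator {a<..<b} x"
    proof (cases "x \<in> {a<..<b}")
      case True
      have "(\<integral>\<^sup>+y. ennreal (mobius_density n (x,y)) * indicator ({a<..<b} \<times> {c<..<e}) (x,y) \<partial>lborel)
        = (\<integral>\<^sup>+y. ennreal (mobius_density n (x,y)) * indicator {c<..<e} y \<partial>lborel)"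
        using True by (intro nn_integral_cong) (auto simp: indicator_def)
      then show ?thesis using True assms by (simp add: nn_integral_mobius_fibre)
    qed (auto simp: indicator_def)
  qed
  also have "\<dots> = ennreal ((ln (n + e * b) - ln (n + c * b)) - (ln (n + e * a) - ln (n + c * a)))"
  proof (rule nn_integral_open_interval[where g = "\<lambda>x. ln (n + e * x) - ln (n + c * x)"])
    fix x assume x: "a \<le> x" "x \<le> b"
    have p: "n + e * x > 0" "n + c * x > 0" using assms x by (auto intro!: add_pos_nonneg mult_nonneg_nonneg)
    show "((\<lambda>x. ln (n + e * x) - ln (n + c * x)) has_real_derivative e / (n + e * x) - c / (n + c * x)) (at x)"
      using p by (auto intro!: derivative_eq_intros simp: field_simps)
    have "c * (n + e * x) \<le> e * (n + c * x)" using assms by (simp add: algebra_simps mult_right_mono)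
    then have "c / (n + c * x) \<le> e / (n + e * x)"
      using p by (simp add: pos_divide_le_eq pos_le_divide_eq)
    then show "0 \<le> e / (n + e * x) - c / (n + c * x)" by simp
  qed (use assms in \<open>simp_all\<close>)
  also have "\<dots> = ennreal (log_cross n a b c e)"
    unfolding log_cross_def by (simp add: algebra_simps)
  finally show ?thesis .
qed

lemma branch_cross_term:
  assumes "n > 0" "x > 0" "k + y > (0::real)"
  shows "n + (n / x - k) * (n / (k + y)) = (n + x * y) * (n / (k + y)) / x"
proof -
  define q where "q = n / (k + y)"
  have "(k + y) * q = n" using assms by (simp add: q_def)
  then have "n + (n / x - k) * q = (n / x + y) * q" by (simp add: algebra_simps)
  also have "\<dots> = (n + x * y) * q / x" using assms by (simp add: field_simps)
  finally show ?thesis unfolding q_def .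
qed

lemma ln_branch_cross_term:
  assumes "n > 0" "k > 0" "x > 0" "y \<ge> (0::real)"
  shows "ln (n + (n / x - k) * (n / (k + y))) = ln (n + x * y) + ln (n / (k + y)) - ln x"
proof -
  have "n + x * y > 0" "n / (k + y) > 0" using assms by (auto intro!: add_pos_nonneg divide_pos_pos)
  moreover have "ln (p * q / x) = ln p + ln q - ln x" if "p > 0" "q > 0" for p q
    using that \<open>x > 0\<close> by (simp add: ln_mult ln_div)
  ultimately have "ln ((n + x * y) * (n / (k + y)) / x) = ln (n + x * y) + ln (n / (k + y)) - ln x"
    by blast
  then show ?thesis using branch_cross_term[of n x k y] assms by simp
qed

lemma log_cross_branch:
  assumes n: "n > 0" and "0 < a" "a \<le> b" "0 \<le> c" "c \<le> e" and k: "k > 0" "n / b - k \<ge> 0"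
  shows "log_cross n (n / b - k) (n / a - k) (n / (k + e)) (n / (k + c)) = log_cross n a b c e"
  unfolding log_cross_def
  using ln_branch_cross_term[of n k b e] ln_branch_cross_term[of n k a e]
    ln_branch_cross_term[of n k b c] ln_branch_cross_term[of n k a c] assms by linarith

lemma cobranch_branch:
  assumes "n > 0" "fst z > 0" "k + snd z > 0"
  shows "cobranch n k (branch n k z) = z"
  using assms by (simp add: cobranch_def branch_def prod_eq_iff)

lemma branch_cobranch:
  assumes "n > 0" "k + fst z > 0" "snd z > 0"
  shows "branch n k (cobranch n k z) = z"
  using assms by (simp add: cobranch_def branch_def prod_eq_iff)

text \<open>
  A branch maps rectangles to rectangles with the same cross ratio; rectangles are a generator of the Borel sets that is
  stable under intersection, so the equality extends to all Borel sets.
\<close>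

lemma branch_image_rect:
  assumes n: "n > 0" and "0 < a" "a \<le> b" "0 \<le> c" "c \<le> e" and k: "k > 0" "n / b - k \<ge> 0"
    and S: "S \<in> sets borel"
  shows "emeasure (mobius_measure n) (({a<..<b} \<times> {c<..<e}) \<inter> branch n k -` S)
       = emeasure (mobius_measure n) (({n / b - k<..<n / a - k} \<times> {n / (k + e)<..<n / (k + c)}) \<inter> S)"
proof -
  let ?M = "mobius_measure n"
  let ?Q = "{a<..<b} \<times> {c<..<e}"
  let ?R = "{n / b - k<..<n / a - k} \<times> {n / (k + e)<..<n / (k + c)}"
  have Q: "?Q \<in> sets borel" and R: "?R \<in> sets borel" by (auto intro!: borel_open open_Times)
  have b: "b > 0" using assms by linarith
  have ba: "n / b - k \<le> n / a - k" using assms by (simp add: frac_le)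
  have ec: "n / (k + e) \<le> n / (k + c)" using assms by (simp add: frac_le)
  define P1 where "P1 = distr (density ?M (indicator ?Q)) borel (branch n k)"
  define P2 where "P2 = density ?M (indicator ?R)"
  have dens: "emeasure (density ?M (indicator W)) X = emeasure ?M (W \<inter> X)"
    if "W \<in> sets borel" "X \<in> sets borel" for W X
    using that by (auto simp: emeasure_density simp flip: indicator_inter_arith)
  have P1: "emeasure P1 X = emeasure ?M (?Q \<inter> branch n k -` X)" if "X \<in> sets borel" for X
  proof -
    have "branch n k -` X \<in> sets borel" using measurable_sets[OF branch_measurable that] by simp
    then show ?thesis unfolding P1_def using Q that by (simp add: emeasure_distr dens)
  qed
  have P2: "emeasure P2 X = emeasure ?M (?R \<inter> X)" if "X \<in> sets borel" for X
    unfolding P2_def using R that by (rule dens)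
  have "P1 = P2"
  proof (rule measure_eqI_generator_eq)
    let ?E = "range (\<lambda>(a, b). box a b :: (real \<times> real) set)"
    show "Int_stable ?E" by (auto simp: Int_stable_def box_Int_box)
    show "?E \<subseteq> Pow UNIV" "sets P1 = sigma_sets UNIV ?E" "sets P2 = sigma_sets UNIV ?E"
      by (simp_all add: borel_eq_box P1_def P2_def)
    let ?A = "\<lambda>n::nat. box (- (real n *\<^sub>R One)) (real n *\<^sub>R One) :: (real \<times> real) set"
    show "range ?A \<subseteq> ?E" "(\<Union>i. ?A i) = UNIV" unfolding UN_box_eq_UNIV by auto
    show "emeasure P1 (?A i) \<noteq> \<infinity>" for i
    proof -
      have "emeasure P1 (?A i) \<le> emeasure ?M ?Q" using Q by (subst P1) (auto intro!: emeasure_mono)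
      also have "\<dots> < \<infinity>" using emeasure_mobius_rect[of n a b c e] assms by simp
      finally show ?thesis by simp
    qed
    fix X assume "X \<in> ?E"
    then obtain l u where X: "X = {fst l<..<fst u} \<times> {snd l<..<snd u}" by (auto simp: box_prod)
    have XS: "X \<in> sets borel" unfolding X by (auto intro!: borel_open open_Times)
    define a' where "a' = max (fst l) (n / b - k)"
    define b' where "b' = min (fst u) (n / a - k)"
    define c' where "c' = max (snd l) (n / (k + e))"
    define e' where "e' = min (snd u) (n / (k + c))"
    have RX: "?R \<inter> X = {a'<..<b'} \<times> {c'<..<e'}" unfolding X a'_def b'_def c'_def e'_def by auto
    have maps: "z \<in> ?Q \<longleftrightarrow> 0 < fst z \<and> 0 < k + snd z \<and> branch n k z \<in> ?R" for z
    proof (cases "0 < fst z \<and> 0 < k + snd z")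
      case True
      then have "branch n k z \<in> ?R \<longleftrightarrow> n / b < n / fst z \<and> n / fst z < n / a \<and> n / (k + e) < n / (k + snd z)
          \<and> n / (k + snd z) < n / (k + c)"
        by (auto simp: branch_def mem_Times_iff)
      also have "\<dots> \<longleftrightarrow> fst z < b \<and> a < fst z \<and> snd z < e \<and> c < snd z"
        using True assms b by (simp add: divide_less_cancel frac_less2 field_simps)
      finally show ?thesis using True by (auto simp: mem_Times_iff)
    next
      case False
      then show ?thesis using assms by (auto simp: mem_Times_iff)
    qed
    show "emeasure P1 X = emeasure P2 X"
    proof (cases "a' < b' \<and> c' < e'")
      case False
      then have "?R \<inter> X = {}" unfolding RX by auto
      moreover from this have "?Q \<inter> branch n k -` X = {}" using maps by blast
      ultimately show ?thesis using XS by (simp add: P1 P2)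
    next
      case True
      have "n / (k + e) > 0" using assms by (intro divide_pos_pos) auto
      then have pos: "a' \<ge> 0" "c' > 0" using k unfolding a'_def c'_def by (auto simp: less_max_iff_disj le_max_iff_disj)
      have "?Q \<inter> branch n k -` X = {n / (k + b')<..<n / (k + a')} \<times> {n / e' - k<..<n / c' - k}"
      proof (rule set_eqI)
        fix z
        have "z \<in> ?Q \<inter> branch n k -` X \<longleftrightarrow> 0 < fst z \<and> 0 < k + snd z \<and> branch n k z \<in> {a'<..<b'} \<times> {c'<..<e'}"
          unfolding RX[symmetric] by (simp only: Int_iff vimage_eq maps[of z] conj_assoc)
        also have "\<dots> \<longleftrightarrow> z \<in> {n / (k + b')<..<n / (k + a')} \<times> {n / e' - k<..<n / c' - k}"
        proof (cases "0 < fst z \<and> 0 < k + snd z")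
          case pz: True
          then have "branch n k z \<in> {a'<..<b'} \<times> {c'<..<e'} \<longleftrightarrow>
             k + a' < n / fst z \<and> n / fst z < k + b' \<and> c' < n / (k + snd z) \<and> n / (k + snd z) < e'"
            by (auto simp: branch_def mem_Times_iff)
          also have "\<dots> \<longleftrightarrow> fst z < n / (k + a') \<and> n / (k + b') < fst z \<and> k + snd z < n / c' \<and> n / e' < k + snd z"
          proof -
            have "0 < k + a'" "0 < k + b'" "0 < e'" using pos True k by auto
            then show ?thesis using pz pos by (simp add: field_simps)
          qed
          finally show ?thesis using pz by (auto simp: mem_Times_iff algebra_simps)
        next
          case nz: False
          have "n / (k + b') > 0" "n / e' > 0" using pos True k n by (auto intro!: divide_pos_pos)
          then show ?thesis using nz by (auto simp: mem_Times_iff)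
        qed
        finally show "z \<in> ?Q \<inter> branch n k -` X \<longleftrightarrow> z \<in> {n / (k + b')<..<n / (k + a')} \<times> {n / e' - k<..<n / c' - k}" .
      qed
      moreover have "emeasure ?M ({n / (k + b')<..<n / (k + a')} \<times> {n / e' - k<..<n / c' - k})
          = emeasure ?M ({a'<..<b'} \<times> {c'<..<e'})"
      proof -
        have ab: "n / (k + b') \<le> n / (k + a')" "n / (k + b') > 0"
          using pos True k n by (auto intro!: divide_left_mono)
        have ce: "n / e' - k \<le> n / c' - k"
          using pos True k n by (auto intro!: divide_left_mono mult_pos_pos)
        have e': "e' \<le> n / (k + c)" "0 < e'" using pos True unfolding e'_def by auto
        have "k + c \<le> n / e'" using e' k assms by (simp add: field_simps)
        then have c0: "n / e' - k \<ge> 0" using assms by linarith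
        have "emeasure ?M ({n / (k + b')<..<n / (k + a')} \<times> {n / e' - k<..<n / c' - k})
          = ennreal (log_cross n (n / (k + b')) (n / (k + a')) (n / e' - k) (n / c' - k))"
          using n ab ce c0 by (intro emeasure_mobius_rect) auto
        also have "log_cross n (n / (k + b')) (n / (k + a')) (n / e' - k) (n / c' - k)
          = log_cross n (n / (n / (k + a')) - k) (n / (n / (k + b')) - k) (n / (k + (n / c' - k))) (n / (k + (n / e' - k)))"
          by (rule log_cross_branch[symmetric]) (use n ab ce c0 k pos True in auto)
        also have "\<dots> = log_cross n a' b' c' e'" using n by simp
        also have "ennreal \<dots> = emeasure ?M ({a'<..<b'} \<times> {c'<..<e'})"
          using n pos True by (intro emeasure_mobius_rect[symmetric]) auto
        finally show ?thesis .
      qed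
      ultimately show ?thesis using XS by (simp add: P1 P2 RX)
    qed
  qed
  then show ?thesis using P1[OF S] P2[OF S] by simp
qed

section \<open>The slabs tile the staircase with their images\<close>

context matched_expansion begin

text \<open>
  The slab is the part of the staircase above the interior of the cylinder of digit \<open>k\<close>. Its image is
  described by means of the inverse branch, which makes it a Borel set without further argument.
\<close>

definition slab :: "nat \<Rightarrow> (real \<times> real) set" where
  "slab k = {z \<in> open_stairs. \<alpha> < n / fst z - real k \<and> n / fst z - real k < \<alpha> + 1}"

definition slab_image :: "nat \<Rightarrow> (real \<times> real) set" where
  "slab_image k = {z. \<alpha> < fst z \<and> fst z < \<alpha> + 1 \<and> cobranch n (real k) z \<in> open_stairs}"

lemma open_stairs_pos: "z \<in> open_stairs \<Longrightarrow> 0 < fst z \<and> 0 < snd z"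
  using \<alpha>_pos A_pos unfolding open_stairs_def by auto

lemma height_quotients:
  "A = n / (\<kappa> + E)" "B = n / (\<kappa> + D)" "C = n / (\<kappa> - 1 + E)"
  "D = n / (\<delta> + 1 + B)" "E = n / (\<delta> + C)" "F = n / (\<delta> + B)"
proof -
  have p: "\<kappa> + E > 0" "\<kappa> + D > 0" "\<kappa> - 1 + E > 0" "\<delta> + 1 + B > 0" "\<delta> + C > 0" "\<delta> + B > 0"
    using heights \<delta>_ge \<kappa>_ge by auto
  show "A = n / (\<kappa> + E)" using p A_eq E_def' by (simp add: eq_divide_eq algebra_simps)
  show "B = n / (\<kappa> + D)" using p B_matched by (simp add: eq_divide_eq algebra_simps)
  show "C = n / (\<kappa> - 1 + E)" using p C_eq E_def' by (simp add: eq_divide_eq algebra_simps)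
  show "D = n / (\<delta> + 1 + B)" using p D_eq by (simp add: eq_divide_eq algebra_simps)
  show "E = n / (\<delta> + C)" using p E_matched by (simp add: eq_divide_eq algebra_simps)
  show "F = n / (\<delta> + B)" using p B_eq F_def' by (simp add: eq_divide_eq algebra_simps)
qed

lemma orbit_quotient_bounds: "\<alpha> + \<delta> + 1 \<le> n / R2" "n / L2 \<le> \<alpha> + \<kappa>"
proof -
  have "n / (\<alpha> + 1) \<le> n / L2" using n_div_le_iff[of "\<alpha> + 1" L2] L2_pos L2_le \<alpha>_pos by simp
  then show "\<alpha> + \<delta> + 1 \<le> n / R2" using orbit_matching inverse_orbits R1_ge by linarith
  have "n / R2 \<le> n / \<alpha>" using n_div_le_iff[of R2 \<alpha>] R2_pos R2_ge \<alpha>_pos by simp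
  then show "n / L2 \<le> \<alpha> + \<kappa>" using orbit_matching inverse_orbits L1_le by linarith
qed

text \<open>
  Each of the six conditions on the image is an inequality between \<open>k + y\<close> and the denominator of the
  matching height in \<open>height_quotients\<close>. For all but one or two digits it follows from
  \<open>A < y < F\<close>; for the remaining ones the position of the image point relative to the step determines the
  position of \<open>x\<close> relative to another step, by the orbit relations.
\<close>

lemma branch_maps_stairs:
  assumes k: "d \<le> k" "k \<le> d + i" and z: "z \<in> slab k"
  shows "branch n (real k) z \<in> open_stairs"
proof -
  obtain x y where xy: "z = (x, y)" by (cases z)
  define K where "K = real k"
  define t where "t = n / x - K"
  define w where "w = n / (K + y)"
  have zz: "\<alpha> < x" "x < \<alpha> + 1" "A < y" "y < F" and
    low: "R2 \<le> x \<Longrightarrow> B < y" "L1 \<le> x \<Longrightarrow> C < y" and upp: "x \<le> L2 \<Longrightarrow> y < E" "x \<le> R1 \<Longrightarrow> y < D"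
    using z unfolding slab_def open_stairs_def xy mem_Collect_eq fst_conv snd_conv by argo+
  have t: "\<alpha> < t" "t < \<alpha> + 1" and nx: "n / x = K + t"
    using z unfolding slab_def xy t_def K_def by auto
  have x: "x > 0" using zz \<alpha>_pos by simp
  have K: "\<delta> \<le> K" "K \<le> \<kappa>" "K = \<delta> \<or> K = \<delta> + 1 \<or> K \<ge> \<delta> + 2" "K = \<kappa> \<or> K = \<kappa> - 1 \<or> K \<le> \<kappa> - 2"
  proof -
    show "\<delta> \<le> K" "K \<le> \<kappa>" using k unfolding K_def by auto
    have "real k = real d \<or> real k = real (d + 1) \<or> real (d + 2) \<le> real k"
      unfolding of_nat_le_iff of_nat_eq_iff using k by arith
    then show "K = \<delta> \<or> K = \<delta> + 1 \<or> K \<ge> \<delta> + 2" unfolding K_def by auto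
    have "real k = real (d + i) \<or> real (k + 1) = real (d + i) \<or> real (k + 2) \<le> real (d + i)"
      unfolding of_nat_le_iff of_nat_eq_iff using k by arith
    then show "K = \<kappa> \<or> K = \<kappa> - 1 \<or> K \<le> \<kappa> - 2" unfolding K_def by auto
  qed
  have Ky: "K + y > 0" using K \<delta>_ge zz A_pos by linarith
  have xge: "u \<le> x" if "n / x \<le> n / u" "u > 0" for u using n_div_le_iff[of x u] that x by simp
  have xle: "x \<le> u" if "n / u \<le> n / x" "u > 0" for u using n_div_le_iff[of u x] that x by simp
  have wlt: "w < n / v" if "v < K + y" "v > 0" for v using n_div_less_iff[of "K + y" v] that Ky unfolding w_def by simp
  have wgt: "n / v < w" if "K + y < v" for v using n_div_less_iff[of v "K + y"] that Ky unfolding w_def by simp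
  have hp: "\<delta> + B > 0" "\<delta> + C > 0" "\<delta> + 1 + B > 0" using heights \<delta>_ge by auto
  have E1: "E = A + 1" and F1: "F = B + 1" using E_def' F_def' by auto
  have "\<delta> + B < K + y"
  proof (cases "K = \<delta>")
    case True
    then have "R2 \<le> x" using nx t orbit_quotient_bounds R2_pos by (intro xge) auto
    then show ?thesis using low True by simp
  next
    case False
    then have "K \<ge> \<delta> + 1" using K by linarith
    then show ?thesis using zz E1 heights by linarith
  qed
  then have c1: "w < F" using wlt[of "\<delta> + B"] hp height_quotients(6) by simp
  have "K + y < \<kappa> + E"
  proof (cases "K = \<kappa>")
    case True
    then have "x \<le> L2" using nx t orbit_quotient_bounds L2_pos by (intro xle) auto
    then show ?thesis using upp True by simp
  next
    case False
    then have "K \<le> \<kappa> - 1" using K by linarith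
    then show ?thesis using zz F1 heights by linarith
  qed
  then have c2: "A < w" using wgt[of "\<kappa> + E"] height_quotients(1) by simp
  have c3: "B < w" if "R2 \<le> t"
  proof -
    have "K + y < \<kappa> + D"
    proof (cases "K = \<kappa>")
      case True
      then have "x \<le> R1" using nx that inverse_orbits R1_pos by (intro xle) auto
      then show ?thesis using upp True by simp
    next
      case False
      then have "K \<le> \<kappa> - 1" using K by linarith
      then show ?thesis using zz F1 heights by linarith
    qed
    then show ?thesis using wgt[of "\<kappa> + D"] height_quotients(2) by simp
  qed
  have c4: "C < w" if tL: "L1 \<le> t"
  proof -
    have K\<kappa>: "K \<noteq> \<kappa>"
    proof
      assume "K = \<kappa>"
      then have "x \<le> \<alpha>" using nx tL inverse_orbits \<alpha>_pos by (intro xle) auto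
      then show False using zz by simp
    qed
    have "K + y < \<kappa> - 1 + E"
    proof (cases "K = \<kappa> - 1")
      case True
      have "n / R2 \<le> n / \<alpha>" using n_div_le_iff[of R2 \<alpha>] R2_pos R2_ge \<alpha>_pos by simp
      then have "n / L2 \<le> n / x" using True nx tL inverse_orbits orbit_matching by linarith
      then have "x \<le> L2" using L2_pos by (intro xle) auto
      then show ?thesis using upp True by simp
    next
      case False
      then have "K \<le> \<kappa> - 2" using K K\<kappa> by linarith
      then show ?thesis using zz F1 heights by linarith
    qed
    then show ?thesis using wgt[of "\<kappa> - 1 + E"] height_quotients(3) by simp
  qed
  have c5: "w < E" if "t \<le> L2"
  proof -
    have "\<delta> + C < K + y"
    proof (cases "K = \<delta>")
      case True
      then have "L1 \<le> x" using nx that inverse_orbits L1_pos by (intro xge) auto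
      then show ?thesis using low True by simp
    next
      case False
      then have "K \<ge> \<delta> + 1" using K by linarith
      then show ?thesis using zz E1 heights by linarith
    qed
    then show ?thesis using wlt[of "\<delta> + C"] hp height_quotients(5) by simp
  qed
  have c6: "w < D" if tR: "t \<le> R1"
  proof -
    have K\<delta>: "K \<noteq> \<delta>"
    proof
      assume "K = \<delta>"
      then have "\<alpha> + 1 \<le> x" using nx tR inverse_orbits \<alpha>_pos by (intro xge) auto
      then show False using zz by simp
    qed
    have "\<delta> + 1 + B < K + y"
    proof (cases "K = \<delta> + 1")
      case True
      have "n / (\<alpha> + 1) \<le> n / L2" using n_div_le_iff[of "\<alpha> + 1" L2] L2_pos L2_le \<alpha>_pos by simp
      then have "n / x \<le> n / R2" using True nx tR inverse_orbits orbit_matching by linarith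
      then have "R2 \<le> x" using R2_pos by (intro xge) auto
      then show ?thesis using low True by simp
    next
      case False
      then have "K \<ge> \<delta> + 2" using K K\<delta> by linarith
      then show ?thesis using zz E1 heights by linarith
    qed
    then show ?thesis using wlt[of "\<delta> + 1 + B"] hp height_quotients(4) by simp
  qed
  have "branch n (real k) z = (t, w)" unfolding branch_def xy t_def w_def K_def by simp
  then show ?thesis using t c1 c2 c3 c4 c5 c6 unfolding open_stairs_def by simp
qed

text \<open>
  Equal images force \<open>y = y' + m\<close> with \<open>m\<close> the difference of the digits. For
  \<open>m \<ge> 2\<close> the staircase is not high enough. For \<open>m = 1\<close> the upper boundary at
  \<open>x\<close> exceeds the lower boundary at \<open>x'\<close> by at most 1, because the steps at \<open>L2\<close>
  and \<open>R2\<close> correspond to each other by \<open>orbit_matching\<close>.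
\<close>

lemma branch_disjoint_aux:
  assumes z: "z \<in> open_stairs" and z': "z' \<in> open_stairs" and "k < k'"
    and eq: "branch n (real k) z = branch n (real k') z'"
  shows False
proof -
  obtain x y x' y' where xy: "z = (x, y)" "z' = (x', y')" by (cases z, cases z')
  have pos: "x > 0" "y > 0" "x' > 0" "y' > 0" using open_stairs_pos z z' xy by force+
  define m where "m = real k' - real k"
  have "real k' = real (k + 1) \<or> real (k + 2) \<le> real k'"
    unfolding of_nat_le_iff of_nat_eq_iff using \<open>k < k'\<close> by arith
  then have m: "m = 1 \<or> m \<ge> 2" unfolding m_def by auto
  have 1: "n / x' = n / x + m" using eq unfolding branch_def xy m_def by simp
  have "n / (real k + y) = n / (real k' + y')" using eq unfolding branch_def xy by simp
  then have 2: "y = y' + m" using pos n_gt_1 unfolding m_def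
    by (simp add: frac_eq_eq field_simps)
  have zz: "A < y'" "y < F" and low: "R2 \<le> x' \<Longrightarrow> B < y'" and upp: "x \<le> L2 \<Longrightarrow> y < E"
    using z z' unfolding open_stairs_def xy mem_Collect_eq fst_conv snd_conv by argo+
  show False
  proof (cases "m = 1")
    case True
    show False
    proof (cases "x \<le> L2")
      case True
      then show False using upp 2 \<open>m = 1\<close> zz E_def' by linarith
    next
      case False
      then have "n / x < n / L2" using n_div_less_iff pos L2_pos by simp
      then have "n / x' < n / R2" using 1 \<open>m = 1\<close> orbit_matching by linarith
      then have "R2 \<le> x'" using n_div_less_iff[of x' R2] pos R2_pos by simp
      then show False using low 2 \<open>m = 1\<close> zz F_def' by linarith
    qed
  next
    case False
    then show False using m 2 zz heights E_def' F_def' by linarith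
  qed
qed

lemma branch_disjoint:
  assumes "z \<in> open_stairs" "z' \<in> open_stairs" "branch n (real k) z = branch n (real k') z'"
  shows "k = k'"
  using branch_disjoint_aux[OF assms(1,2) _ assms(3)] branch_disjoint_aux[OF assms(2,1) _ assms(3)[symmetric]]
  by (cases k k' rule: linorder_cases) auto

lemma open_stairs_borel [measurable, simp]: "open_stairs \<in> sets borel"
  by (rule borel_open[OF open_open_stairs])

lemma slab_subset: "slab k \<subseteq> open_stairs" unfolding slab_def by auto

lemma slab_borel [measurable, simp]: "slab k \<in> sets borel"
  unfolding slab_def by measurable

lemma slab_image_borel [measurable, simp]: "slab_image k \<in> sets borel"
  unfolding slab_image_def by measurable

lemma cobranch_stairs_pos:
  assumes "cobranch n (real k) z \<in> open_stairs" "fst z > 0"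
  shows "snd z > 0" 
proof -
  have "0 < n / snd z - real k" using open_stairs_pos[OF assms(1)] by (simp add: cobranch_def)
  then have "0 < n / snd z" by (smt (verit) of_nat_0_le_iff)
  then show ?thesis using n_gt_1 by (simp add: zero_less_divide_iff)
qed

lemma slab_image_D:
  assumes "z \<in> slab_image k"
  shows "cobranch n (real k) z \<in> slab k" "branch n (real k) (cobranch n (real k) z) = z"
proof -
  have z: "\<alpha> < fst z" "fst z < \<alpha> + 1" "cobranch n (real k) z \<in> open_stairs"
    using assms unfolding slab_image_def by auto
  have p: "fst z > 0" using z \<alpha>_pos by simp
  show "branch n (real k) (cobranch n (real k) z) = z"
    using n_gt_1 p cobranch_stairs_pos[OF z(3) p] by (intro branch_cobranch) auto
  then have "n / fst (cobranch n (real k) z) - real k = fst z" by (simp add: branch_def prod_eq_iff)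
  then show "cobranch n (real k) z \<in> slab k" using z unfolding slab_def by simp
qed

lemma slab_D:
  assumes "z \<in> slab k"
  shows "branch n (real k) z \<in> slab_image k" "cobranch n (real k) (branch n (real k) z) = z"
proof -
  have z: "z \<in> open_stairs" "\<alpha> < n / fst z - real k" "n / fst z - real k < \<alpha> + 1" using assms unfolding slab_def by auto
  show 1: "cobranch n (real k) (branch n (real k) z) = z"
    using n_gt_1 open_stairs_pos[OF z(1)] by (intro cobranch_branch) auto
  show "branch n (real k) z \<in> slab_image k" using z 1 unfolding slab_image_def by (simp add: branch_def)
qed

lemma slab_image_subset: "k \<in> {d..d+i} \<Longrightarrow> slab_image k \<subseteq> open_stairs"
proof
  fix z assume k: "k \<in> {d..d+i}" and z: "z \<in> slab_image k"
  then have "branch n (real k) (cobranch n (real k) z) \<in> open_stairs"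
    by (intro branch_maps_stairs slab_image_D) auto
  then show "z \<in> open_stairs" by (simp only: slab_image_D[OF z])
qed

lemma slab_image_disjoint: "disjoint_family slab_image"
proof -
  have "k = k'" if "z \<in> slab_image k" "z \<in> slab_image k'" for z k k'
  proof (rule branch_disjoint)
    show "cobranch n (real k) z \<in> open_stairs" "cobranch n (real k') z \<in> open_stairs"
      using that unfolding slab_image_def by auto
    show "branch n (real k) (cobranch n (real k) z) = branch n (real k') (cobranch n (real k') z)"
      using that by (simp only: slab_image_D)
  qed
  then show ?thesis unfolding disjoint_family_on_def by blast
qed

lemma slab_disjoint: "disjoint_family slab"
proof -
  have "k = k'" if "z \<in> slab k" "z \<in> slab k'" for z k k'
  proof -
    have "real k < real (k' + 1)" "real k' < real (k + 1)" using that unfolding slab_def by auto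
    then show ?thesis unfolding of_nat_less_iff by simp
  qed
  then show ?thesis unfolding disjoint_family_on_def by blast
qed

text \<open>
  The slab and its image are cut out of corresponding rectangles by one condition, membership of the source point in the
  staircase, so the statement about rectangles applies.
\<close>

lemma emeasure_slab:
  assumes "k \<in> {d..d+i}" "S \<in> sets borel"
  shows "emeasure (mobius_measure n) (slab k \<inter> branch n (real k) -` S) = emeasure (mobius_measure n) (slab_image k \<inter> S)"
proof -
  let ?k = "real k"
  have k: "?k \<ge> 1" using assms d_pos by auto
  define a where "a = n / (?k + (\<alpha> + 1))"
  define b where "b = n / (?k + \<alpha>)"
  have ab: "0 < a" "a \<le> b" "n / a - ?k = \<alpha> + 1" "n / b - ?k = \<alpha>"
    using k \<alpha>_pos n_gt_1 unfolding a_def b_def by (auto intro!: divide_left_mono)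
  have AF: "0 < A" "A < F" using heights by auto
  let ?S = "cobranch n ?k -` open_stairs \<inter> S"
  have S: "?S \<in> sets borel"
    using measurable_sets[OF cobranch_measurable, of open_stairs n ?k] assms(2) by auto
  have 1: "({a<..<b} \<times> {A<..<F}) \<inter> branch n ?k -` ?S = slab k \<inter> branch n ?k -` S"
  proof (rule set_eqI)
    fix z
    have "z \<in> {a<..<b} \<times> {A<..<F} \<and> cobranch n ?k (branch n ?k z) \<in> open_stairs \<longleftrightarrow> z \<in> slab k"
    proof
      assume z: "z \<in> {a<..<b} \<times> {A<..<F} \<and> cobranch n ?k (branch n ?k z) \<in> open_stairs"
      then have p: "0 < fst z" "0 < snd z" using ab AF by (auto simp: mem_Times_iff)
      then have "cobranch n ?k (branch n ?k z) = z" using n_gt_1 k by (intro cobranch_branch) auto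
      moreover have "n / b < n / fst z" "n / fst z < n / a" using z p ab n_gt_1 by (auto simp: mem_Times_iff intro!: divide_strict_left_mono)
      ultimately show "z \<in> slab k" using z ab unfolding slab_def by auto
    next
      assume z: "z \<in> slab k"
      then have zz: "\<alpha> < n / fst z - ?k" "n / fst z - ?k < \<alpha> + 1" "0 < fst z" "A < snd z" "snd z < F" "z \<in> open_stairs"
        using open_stairs_pos unfolding slab_def open_stairs_def by auto
      have "a < fst z" "fst z < b" using zz k \<alpha>_pos unfolding a_def b_def by (simp_all add: field_simps)
      then show "z \<in> {a<..<b} \<times> {A<..<F} \<and> cobranch n ?k (branch n ?k z) \<in> open_stairs"
        using zz slab_D(2)[OF z] by (auto simp: mem_Times_iff)
    qed
    then show "z \<in> ({a<..<b} \<times> {A<..<F}) \<inter> branch n ?k -` ?S \<longleftrightarrow> z \<in> slab k \<inter> branch n ?k -` S"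
      by (simp only: Int_iff vimage_eq conj_assoc[symmetric])
  qed
  have 2: "({\<alpha><..<\<alpha> + 1} \<times> {n / (?k + F)<..<n / (?k + A)}) \<inter> ?S = slab_image k \<inter> S"
  proof -
    have "z \<in> {\<alpha><..<\<alpha> + 1} \<times> {n / (?k + F)<..<n / (?k + A)} \<and> cobranch n ?k z \<in> open_stairs \<longleftrightarrow> z \<in> slab_image k" for z
    proof
      assume z: "z \<in> slab_image k"
      then have zz: "\<alpha> < fst z" "fst z < \<alpha> + 1" "cobranch n ?k z \<in> open_stairs" unfolding slab_image_def by auto
      have p: "snd z > 0" using cobranch_stairs_pos[OF zz(3)] zz \<alpha>_pos by simp
      have "A < n / snd z - ?k" "n / snd z - ?k < F" using zz unfolding open_stairs_def cobranch_def by auto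
      then have "n / (?k + F) < snd z" "snd z < n / (?k + A)" using p k AF by (simp_all add: field_simps)
      then show "z \<in> {\<alpha><..<\<alpha> + 1} \<times> {n / (?k + F)<..<n / (?k + A)} \<and> cobranch n ?k z \<in> open_stairs"
        using zz by (auto simp: mem_Times_iff)
    qed (auto simp: slab_image_def)
    then show ?thesis by (intro set_eqI) (simp only: Int_iff vimage_eq conj_assoc[symmetric])
  qed
  have "emeasure (mobius_measure n) (({a<..<b} \<times> {A<..<F}) \<inter> branch n ?k -` ?S) =
    emeasure (mobius_measure n) (({n / b - ?k<..<n / a - ?k} \<times> {n / (?k + F)<..<n / (?k + A)}) \<inter> ?S)"
    using n_gt_1 ab AF k S \<alpha>_pos by (intro branch_image_rect) auto
  then show ?thesis by (simp only: 1 2 ab)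
qed

end

section \<open>Total mass, invariance and the inverse map\<close>

context matched_expansion begin

text \<open>
  The integral of \<open>n / (n + x y)^2\<close> over the vertical fibre at \<open>x\<close>, for \<open>x\<close>
  outside the finitely many steps.
\<close>

definition stairs_density :: "real \<Rightarrow> real" where
  "stairs_density x =
     D / (n + D * x) * indicator {\<alpha><..<R1} x + E / (n + E * x) * indicator {R1<..<L2} x
     + F / (n + F * x) * indicator {L2<..<\<alpha> + 1} x - A / (n + A * x) * indicator {\<alpha><..<R2} x
     - B / (n + B * x) * indicator {R2<..<L1} x - C / (n + C * x) * indicator {L1<..<\<alpha> + 1} x"

lemma stairs_density_measurable [measurable]: "stairs_density \<in> borel_measurable borel"
  unfolding stairs_density_def by measurable

lemma fraction_mono:
  assumes "0 \<le> c" "c < e" "x > 0"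
  shows "c / (n + c * x) < e / (n + e * x)"
proof -
  have "n + c * x > 0" "n + e * x > 0" using assms n_gt_1 by (auto intro!: add_pos_nonneg)
  moreover have "c * (n + e * x) < e * (n + c * x)" using assms n_gt_1 by (simp add: algebra_simps)
  ultimately show ?thesis by (simp add: pos_divide_less_eq pos_less_divide_eq)
qed

text \<open>
  At a step of the staircase the open intervals in \<open>stairs_density\<close> leave out a term, so pointwise
  statements exclude these points.
\<close>

definition generic :: "real \<Rightarrow> bool" where
  "generic x \<longleftrightarrow> x \<noteq> \<alpha> \<and> x \<noteq> \<alpha> + 1 \<and> x \<noteq> R1 \<and> x \<noteq> R2 \<and> x \<noteq> L1 \<and> x \<noteq> L2"

lemma AE_generic: "AE x in lborel. generic x"
  using AE_lborel_singleton[of \<alpha>] AE_lborel_singleton[of "\<alpha> + 1"] AE_lborel_singleton[of R1]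
    AE_lborel_singleton[of R2] AE_lborel_singleton[of L1] AE_lborel_singleton[of L2]
  unfolding generic_def by eventually_elim auto

lemma fibre_bounds:
  assumes "generic x"
  obtains b t where "0 < b" "b < t" "{y. (x, y) \<in> open_stairs} = {b<..<t}" "x > 0"
      "stairs_density x = t / (n + t * x) - b / (n + b * x)" "\<alpha> < x" "x < \<alpha> + 1"
  | "{y. (x, y) \<in> open_stairs} = {}" "stairs_density x = 0" "\<not> (\<alpha> < x \<and> x < \<alpha> + 1)"
proof (cases "\<alpha> < x \<and> x < \<alpha> + 1")
  case x: True
  define b where "b = (if x < R2 then A else if x < L1 then B else C)"
  define t where "t = (if x < R1 then D else if x < L2 then E else F)"
  have ne: "x \<noteq> R1" "x \<noteq> R2" "x \<noteq> L1" "x \<noteq> L2" using assms unfolding generic_def by auto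
  have h: "A < B" "B < C" "D < E" "E < F" "0 < A" "B < D" "C < E" using heights by auto
  have "b \<le> B \<and> D \<le> t \<or> b \<le> C \<and> E \<le> t" "0 < b"
    using h R1_less_L1 unfolding b_def t_def by (auto split: if_splits)
  then have bt: "0 < b" "b < t" using h by auto
  have fib: "{y. (x, y) \<in> open_stairs} = {b<..<t}"
  proof (rule set_eqI)
    fix y
    have le: "R2 \<le> x \<longleftrightarrow> R2 < x" "L1 \<le> x \<longleftrightarrow> L1 < x" "x \<le> L2 \<longleftrightarrow> x < L2" "x \<le> R1 \<longleftrightarrow> x < R1"
      using ne by auto
    have "b < y \<longleftrightarrow> A < y \<and> (R2 < x \<longrightarrow> B < y) \<and> (L1 < x \<longrightarrow> C < y)"
    proof -
      consider "x < R2" | "R2 < x" "x < L1" | "L1 < x" using ne by linarith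
      then show ?thesis unfolding b_def using h(1,2) R2_le_L1 by cases auto
    qed
    moreover have "y < t \<longleftrightarrow> y < F \<and> (x < L2 \<longrightarrow> y < E) \<and> (x < R1 \<longrightarrow> y < D)"
    proof -
      consider "x < R1" | "R1 < x" "x < L2" | "L2 < x" using ne by linarith
      then show ?thesis unfolding t_def using h(3,4) R1_le_L2 by cases auto
    qed
    ultimately show "y \<in> {y. (x, y) \<in> open_stairs} \<longleftrightarrow> y \<in> {b<..<t}"
      unfolding open_stairs_def mem_Collect_eq fst_conv snd_conv le greaterThanLessThan_iff using x by argo
  qed
  have "A / (n + A * x) * indicator {\<alpha><..<R2} x + B / (n + B * x) * indicator {R2<..<L1} x
      + C / (n + C * x) * indicator {L1<..<\<alpha> + 1} x = b / (n + b * x)"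
    using x ne R2_le_L1 unfolding b_def by (auto simp: indicator_def)
  moreover have "D / (n + D * x) * indicator {\<alpha><..<R1} x + E / (n + E * x) * indicator {R1<..<L2} x
     + F / (n + F * x) * indicator {L2<..<\<alpha> + 1} x = t / (n + t * x)"
    using x ne R1_le_L2 unfolding t_def by (auto simp: indicator_def)
  ultimately have "stairs_density x = t / (n + t * x) - b / (n + b * x)"
    unfolding stairs_density_def by linarith
  then show ?thesis using that(1) bt fib x \<alpha>_pos by auto
next
  case False
  then have "stairs_density x = 0"
    using orbit_order unfolding stairs_density_def by (auto simp: indicator_def)
  moreover have "{y. (x, y) \<in> open_stairs} = {}" using False unfolding open_stairs_def by auto
  ultimately show ?thesis using that(2) False by auto
qed

lemma stairs_density_nonneg: "generic x \<Longrightarrow> 0 \<le> stairs_density x"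
proof (erule fibre_bounds)
  fix b t assume "0 < b" "b < t" "0 < x" "stairs_density x = t / (n + t * x) - b / (n + b * x)"
  then show ?thesis using fraction_mono[of b t x] by simp
qed simp

lemma stairs_density_pos: 
  assumes "generic x" "\<alpha> < x" "x < \<alpha> + 1"
  shows "0 < stairs_density x"
  using assms(1)
proof (rule fibre_bounds)
  fix b t assume "0 < b" "b < t" "0 < x" "stairs_density x = t / (n + t * x) - b / (n + b * x)"
  then show ?thesis using fraction_mono[of b t x] by simp
qed (use assms in simp)

lemma fibre_integral:
  assumes "generic x"
  shows "(\<integral>\<^sup>+y. ennreal (mobius_density n (x, y)) * indicator open_stairs (x, y) \<partial>lborel) = ennreal (stairs_density x)"
proof (rule fibre_bounds[OF assms])
  fix b t
  assume *: "0 < b" "b < t" "{y. (x, y) \<in> open_stairs} = {b<..<t}" "x > 0"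
    "stairs_density x = t / (n + t * x) - b / (n + b * x)"
  have "indicator open_stairs (x, y) = (indicator {b<..<t} y :: ennreal)" for y
    using *(3) by (auto simp: indicator_def)
  then show ?thesis using * n_gt_1 by (simp add: nn_integral_mobius_fibre)
next
  assume *: "{y. (x, y) \<in> open_stairs} = {}" "stairs_density x = 0"
  then have "indicator open_stairs (x, y) = (0 :: ennreal)" for y by (auto simp: indicator_def)
  then show ?thesis using * by simp
qed

lemma emeasure_strip:
  assumes X [measurable]: "X \<in> sets borel"
  shows "emeasure (mobius_measure n) (open_stairs \<inter> fst -` X) = (\<integral>\<^sup>+x. ennreal (stairs_density x) * indicator X x \<partial>lborel)"
proof -
  have fX [measurable]: "fst -` X \<in> sets (borel :: (real \<times> real) measure)"
    using measurable_sets[OF borel_pair_fst_snd(1) X] by simp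
  let ?f = "\<lambda>z. ennreal (mobius_density n z) * indicator (open_stairs \<inter> fst -` X) z"
  have "emeasure (mobius_measure n) (open_stairs \<inter> fst -` X) = (\<integral>\<^sup>+z. ?f z \<partial>lborel)"
    unfolding mobius_measure_def by (subst emeasure_density) auto
  also have "\<dots> = (\<integral>\<^sup>+x. \<integral>\<^sup>+y. ?f (x, y) \<partial>lborel \<partial>lborel)"
  proof -
    have "?f \<in> borel_measurable (lborel \<Otimes>\<^sub>M lborel)"
      unfolding lborel_prod by simp
    from lborel.nn_integral_fst[OF this, symmetric] show ?thesis by (simp only: lborel_prod)
  qed
  also have "\<dots> = (\<integral>\<^sup>+x. ennreal (stairs_density x) * indicator X x \<partial>lborel)"
  proof (rule nn_integral_cong_AE, use AE_generic in eventually_elim)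
    fix x assume g: "generic x"
    show "(\<integral>\<^sup>+y. ?f (x, y) \<partial>lborel) = ennreal (stairs_density x) * indicator X x"
      using fibre_integral[OF g] by (cases "x \<in> X") (auto simp: indicator_def)
  qed
  finally show ?thesis .
qed

lemma has_bochner_integral_fraction:
  assumes "0 \<le> a" "a \<le> b" "0 < T"
  shows "has_bochner_integral lborel (\<lambda>x. T / (n + T * x) * indicator {a<..<b} x) (ln (n + T * b) - ln (n + T * a))"
proof (rule has_bochner_integral_nn_integral)
  have p: "n + T * x > 0" if "a \<le> x" for x using assms that n_gt_1 by (auto intro!: add_pos_nonneg)
  have "(\<integral>\<^sup>+x. ennreal (T / (n + T * x)) * indicator {a<..<b} x \<partial>lborel) = ennreal (ln (n + T * b) - ln (n + T * a))"
    using assms p by (intro nn_integral_open_interval) (auto intro!: derivative_eq_intros less_imp_le)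
  then show "(\<integral>\<^sup>+x. ennreal (T / (n + T * x) * indicator {a<..<b} x) \<partial>lborel) = ennreal (ln (n + T * b) - ln (n + T * a))"
  proof -
    have "ennreal (T / (n + T * x) * indicator {a<..<b} x) = ennreal (T / (n + T * x)) * indicator {a<..<b} x" for x
      by (simp add: indicator_def)
    then show ?thesis using \<open>(\<integral>\<^sup>+x. ennreal (T / (n + T * x)) * indicator {a<..<b} x \<partial>lborel) = _\<close> by (simp only:)
  qed
  show "AE x in lborel. 0 \<le> T / (n + T * x) * indicator {a<..<b} x"
    using p assms by (auto simp: indicator_def less_imp_le)
  show "0 \<le> ln (n + T * b) - ln (n + T * a)" using p[of a] p[of b] assms by simp
qed measurable

definition total_mass :: real where
  "total_mass = 2 * ln A + 2 * ln (B + 1) - ln (n - (A + 1) * \<delta>) - ln (n - \<kappa> * B)"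

text \<open>
  The companion of \<open>ln_branch_cross_term\<close> for the pairs of points \<open>(x, y)\<close> and
  \<open>(x', y - 1)\<close> that have the same image under consecutive branches.
\<close>

lemma ln_shift:
  assumes "n / x' = n / x + 1" "y' = y - 1" "x > 0" "x' > 0" "y \<ge> 0"
  shows "ln (n + y' * x') = ln (n + y * x) + ln x' - ln x"
proof -
  have "n + y' * x' = x' * (n / x' + y')" using assms(4) by (simp add: algebra_simps)
  also have "\<dots> = x' * (n / x + y)" using assms by simp
  also have "\<dots> = x' * (n + y * x) / x" using assms by (simp add: field_simps)
  finally have eq: "n + y' * x' = x' * (n + y * x) / x" .
  have "n + y * x > 0" using assms n_gt_1 by (auto intro!: add_pos_nonneg)
  moreover have "ln (x' * p / x) = ln p + ln x' - ln x" if "p > 0" for p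
    using that assms by (simp add: ln_mult ln_div)
  ultimately show ?thesis unfolding eq by blast
qed

text \<open>
  The fibre integrals contribute the logarithms of \<open>n + x y\<close> at the twelve vertices. The edge relations
  \<open>e1\<close> to \<open>e10\<close> express them through those at \<open>(\<alpha>, A)\<close>,
  \<open>(\<alpha>, D)\<close>, \<open>(\<alpha> + 1, C)\<close> and \<open>(\<alpha> + 1, F)\<close>. The vertices
  \<open>(R2, A)\<close> and \<open>(L2, F)\<close> are reached in two ways, which eliminates these four as well.
\<close>

lemma stairs_density_integral: "has_bochner_integral lborel stairs_density total_mass"
proof -
  have step: "ln (n + y' * x') = ln (n + y * x) + ln y' - ln x"
    if "x' = n / x - k" "y' = n / (k + y)" "k > 0" "x > 0" "y \<ge> 0" for x x' y y' k
    using ln_branch_cross_term[of n k x y] that n_gt_1 by (simp add: mult.commute)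
  have pos: "L1 > 0" "L2 > 0" "R1 > 0" "R2 > 0" "\<alpha> > 0" "\<alpha> + 1 > 0" "\<delta> > 0" "\<kappa> > 0" "A > 0" "B > 0" "C > 0" "D > 0" "E > 0" "F > 0"
    using L1_pos L2_pos R1_pos R2_pos \<alpha>_pos \<delta>_ge \<kappa>_ge heights by auto
  have q: "C = n / (\<kappa> + A)" "D = n / (\<delta> + F)"
    using height_quotients(3,4) unfolding E_def' F_def' by (simp_all add: algebra_simps)
  have e1: "ln (n + C * L1) = ln (n + A * \<alpha>) + ln C - ln \<alpha>"
    using pos q(1) inverse_orbits by (intro step[where k = \<kappa>]) auto
  have e2: "ln (n + E * L2) = ln (n + C * L1) + ln E - ln L1"
    using pos height_quotients(5) inverse_orbits by (intro step[where k = \<delta>]) auto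
  have e3: "ln (n + A * R2) = ln (n + E * L2) + ln R2 - ln L2"
    using pos E_def' orbit_matching by (intro ln_shift) auto
  have e4: "ln (n + E * R1) = ln (n + C * (\<alpha> + 1)) + ln E - ln (\<alpha> + 1)"
    using pos height_quotients(5) inverse_orbits by (intro step[where k = \<delta>]) auto
  have e5: "ln (n + A * R2) = ln (n + E * R1) + ln A - ln R1"
    using pos height_quotients(1) inverse_orbits by (intro step[where k = \<kappa>]) auto
  have e6: "ln (n + D * R1) = ln (n + F * (\<alpha> + 1)) + ln D - ln (\<alpha> + 1)"
    using pos q(2) inverse_orbits by (intro step[where k = \<delta>]) auto
  have e7: "ln (n + B * R2) = ln (n + D * R1) + ln B - ln R1"
    using pos height_quotients(2) inverse_orbits by (intro step[where k = \<kappa>]) auto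
  have e8: "ln (n + B * R2) = ln (n + F * L2) + ln R2 - ln L2"
    using pos F_def' orbit_matching by (intro ln_shift) auto
  have e9: "ln (n + B * L1) = ln (n + D * \<alpha>) + ln B - ln \<alpha>"
    using pos height_quotients(2) inverse_orbits by (intro step[where k = \<kappa>]) auto
  have e10: "ln (n + F * L2) = ln (n + B * L1) + ln F - ln L1"
    using pos height_quotients(6) inverse_orbits by (intro step[where k = \<delta>]) auto
  have "n - (A + 1) * \<delta> = E * C" "n - \<kappa> * B = B * D"
    using E_matched B_matched E_def' by (simp_all add: algebra_simps)
  then have e11: "ln (n - (A + 1) * \<delta>) = ln E + ln C" "ln (n - \<kappa> * B) = ln B + ln D"
    using pos by (simp_all add: ln_mult)
  have mass: "total_mass = (ln (n + D * R1) - ln (n + D * \<alpha>)) + (ln (n + E * L2) - ln (n + E * R1))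
     + (ln (n + F * (\<alpha> + 1)) - ln (n + F * L2)) - (ln (n + A * R2) - ln (n + A * \<alpha>))
     - (ln (n + B * L1) - ln (n + B * R2)) - (ln (n + C * (\<alpha> + 1)) - ln (n + C * L1))"
    unfolding total_mass_def e11 F_def'[symmetric]
    using e1 e2 e3 e4 e5 e6 e7 e8 e9 e10 by linarith
  show ?thesis
    unfolding stairs_density_def[abs_def] mass
    by (intro has_bochner_integral_add has_bochner_integral_diff has_bochner_integral_fraction)
      (use pos orbit_order in linarith)+
qed

lemma emeasure_stairs: "emeasure (mobius_measure n) open_stairs = ennreal total_mass"
proof -
  have ge: "AE x in lborel. 0 \<le> stairs_density x"
    using AE_generic by eventually_elim (rule stairs_density_nonneg)
  have "emeasure (mobius_measure n) open_stairs = (\<integral>\<^sup>+x. ennreal (stairs_density x) \<partial>lborel)"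
    using emeasure_strip[of UNIV] by simp
  also have "\<dots> = ennreal total_mass"
    using stairs_density_integral ge
    by (subst nn_integral_eq_integral) (auto simp: has_bochner_integral_iff)
  finally show ?thesis .
qed

lemma total_mass_pos: "total_mass > 0"
proof (rule ccontr)
  assume "\<not> ?thesis"
  then have "(\<integral>\<^sup>+x. ennreal (stairs_density x) \<partial>lborel) = 0"
    using emeasure_stairs emeasure_strip[of UNIV] by (simp add: ennreal_neg)
  then have "AE x in lborel. stairs_density x \<le> 0"
    by (subst (asm) nn_integral_0_iff_AE) (auto simp: ennreal_eq_0_iff)
  then have "AE x in lborel. x \<notin> {\<alpha><..<\<alpha>+1}"
    using AE_generic by eventually_elim (use stairs_density_pos in force)
  then have "{\<alpha><..<\<alpha>+1} \<in> null_sets lborel" by (subst AE_iff_null_sets) auto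
  then have "emeasure lborel {\<alpha><..<\<alpha>+1} = 0" by (rule null_setsD1)
  then show False by simp
qed

definition H :: real where "H = Hconst N d i"

lemma H_eq: "H = 1 / total_mass" and H_pos: "H > 0"
  using total_mass_pos unfolding H_def Hconst_def total_mass_def by (simp_all add: inverse_eq_divide)

lemma dens1_eq: "dens1 N d i \<alpha> x = H * stairs_density x"
  unfolding dens1_def stairs_density_def H_def ..

text \<open>
  The measure of the theorem, extended by zero to the plane, where maps need not be restricted to the polygon in order
  to be measurable.
\<close>

definition M0 :: "(real \<times> real) measure" where
  "M0 = density lborel (\<lambda>z. ennreal (H * mobius_density n z * indicator open_stairs z))"

lemma sets_M0 [measurable_cong, simp]: "sets M0 = sets borel" and space_M0 [simp]: "space M0 = UNIV"
  unfolding M0_def by simp_all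

lemma emeasure_M0:
  assumes [measurable]: "X \<in> sets borel"
  shows "emeasure M0 X = ennreal H * emeasure (mobius_measure n) (open_stairs \<inter> X)"
proof -
  have "emeasure M0 X = (\<integral>\<^sup>+z. ennreal H * (ennreal (mobius_density n z) * indicator (open_stairs \<inter> X) z) \<partial>lborel)"
    unfolding M0_def using H_pos n_gt_1
    by (subst emeasure_density)
       (auto intro!: nn_integral_cong simp: indicator_def ennreal_mult'[symmetric] mobius_density_def)
  also have "\<dots> = ennreal H * (\<integral>\<^sup>+z. (ennreal (mobius_density n z) * indicator (open_stairs \<inter> X) z) \<partial>lborel)"
    by (rule nn_integral_cmult) measurable
  also have "\<dots> = ennreal H * emeasure (mobius_measure n) (open_stairs \<inter> X)"
    unfolding mobius_measure_def by (subst emeasure_density) auto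
  finally show ?thesis .
qed

lemma prob_space_M0: "prob_space M0"
proof
  have "emeasure M0 (space M0) = ennreal H * ennreal total_mass" by (simp add: emeasure_M0 emeasure_stairs)
  also have "\<dots> = 1" using total_mass_pos by (simp add: H_eq ennreal_mult[symmetric])
  finally show "emeasure M0 (space M0) = 1" .
qed

sublocale M0: prob_space M0 by (rule prob_space_M0)

lemma AE_M0_stairs: "AE z in M0. z \<in> open_stairs"
  unfolding M0_def by (subst AE_density) (auto simp: indicator_def)

lemma slab_range: "z \<in> slab k \<Longrightarrow> k \<in> {d..d+i}"
proof -
  assume z: "z \<in> slab k"
  then have zz: "\<alpha> < fst z" "fst z < \<alpha> + 1" "\<alpha> < n / fst z - real k" "n / fst z - real k < \<alpha> + 1"
    unfolding slab_def open_stairs_def by auto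
  have "n / fst z < n / \<alpha>" using n_div_less_iff[of "fst z" \<alpha>] zz \<alpha>_pos by simp
  then have "real k < real (d + i + 1)" using zz inverse_orbits L1_le by auto
  moreover have "n / (\<alpha> + 1) < n / fst z" using n_div_less_iff[of "\<alpha> + 1" "fst z"] zz \<alpha>_pos by simp
  then have "real d < real (k + 1)" using zz inverse_orbits R1_ge by auto
  ultimately show ?thesis unfolding of_nat_less_iff by simp
qed

lemma slab_image_range: "z \<in> slab_image k \<Longrightarrow> k \<in> {d..d+i}"
  using slab_range slab_image_D by blast

definition slabs :: "(real \<times> real) set" where "slabs = (\<Union>k. slab k)"
definition slab_images :: "(real \<times> real) set" where "slab_images = (\<Union>k. slab_image k)"

lemma slabs_borel [measurable, simp]: "slabs \<in> sets borel" and slab_images_borel [measurable, simp]: "slab_images \<in> sets borel"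
  unfolding slabs_def slab_images_def by auto

lemma slabs_subset: "slabs \<subseteq> open_stairs" and slab_images_subset: "slab_images \<subseteq> open_stairs"
  unfolding slabs_def slab_images_def using slab_subset slab_image_subset slab_image_range by blast+

lemma stairs_minus_slabs_null: "open_stairs - slabs \<in> null_sets lborel"
proof (rule null_sets_subset)
  show "(\<Union>k::nat. {z :: real \<times> real. fst z = n / (\<alpha> + real k)}) \<in> null_sets lborel"
    by (intro null_sets_UN vertical_line_null)
  show "open_stairs - slabs \<in> sets lborel" by simp
  show "open_stairs - slabs \<subseteq> (\<Union>k::nat. {z. fst z = n / (\<alpha> + real k)})"
  proof
    fix z assume z: "z \<in> open_stairs - slabs"
    then have zz: "\<alpha> < fst z" "fst z < \<alpha> + 1" unfolding open_stairs_def by auto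
    have "n / (\<alpha> + 1) < n / fst z" using n_div_less_iff[of "\<alpha> + 1" "fst z"] zz \<alpha>_pos by simp
    then have ge: "n / fst z - \<alpha> > 0" using inverse_orbits R1_ge \<delta>_ge by linarith
    define k where "k = nat \<lfloor>n / fst z - \<alpha>\<rfloor>"
    have k: "real k \<le> n / fst z - \<alpha>" "n / fst z - \<alpha> < real k + 1" 
      using ge unfolding k_def by (auto simp: of_nat_nat)
    have "z \<notin> slab k" using z unfolding slabs_def by auto
    then have "\<not> \<alpha> < n / fst z - real k" using z k unfolding slab_def by auto
    then have "n / fst z = \<alpha> + real k" using k by linarith
    then have "fst z = n / (\<alpha> + real k)" using n_gt_1 zz \<alpha>_pos by (auto simp: field_simps)
    then show "z \<in> (\<Union>k::nat. {z. fst z = n / (\<alpha> + real k)})" by blast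
  qed
qed

abbreviation "TT \<equiv> TTmap N \<alpha>"

lemma digit_measurable [measurable]: "(\<lambda>x. real_of_int (digit N \<alpha> x)) \<in> borel_measurable borel"
proof -
  define c where "c = (if n / \<alpha> - \<alpha> \<in> \<int> then \<lfloor>n / \<alpha> - \<alpha>\<rfloor> - 1 else \<lfloor>n / \<alpha> - \<alpha>\<rfloor>)"
  have "(\<lambda>x. real_of_int (digit N \<alpha> x)) = (\<lambda>x. if x = \<alpha> then real_of_int c else real_of_int \<lfloor>n / x - \<alpha>\<rfloor>)"
    unfolding digit_def c_def by (auto simp: fun_eq_iff)
  then show ?thesis by simp
qed

lemma Tmap_measurable [measurable]: "Tmap N \<alpha> \<in> borel_measurable borel"
  unfolding Tmap_def[abs_def] by measurable

lemma TT_alt: "TT z = (Tmap N \<alpha> (fst z), n / (real_of_int (digit N \<alpha> (fst z)) + snd z))"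
  unfolding TTmap_def by (cases z) simp

lemma TT_measurable [measurable]: "TT \<in> borel_measurable borel"
  unfolding TT_alt[abs_def] by measurable

lemma digit_slab: "z \<in> slab k \<Longrightarrow> digit N \<alpha> (fst z) = int k"
proof -
  assume z: "z \<in> slab k"
  then have zz: "\<alpha> < fst z" "\<alpha> < n / fst z - real k" "n / fst z - real k < \<alpha> + 1"
    unfolding slab_def open_stairs_def by auto
  then have "\<lfloor>n / fst z - \<alpha>\<rfloor> = int k" by (intro floor_unique) auto
  then show ?thesis using zz unfolding digit_def by simp
qed

lemma TT_slab: "z \<in> slab k \<Longrightarrow> TT z = branch n (real k) z"
  using digit_slab unfolding TT_alt Tmap_def branch_def by simp

text \<open>
  The slab images are disjoint, so the least index is the only one; choosing it by \<open>LEAST\<close> gives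
  measurability at once.
\<close>

definition inv_TT :: "real \<times> real \<Rightarrow> real \<times> real" where
  "inv_TT z = cobranch n (real (LEAST k. z \<in> slab_image k)) z"

lemma inv_TT_measurable [measurable]: "inv_TT \<in> borel_measurable borel"
proof -
  have [measurable]: "(\<lambda>z. LEAST k. z \<in> slab_image k) \<in> measurable borel (count_space UNIV)"
    by measurable
  show ?thesis unfolding inv_TT_def[abs_def] cobranch_def by measurable
qed

lemma inv_TT_slab_image: "z \<in> slab_image k \<Longrightarrow> inv_TT z = cobranch n (real k) z"
proof -
  assume z: "z \<in> slab_image k"
  then have "(LEAST k. z \<in> slab_image k) = k"
    using slab_image_disjoint LeastI[of "\<lambda>k. z \<in> slab_image k" k] unfolding disjoint_family_on_def by blast
  then show ?thesis unfolding inv_TT_def by simp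
qed

lemma TT_slabs:
  assumes "z \<in> slabs"
  shows "TT z \<in> slab_images" "inv_TT (TT z) = z"
proof -
  obtain k where k: "z \<in> slab k" using assms unfolding slabs_def by blast
  have T: "TT z \<in> slab_image k" using slab_D(1)[OF k] by (simp only: TT_slab[OF k])
  then show "TT z \<in> slab_images" unfolding slab_images_def by blast
  show "inv_TT (TT z) = z" unfolding inv_TT_slab_image[OF T] unfolding TT_slab[OF k] by (rule slab_D(2)[OF k])
qed

lemma inv_TT_slab_images:
  assumes "z \<in> slab_images"
  shows "inv_TT z \<in> slabs" "TT (inv_TT z) = z"
proof -
  obtain k where k: "z \<in> slab_image k" using assms unfolding slab_images_def by blast
  have T: "inv_TT z \<in> slab k" using slab_image_D(1)[OF k] by (simp only: inv_TT_slab_image[OF k])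
  then show "inv_TT z \<in> slabs" unfolding slabs_def by blast
  show "TT (inv_TT z) = z" unfolding TT_slab[OF T] unfolding inv_TT_slab_image[OF k] by (rule slab_image_D(2)[OF k])
qed

lemma null_sets_mobius: "X \<in> null_sets lborel \<Longrightarrow> X \<in> null_sets (mobius_measure n)"
  using absolutely_continuousI_density[of "\<lambda>z. ennreal (mobius_density n z)" lborel]
  unfolding absolutely_continuous_def mobius_measure_def by auto

lemma emeasure_slabs_Int:
  assumes "X \<in> sets borel"
  shows "emeasure (mobius_measure n) (slabs \<inter> X) = emeasure (mobius_measure n) (open_stairs \<inter> X)"
proof -
  have "open_stairs - slabs \<in> null_sets (mobius_measure n)" using stairs_minus_slabs_null by (rule null_sets_mobius)
  moreover have "open_stairs \<inter> X = (slabs \<inter> X) \<union> ((open_stairs - slabs) \<inter> X)" using slabs_subset by auto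
  ultimately show ?thesis
    using assms by (simp add: emeasure_Un_null_set null_set_Int2)
qed

lemma emeasure_slabs_TT:
  assumes "S \<in> sets borel"
  shows "emeasure (mobius_measure n) (slabs \<inter> TT -` S) = emeasure (mobius_measure n) (slab_images \<inter> S)"
proof -
  let ?M = "mobius_measure n"
  have m: "branch n (real k) -` S \<in> sets borel" for k
    using measurable_sets[OF branch_measurable assms] by simp
  have dj: "disjoint_family (\<lambda>k. slab k \<inter> branch n (real k) -` S)" "disjoint_family (\<lambda>k. slab_image k \<inter> S)"
    using slab_disjoint slab_image_disjoint unfolding disjoint_family_on_def by blast+
  have "slabs \<inter> TT -` S = (\<Union>k. slab k \<inter> branch n (real k) -` S)"
    unfolding slabs_def using TT_slab by auto
  then have "emeasure ?M (slabs \<inter> TT -` S) = (\<Sum>k. emeasure ?M (slab k \<inter> branch n (real k) -` S))"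
    using m dj by (auto intro!: suminf_emeasure[symmetric])
  also have "\<dots> = (\<Sum>k. emeasure ?M (slab_image k \<inter> S))"
  proof (rule suminf_cong)
    fix k
    show "emeasure ?M (slab k \<inter> branch n (real k) -` S) = emeasure ?M (slab_image k \<inter> S)"
    proof (cases "k \<in> {d..d+i}")
      case False
      then have "slab k = {}" "slab_image k = {}" using slab_range slab_image_range by blast+
      then show ?thesis by simp
    qed (rule emeasure_slab[OF _ assms])
  qed
  also have "\<dots> = emeasure ?M (\<Union>k. slab_image k \<inter> S)"
    using assms dj by (intro suminf_emeasure) auto
  also have "(\<Union>k. slab_image k \<inter> S) = slab_images \<inter> S" unfolding slab_images_def by auto
  finally show ?thesis .
qed

text \<open>
  The images fill the staircase since they have the same finite measure.
\<close>

lemma stairs_minus_slab_images_null: "open_stairs - slab_images \<in> null_sets (mobius_measure n)"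
proof -
  let ?M = "mobius_measure n"
  have "emeasure ?M slab_images = emeasure ?M open_stairs"
    using emeasure_slabs_TT[of UNIV] emeasure_slabs_Int[of UNIV] by simp
  then have "emeasure ?M (open_stairs - slab_images) = 0"
    using emeasure_stairs slab_images_subset by (subst emeasure_Diff) auto
  then show ?thesis by (simp add: null_sets_def)
qed

lemma emeasure_slab_images_Int:
  assumes "X \<in> sets borel"
  shows "emeasure (mobius_measure n) (slab_images \<inter> X) = emeasure (mobius_measure n) (open_stairs \<inter> X)"
proof -
  have "open_stairs \<inter> X = (slab_images \<inter> X) \<union> ((open_stairs - slab_images) \<inter> X)" using slab_images_subset by auto
  then show ?thesis
    using assms stairs_minus_slab_images_null by (simp add: emeasure_Un_null_set null_set_Int2)
qed

lemma AE_M0_I: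
  assumes "X \<in> sets borel" "open_stairs - X \<in> null_sets (mobius_measure n)"
  shows "AE z in M0. z \<in> X"
proof -
  have "emeasure M0 (- X) = 0"
    using assms by (subst emeasure_M0) (auto simp: Diff_eq null_sets_def)
  then have "- X \<in> null_sets M0" using assms by (auto simp: null_sets_def)
  then show ?thesis using AE_not_in by fastforce
qed

lemma AE_slabs: "AE z in M0. z \<in> slabs" and AE_slab_images: "AE z in M0. z \<in> slab_images"
  using AE_M0_I stairs_minus_slabs_null null_sets_mobius stairs_minus_slab_images_null by auto

lemma distr_TT: "distr M0 M0 TT = M0"
proof (rule measure_eqI)
  fix S assume "S \<in> sets (distr M0 M0 TT)"
  then have S: "S \<in> sets borel" by simp
  have TS: "TT -` S \<in> sets borel" using measurable_sets[OF TT_measurable S] by simp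
  have "emeasure (distr M0 M0 TT) S = emeasure M0 (TT -` S)"
    using S by (subst emeasure_distr) auto
  also have "\<dots> = emeasure M0 S"
    using S TS emeasure_slabs_TT[OF S] by (simp add: emeasure_M0 emeasure_slabs_Int[symmetric] emeasure_slab_images_Int[symmetric])
       (simp add: emeasure_slabs_Int emeasure_slab_images_Int)
  finally show "emeasure (distr M0 M0 TT) S = emeasure M0 S" .
qed simp

lemma AE_TT: "AE z in M0. TT z \<in> open_stairs \<and> inv_TT (TT z) = z"
  using AE_slabs by eventually_elim (use TT_slabs slab_images_subset in auto)

lemma AE_inv_TT: "AE z in M0. inv_TT z \<in> open_stairs \<and> TT (inv_TT z) = z"
  using AE_slab_images by eventually_elim (use inv_TT_slab_images slabs_subset in auto)

lemma distr_inv_TT: "distr M0 M0 inv_TT = M0"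
proof -
  have "distr M0 M0 inv_TT = distr (distr M0 M0 TT) M0 inv_TT" by (simp only: distr_TT)
  also have "\<dots> = distr M0 M0 (inv_TT \<circ> TT)" by (rule distr_distr) auto
  also have "\<dots> = distr M0 M0 (\<lambda>z. z)"
    by (rule distr_cong_AE) (use AE_TT in \<open>auto elim: eventually_mono\<close>)
  also have "\<dots> = M0" by (rule distr_id2) simp
  finally show ?thesis .
qed

end

section \<open>The Hopf argument\<close>

text \<open>
  Enclose \<open>W\<close> between a compact set and an open set of almost the same measure; they have positive
  distance. If \<open>z\<close> is in \<open>W\<close> and \<open>\<tau> z\<close> is not, the same is true of their
  images under \<open>\<Phi> m\<close>, which for large \<open>m\<close> are closer to each other than this distance; so
  one of them lies in the small gap between \<open>W\<close> and the compact or the open set. The hypothesis on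
  \<open>K\<close> bounds the measure of the points that \<open>\<tau>\<close> takes there.
\<close>

lemma hopf_argument:
  fixes M :: "'a::{second_countable_topology, complete_space, heine_borel} measure" and \<Phi> :: "nat \<Rightarrow> 'a \<Rightarrow> 'a"
  assumes "finite_measure M" and sets_M: "sets M = sets borel"
    and \<Phi>: "\<And>m. \<Phi> m \<in> borel_measurable borel" "\<And>m. distr M M (\<Phi> m) = M"
    and W: "W \<in> sets borel" "\<And>m. AE z in M. \<Phi> m z \<in> W \<longleftrightarrow> z \<in> W"
    and E: "E \<in> sets borel" and \<tau>: "\<tau> \<in> borel_measurable borel"
    and K0: "K \<ge> 0" and K: "\<And>X. X \<in> sets borel \<Longrightarrow> measure M (E \<inter> \<tau> -` X) \<le> K * measure M X"
    and contr: "\<And>m z. z \<in> E \<Longrightarrow> dist (\<Phi> m z) (\<Phi> m (\<tau> z)) \<le> \<epsilon> m" and \<epsilon>: "\<epsilon> \<longlonglongrightarrow> 0"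
  shows "AE z in M. z \<in> E \<longrightarrow> z \<in> W \<longrightarrow> \<tau> z \<in> W"
proof -
  interpret finite_measure M by fact
  have [simp]: "space M = UNIV" using sets_eq_imp_space_eq[OF sets_M] by simp
  have pre: "f -` X \<in> sets borel" if "f \<in> borel_measurable borel" "X \<in> sets borel" for f :: "'a \<Rightarrow> 'a" and X
    using measurable_sets[OF that] by simp
  define bad where "bad = E \<inter> W - \<tau> -` W"
  have bad_sets: "bad \<in> sets borel" unfolding bad_def using E W pre[OF \<tau>] by auto
  have bound: "measure M bad \<le> (1 + K) * \<eta>" if "\<eta> > 0" for \<eta>
  proof -
    obtain C where C: "compact C" "C \<subseteq> W" "measure M (W - C) \<le> \<eta>"
    proof (cases "measure M W < \<eta>")
      case True
      then show ?thesis using that[of "{}"] by simp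
    next
      case False
      then have "ennreal (measure M W - \<eta>) < emeasure M W"
        using \<open>\<eta> > 0\<close> unfolding emeasure_eq_measure by (intro ennreal_lessI) (auto simp: measure_nonneg)
      also have "\<dots> = (SUP C \<in> {C. C \<subseteq> W \<and> compact C}. emeasure M C)"
        using inner_regular[OF sets_M _ W(1)] by simp
      finally obtain C where C: "C \<subseteq> W" "compact C" "ennreal (measure M W - \<eta>) < emeasure M C"
        unfolding less_SUP_iff by auto
      have "measure M W - \<eta> < measure M C"
        using C(3) False unfolding emeasure_eq_measure by (subst (asm) ennreal_less_iff) auto
      moreover have "measure M (W - C) = measure M W - measure M C"
        using C W sets_M by (intro finite_measure_Diff) (auto intro: borel_compact)
      ultimately show ?thesis using that[of C] C by simp
    qed
    obtain U where U: "open U" "W \<subseteq> U" "measure M (U - W) \<le> \<eta>"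
    proof -
      have "emeasure M W < ennreal (measure M W + \<eta>)"
        using \<open>\<eta> > 0\<close> unfolding emeasure_eq_measure by (intro ennreal_lessI) (auto intro: add_nonneg_pos)
      also have "emeasure M W = (INF U \<in> {U. W \<subseteq> U \<and> open U}. emeasure M U)"
        using outer_regular[OF sets_M _ W(1)] by simp
      finally obtain U where U: "W \<subseteq> U" "open U" "emeasure M U < ennreal (measure M W + \<eta>)"
        unfolding INF_less_iff by auto
      have "measure M U < measure M W + \<eta>"
        using U(3) unfolding emeasure_eq_measure by (subst (asm) ennreal_less_iff) auto
      moreover have "measure M (U - W) = measure M U - measure M W"
        using U W sets_M by (intro finite_measure_Diff) auto
      ultimately show ?thesis using that[of U] U by simp
    qed
    have CU: "C \<inter> (- U) = {}" using C U by auto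
    have "closed (- U)" using U by auto
    from separate_compact_closed[OF C(1) this CU]
    obtain \<rho> where \<rho>: "\<rho> > 0" "\<And>x y. x \<in> C \<Longrightarrow> y \<notin> U \<Longrightarrow> \<rho> \<le> dist x y" by auto
    obtain m where m: "\<epsilon> m < \<rho>"
      using order_tendstoD(2)[OF \<epsilon> \<rho>(1)] by (meson eventually_sequentially order_refl)
    define N where "N = {z. \<not> (\<Phi> m z \<in> W \<longleftrightarrow> z \<in> W)}"
    have "N = (\<Phi> m -` W - W) \<union> (W - \<Phi> m -` W)" unfolding N_def by auto
    then have N_sets: "N \<in> sets borel" using W pre[OF \<Phi>(1)] by auto
    have "N \<in> null_sets M"
      using W(2)[of m] N_sets sets_M by (subst AE_iff_null_sets) (auto simp: N_def)
    then have N0: "measure M N = 0" by (simp add: measure_eq_0_null_sets)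
    have inv: "measure M (\<Phi> m -` X) = measure M X" if "X \<in> sets borel" for X
    proof -
      have "measure (distr M M (\<Phi> m)) X = measure M (\<Phi> m -` X \<inter> space M)"
        using that \<Phi>(1)[of m] sets_M by (intro measure_distr) (simp_all cong: measurable_cong_sets)
      then show ?thesis by (simp add: \<Phi>(2))
    qed
    let ?X1 = "N" and ?X2 = "E \<inter> \<tau> -` N" and ?X3 = "\<Phi> m -` (W - C)" and ?X4 = "E \<inter> \<tau> -` (\<Phi> m -` (U - W))"
    have CS: "W - C \<in> sets borel" "U - W \<in> sets borel" using C U W by (auto intro: borel_compact)
    have sets: "?X1 \<in> sets M" "?X2 \<in> sets M" "?X3 \<in> sets M" "?X4 \<in> sets M"
      unfolding sets_M using N_sets E CS pre[OF \<tau>] pre[OF \<Phi>(1)] by auto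
    have "bad \<subseteq> ?X1 \<union> ?X2 \<union> ?X3 \<union> ?X4"
    proof
      fix z assume z: "z \<in> bad"
      have close: "\<Phi> m z \<in> C \<Longrightarrow> \<Phi> m (\<tau> z) \<in> U"
        using \<rho>(2)[of "\<Phi> m z" "\<Phi> m (\<tau> z)"] contr[of z m] m z unfolding bad_def by fastforce
      show "z \<in> ?X1 \<union> ?X2 \<union> ?X3 \<union> ?X4"
        using z close unfolding bad_def N_def by auto
    qed
    then have "measure M bad \<le> measure M (?X1 \<union> ?X2 \<union> ?X3 \<union> ?X4)"
      using sets by (intro finite_measure_mono) auto
    also have "\<dots> \<le> measure M ?X1 + measure M ?X2 + measure M ?X3 + measure M ?X4"
      using measure_Un_le[OF sets(1,2)] measure_Un_le[of "?X1 \<union> ?X2" M ?X3] measure_Un_le[of "?X1 \<union> ?X2 \<union> ?X3" M ?X4] sets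
      by auto
    also have "\<dots> \<le> 0 + K * 0 + \<eta> + K * \<eta>"
    proof (intro add_mono)
      show "measure M ?X1 \<le> 0" using N0 by simp
      show "measure M ?X2 \<le> K * 0" using K[OF N_sets] N0 by simp
      show "measure M ?X3 \<le> \<eta>" using inv[OF CS(1)] C by simp
      have "measure M ?X4 \<le> K * measure M (U - W)" using K[of "\<Phi> m -` (U - W)"] pre[OF \<Phi>(1) CS(2)] inv[OF CS(2)] by simp
      also have "\<dots> \<le> K * \<eta>" using U(3) K0 by (rule mult_left_mono)
      finally show "measure M ?X4 \<le> K * \<eta>" .
    qed
    finally show ?thesis by (simp add: algebra_simps)
  qed
  have "measure M bad \<le> 0"
  proof (rule field_le_epsilon)
    fix e :: real assume "e > 0"
    define \<eta> where "\<eta> = e / (\<bar>1 + K\<bar> + 1)"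
    have "\<eta> > 0" using \<open>e > 0\<close> unfolding \<eta>_def by simp
    then have "measure M bad \<le> (1 + K) * \<eta>" by (rule bound)
    also have "\<dots> \<le> (\<bar>1 + K\<bar> + 1) * \<eta>" using \<open>\<eta> > 0\<close> by (intro mult_right_mono) auto
    also have "\<dots> = e" unfolding \<eta>_def by simp
    finally show "measure M bad \<le> 0 + e" by simp
  qed
  then have "bad \<in> null_sets M"
    using bad_sets sets_M measure_nonneg[of M bad] by (auto simp: emeasure_eq_measure null_sets_def)
  from AE_not_in[OF this] show ?thesis
    by eventually_elim (auto simp: bad_def)
qed

section \<open>Open sets invariant under the expansion\<close>

lemma periodic_int:
  fixes U :: "real set"
  assumes "\<And>x. x \<in> U \<longleftrightarrow> x + 1 \<in> U"
  shows "x \<in> U \<longleftrightarrow> x + of_int m \<in> U"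
proof (induction m arbitrary: x rule: int_induct[where k = 0])
  case (step1 m)
  then show ?case using assms[of "x + of_int m"] by (simp add: add.assoc)
next
  case (step2 m)
  then show ?case using assms[of "x + of_int (m - 1)"] by (simp add: add.assoc)
qed simp

lemma periodic_eq_UNIV:
  fixes U :: "real set"
  assumes per: "\<And>x. x \<in> U \<longleftrightarrow> x + 1 \<in> U" and sub: "{c..<c + 1} \<subseteq> U"
  shows "U = UNIV"
proof -
  have "x \<in> U" for x
  proof -
    have "x + of_int (- \<lfloor>x - c\<rfloor>) \<in> {c..<c + 1}" by (simp, linarith)
    then show ?thesis using sub periodic_int[OF per, of x "- \<lfloor>x - c\<rfloor>"] by blast
  qed
  then show ?thesis by blast
qed

text \<open>
  Up to translation, the intervals contained in \<open>U\<close> form a compact set of pairs of endpoints, because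
  containment in \<open>U\<close> is a closed condition on the endpoints; so the length attains its maximum.
\<close>

lemma longest_gap:
  fixes U :: "real set"
  assumes "open U" and per: "\<And>x. x \<in> U \<longleftrightarrow> x + 1 \<in> U" and "U \<noteq> {}" "U \<noteq> UNIV"
  obtains u v where "u < v" "{u<..<v} \<subseteq> U" "u \<notin> U" "v \<notin> U"
    "\<And>p q. {p<..<q} \<subseteq> U \<Longrightarrow> q - p \<le> v - u"
proof -
  note per' = periodic_int[OF per]
  have short: "q - p \<le> 1" if "{p<..<q} \<subseteq> U" for p q
  proof (rule ccontr)
    assume long: "\<not> ?thesis"
    define c where "c = (p + (q - 1)) / 2"
    have "{c..<c + 1} \<subseteq> {p<..<q}" using long unfolding c_def by (auto simp: field_simps)
    then show False using periodic_eq_UNIV[OF per, of c] that \<open>U \<noteq> UNIV\<close> by blast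
  qed
  define K where "K = {z :: real \<times> real. 0 \<le> fst z \<and> fst z \<le> 1 \<and> fst z \<le> snd z \<and> snd z \<le> fst z + 1 \<and>
     (\<forall>f. f \<notin> U \<longrightarrow> f \<le> fst z \<or> snd z \<le> f)}"
  have Kiff: "(u, v) \<in> K \<longleftrightarrow> 0 \<le> u \<and> u \<le> 1 \<and> u \<le> v \<and> v \<le> u + 1 \<and> {u<..<v} \<subseteq> U" for u v
    unfolding K_def by (auto simp: subset_iff not_le)
  have "closed K" unfolding K_def imp_conv_disj
    by (intro closed_Collect_conj closed_Collect_all closed_Collect_disj closed_Collect_le closed_Collect_const
        continuous_intros)
  moreover have "bounded K"
  proof (rule bounded_subset)
    show "bounded ({0..1::real} \<times> {0..2::real})" by (intro bounded_Times) auto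
    show "K \<subseteq> {0..1} \<times> {0..2}" unfolding K_def by auto
  qed
  ultimately have "compact K" by (simp add: compact_eq_bounded_closed)
  moreover have "(0, 0) \<in> K" by (simp add: Kiff)
  moreover have "continuous_on K (\<lambda>z. snd z - fst z)" by (intro continuous_intros)
  ultimately obtain z where z: "z \<in> K" "\<And>z'. z' \<in> K \<Longrightarrow> snd z' - fst z' \<le> snd z - fst z"
    using continuous_attains_sup[of K "\<lambda>z. snd z - fst z"] by (metis empty_iff)
  obtain u v where uv: "z = (u, v)" by (cases z)
  have sub: "{u<..<v} \<subseteq> U" and "u \<le> v" using z Kiff uv by auto
  have max: "q - p \<le> v - u" if pq: "{p<..<q} \<subseteq> U" for p q
  proof (cases "p < q")
    case True
    define m where "m = - \<lfloor>p\<rfloor>"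
    have "{p + of_int m<..<q + of_int m} \<subseteq> U"
    proof
      fix x assume "x \<in> {p + of_int m<..<q + of_int m}"
      then have "x - of_int m \<in> U" using pq by (intro subsetD[OF pq]) auto
      then show "x \<in> U" using per'[of "x - of_int m" m] by simp
    qed
    then have "(p + of_int m, q + of_int m) \<in> K"
      unfolding Kiff m_def using short[OF pq] True by (simp, linarith)
    then show ?thesis using z(2) uv by fastforce
  next
    case False
    then show ?thesis using \<open>u \<le> v\<close> by simp
  qed
  obtain x where "x \<in> U" using \<open>U \<noteq> {}\<close> by blast
  then obtain e where "e > 0" "ball x e \<subseteq> U" using \<open>open U\<close> open_contains_ball by blast
  then have "{x - e<..<x + e} \<subseteq> U" by (auto simp: ball_eq_greaterThanLessThan)
  from max[OF this] have "u < v" using \<open>e > 0\<close> by simp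
  moreover have "u \<notin> U"
  proof
    assume "u \<in> U"
    then obtain e where e: "e > 0" "ball u e \<subseteq> U" using \<open>open U\<close> open_contains_ball by blast
    have "{u - e<..<v} \<subseteq> U"
    proof
      fix x assume "x \<in> {u - e<..<v}"
      then show "x \<in> U" using sub e by (cases "u < x") (auto simp: ball_eq_greaterThanLessThan)
    qed
    from max[OF this] show False using e by simp
  qed
  moreover have "v \<notin> U"
  proof
    assume "v \<in> U"
    then obtain e where e: "e > 0" "ball v e \<subseteq> U" using \<open>open U\<close> open_contains_ball by blast
    have "{u<..<v + e} \<subseteq> U"
    proof
      fix x assume "x \<in> {u<..<v + e}"
      then show "x \<in> U" using sub e by (cases "x < v") (auto simp: ball_eq_greaterThanLessThan)
    qed
    from max[OF this] show False using e by simp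
  qed
  ultimately show ?thesis using that sub max by blast
qed

context matched_expansion begin

text \<open>
  The set is regarded as a subset of the circle, on which \<open>x \<mapsto> n / x\<close> is expanding and continuous
  except at \<open>\<alpha>\<close>. The longest component contains \<open>\<alpha>\<close>, since its image would be
  longer otherwise. It splits there into a part to the left of \<open>\<alpha> + 1\<close>, which starts at
  \<open>b\<close>, and a part to the right of \<open>\<alpha>\<close>, which ends at \<open>a\<close>. Their images
  start at \<open>R1\<close> and end at \<open>L1\<close>. If an image reaches \<open>\<alpha>\<close> again, the
  component contains a full cylinder and nothing remains to be shown. The second images end at \<open>R2\<close> and
  start at \<open>L2\<close>, and the third ones meet at \<open>n / R2 = n / L2 + 1\<close>; since \<open>U\<close>
  contains this point by \<open>reg\<close>, together they form an interval longer than the longest one. If a second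
  image contains \<open>\<alpha>\<close>, the contradiction comes from a boundary point of the component, whose image is
  not in \<open>U\<close> but lies in or at the end of the other third image.
\<close>

lemma invariant_open_set_is_everything:
  fixes U :: "real set"
  assumes "open U" and per: "\<And>x. x \<in> U \<longleftrightarrow> x + 1 \<in> U"
    and inv: "\<And>x. \<alpha> < x \<Longrightarrow> x < \<alpha> + 1 \<Longrightarrow> x \<in> U \<longleftrightarrow> n / x \<in> U"
    and reg: "\<And>p x q. p < x \<Longrightarrow> x < q \<Longrightarrow> {p<..<x} \<subseteq> U \<Longrightarrow> {x<..<q} \<subseteq> U \<Longrightarrow> x \<in> U"
    and "U \<noteq> {}"
  shows "U = UNIV"
proof (rule ccontr)
  assume "U \<noteq> UNIV"
  note per' = periodic_int[OF per]
  obtain u v where uv: "u < v" "{u<..<v} \<subseteq> U" "u \<notin> U" "v \<notin> U"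
    and max: "\<And>p q. {p<..<q} \<subseteq> U \<Longrightarrow> q - p \<le> v - u"
    using longest_gap[OF \<open>open U\<close> per \<open>U \<noteq> {}\<close> \<open>U \<noteq> UNIV\<close>] by blast
  have shift: "{p + of_int m<..<q + of_int m} \<subseteq> U" if pq: "{p<..<q} \<subseteq> U" for p q m
  proof
    fix x assume "x \<in> {p + of_int m<..<q + of_int m}"
    then have "x - of_int m \<in> U" by (intro subsetD[OF pq]) auto
    then show "x \<in> U" using per'[of "x - of_int m" m] by simp
  qed
  have shift\<delta>: "{p - \<delta><..<q - \<delta>} \<subseteq> U" if "{p<..<q} \<subseteq> U" for p q
    using shift[OF that, of "- int d"] by simp
  have shift\<kappa>: "{p - \<kappa><..<q - \<kappa>} \<subseteq> U" if "{p<..<q} \<subseteq> U" for p q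
    using shift[OF that, of "- int (d + i)"] by (simp add: algebra_simps)
  have img: "{n / q<..<n / p} \<subseteq> U" and expand: "q - p < n / p - n / q"
    if pq: "\<alpha> \<le> p" "p < q" "q \<le> \<alpha> + 1" "{p<..<q} \<subseteq> U" for p q
  proof -
    have p: "p > 0" "q > 0" using pq \<alpha>_pos by auto
    show "{n / q<..<n / p} \<subseteq> U"
    proof
      fix y assume y: "y \<in> {n / q<..<n / p}"
      have "0 < n / q" using n_gt_1 p by simp
      then have y0: "y > 0" using y by simp
      have "p < n / y" "n / y < q" using y y0 p by (auto simp: field_simps)
      then have "n / y \<in> U" "\<alpha> < n / y" "n / y < \<alpha> + 1" using pq by auto
      then show "y \<in> U" using inv[of "n / y"] y0 n_gt_1 by simp
    qed
    have "p * q < (\<alpha> + 1) * (\<alpha> + 1)" using pq p by (intro mult_less_le_imp_less) auto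
    then have "p * q < n" using \<alpha>_sqr by (simp add: power2_eq_square)
    then have "(q - p) * (p * q) < (q - p) * n" using pq by simp
    then have "q - p < (q - p) * n / (p * q)" using p by (simp add: pos_less_divide_eq)
    also have "\<dots> = n / p - n / q" using p by (simp add: field_simps)
    finally show "q - p < n / p - n / q" .
  qed
  have full: False if "{\<alpha><..<\<alpha> + 1} \<subseteq> U" "\<alpha> \<in> U"
  proof -
    have "{\<alpha>..<\<alpha> + 1} \<subseteq> U" using that by (auto simp: le_less)
    then show False using periodic_eq_UNIV[OF per] \<open>U \<noteq> UNIV\<close> by blast
  qed
  have full_cylinder: False
    if "{n / (\<alpha> + real k + 1)<..<n / (\<alpha> + real k)} \<subseteq> U" "\<alpha> \<le> n / (\<alpha> + real k + 1)" "n / (\<alpha> + real k) \<le> \<alpha> + 1" "\<alpha> \<in> U" for k :: nat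
  proof -
    have "n / (\<alpha> + real k + 1) < n / (\<alpha> + real k)" using n_gt_1 \<alpha>_pos by (intro divide_strict_left_mono) auto
    from img[OF that(2) this that(3,1)] have "{\<alpha> + real k<..<\<alpha> + real k + 1} \<subseteq> U" using n_gt_1 by simp
    from shift[OF this, of "- int k"] show False using full that by simp
  qed

  \<comment> \<open>The longest gap contains the point \<open>\<alpha>\<close> of the circle, since otherwise its image would be longer.\<close>
  define m where "m = - \<lfloor>u - \<alpha>\<rfloor>"
  define b where "b = u + of_int m"
  define a where "a = v + of_int m - 1"
  have b_bounds: "\<alpha> \<le> b" "b < \<alpha> + 1" unfolding b_def m_def by (simp_all, linarith+)
  have ba: "{b<..<a + 1} \<subseteq> U" using shift[OF uv(2), of m] unfolding a_def b_def by simp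
  have len: "a + 1 - b = v - u" unfolding a_def b_def by simp
  have bnot: "b \<notin> U" using uv(3) per'[of u m] unfolding b_def by simp
  have anot: "a \<notin> U" using uv(4) per'[of v "m - 1"] unfolding a_def by (simp add: algebra_simps)
  have a_gt: "\<alpha> < a"
  proof (rule ccontr)
    assume "\<not> \<alpha> < a"
    then have *: "\<alpha> \<le> b" "b < a + 1" "a + 1 \<le> \<alpha> + 1" using b_bounds len uv(1) by auto
    from expand[OF * ba] max[OF img[OF * ba]] show False using len by simp
  qed
  have \<alpha>1: "\<alpha> + 1 \<in> U" using ba b_bounds a_gt by auto
  then have \<alpha>U: "\<alpha> \<in> U" using per by blast
  have b_gt: "\<alpha> < b" using b_bounds bnot \<alpha>U by (auto simp: le_less)
  have Q: "{b<..<\<alpha> + 1} \<subseteq> U" using ba a_gt by auto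
  have "{\<alpha> + 1<..<a + 1} \<subseteq> U" using ba b_bounds by auto
  from shift[OF this, of "- 1"] have P: "{\<alpha><..<a} \<subseteq> U" by simp
  have a_le: "a < \<alpha> + 1"
  proof (rule ccontr)
    assume "\<not> ?thesis"
    then have "{\<alpha><..<\<alpha> + 1} \<subseteq> U" using P by auto
    then show False using full \<alpha>U by blast
  qed

  \<comment> \<open>The images of the two sides of the gap, moved back by the digits \<open>\<kappa>\<close> and \<open>d\<close>, are \<open>(ta, L1)\<close> and \<open>(R1, tb)\<close>.\<close>
  define ta where "ta = n / a - \<kappa>"
  define tb where "tb = n / b - \<delta>"
  have TP: "{ta<..<L1} \<subseteq> U" and lTP: "a - \<alpha> < L1 - ta"
    using shift\<kappa>[OF img[of \<alpha> a]] expand[of \<alpha> a] P a_gt a_le inverse_orbits unfolding ta_def by auto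
  have TQ: "{R1<..<tb} \<subseteq> U" and lTQ: "\<alpha> + 1 - b < tb - R1"
    using shift\<delta>[OF img[of b "\<alpha> + 1"]] expand[of b "\<alpha> + 1"] Q b_gt b_bounds inverse_orbits unfolding tb_def by auto
  have ta_gt: "\<alpha> < ta"
  proof (rule ccontr)
    assume "\<not> ?thesis"
    then have sub: "{\<alpha><..<L1} \<subseteq> U" using TP by auto
    have 1: "n / (\<alpha> + \<delta> + 1) \<le> L1"
    proof -
      have "L1 * (L2 + \<delta>) \<le> L1 * (\<alpha> + \<delta> + 1)" using L2_le L1_pos by simp
      then show ?thesis using L2_eq \<alpha>_pos \<delta>_ge by (simp add: pos_divide_le_eq)
    qed
    have "n / \<alpha> \<ge> \<alpha> + \<delta> + 2" using inverse_orbits R1_less_L1 R1_ge \<kappa>_ge by linarith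
    then have 2: "\<alpha> \<le> n / (\<alpha> + real (d + 1) + 1)" using \<alpha>_pos by (simp add: field_simps)
    have L1_ge: "n / (\<alpha> + real (d + 1)) \<le> L1" using 1 by (simp add: add_ac)
    show False
    proof (rule full_cylinder[of "d + 1"])
      show "{n / (\<alpha> + real (d + 1) + 1)<..<n / (\<alpha> + real (d + 1))} \<subseteq> U"
        using L1_ge 2 by (intro order_trans[OF _ sub]) auto
      show "n / (\<alpha> + real (d + 1)) \<le> \<alpha> + 1" using L1_ge L1_le by linarith
    qed (use 2 \<alpha>U in auto)
  qed
  have tb_less: "tb < \<alpha> + 1"
  proof (rule ccontr)
    assume "\<not> ?thesis"
    then have sub: "{R1<..<\<alpha> + 1} \<subseteq> U" using TQ by auto
    define k where "k = d + i - 1"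
    have k: "real k = \<kappa> - 1" using i_ge unfolding k_def by (simp add: of_nat_diff)
    have "R1 * (\<alpha> + \<kappa>) \<le> R1 * (R2 + \<kappa>)" using R2_ge R1_pos by simp
    then have "R1 * (\<alpha> + \<kappa>) \<le> n" using R2_eq by simp
    then have 1: "R1 \<le> n / (\<alpha> + real k + 1)" using \<alpha>_pos \<kappa>_ge \<delta>_ge unfolding k by (simp add: pos_le_divide_eq)
    have "n / (\<alpha> + 1) \<le> \<alpha> + real k" using inverse_orbits R1_less_L1 L1_le \<kappa>_ge unfolding k by linarith
    then have 2: "n / (\<alpha> + real k) \<le> \<alpha> + 1" using \<alpha>_pos by (simp add: pos_divide_le_eq mult.commute)
    show False
    proof (rule full_cylinder[of k])
      show "{n / (\<alpha> + real k + 1)<..<n / (\<alpha> + real k)} \<subseteq> U"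
        using 1 2 by (intro order_trans[OF _ sub]) auto
      show "\<alpha> \<le> n / (\<alpha> + real k + 1)" using 1 R1_ge by linarith
    qed (use 2 \<alpha>U in auto)
  qed
  have ta_less: "ta < L1" and tb_gt: "R1 < tb" using lTP lTQ a_gt b_bounds by linarith+

  \<comment> \<open>The second images may extend beyond the fundamental interval, \<open>(L2, tta)\<close> on the right and \<open>(ttb, R2)\<close> on the left.\<close>
  define tta where "tta = n / ta - \<delta>"
  define ttb where "ttb = n / tb - \<kappa>"
  have ttP: "{L2<..<tta} \<subseteq> U" and lttP: "L1 - ta < tta - L2"
    using shift\<delta>[OF img[of ta L1]] expand[of ta L1] TP ta_gt ta_less L1_le inverse_orbits unfolding tta_def by auto
  have ttQ: "{ttb<..<R2} \<subseteq> U" and lttQ: "tb - R1 < R2 - ttb"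
    using shift\<kappa>[OF img[of R1 tb]] expand[of R1 tb] TQ tb_gt tb_less R1_ge inverse_orbits unfolding ttb_def by auto
  have L2_less: "L2 < \<alpha> + 1"
  proof (rule ccontr)
    assume "\<not> ?thesis"
    then have "L2 = \<alpha> + 1" using L2_le by simp
    then have "{\<alpha><..<tta - 1} \<subseteq> U" using shift[OF ttP, of "- 1"] by simp
    moreover have "a \<in> {\<alpha><..<tta - 1}" using a_gt lTP lttP \<open>L2 = _\<close> by auto
    ultimately show False using anot by blast
  qed
  have R2_gt: "\<alpha> < R2"
  proof (rule ccontr)
    assume "\<not> ?thesis"
    then have "R2 = \<alpha>" using R2_ge by simp
    then have "{ttb + 1<..<\<alpha> + 1} \<subseteq> U" using shift[OF ttQ, of 1] by simp
    moreover have "b \<in> {ttb + 1<..<\<alpha> + 1}" using b_bounds lTQ lttQ \<open>R2 = _\<close> by auto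
    ultimately show False using bnot by blast
  qed
  have na: "n / a \<notin> U" using inv[of a] a_gt a_le anot by simp
  have nb: "n / b \<notin> U" using inv[of b] b_gt b_bounds bnot by simp
  have X: "b \<le> L2" if "\<alpha> + 1 < tta"
  proof (rule ccontr)
    assume "\<not> ?thesis"
    then have "b \<in> {L2<..<tta}" using that b_bounds by auto
    then show False using ttP bnot by blast
  qed
  have Y: "R2 \<le> a" if "ttb < \<alpha>"
  proof (rule ccontr)
    assume "\<not> ?thesis"
    then have "a \<in> {ttb<..<R2}" using that a_gt by auto
    then show False using ttQ anot by blast
  qed
  have nX: "n / L2 \<le> n / b" if "b \<le> L2" using that n_div_le_iff[of L2 b] L2_pos b_gt \<alpha>_pos by simp
  have nY: "n / a \<le> n / R2" if "R2 \<le> a" using that n_div_le_iff[of a R2] R2_pos a_gt \<alpha>_pos by simp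
  consider "\<alpha> + 1 < tta" "ttb < \<alpha>" | "\<alpha> + 1 < tta" "\<alpha> \<le> ttb" | "tta \<le> \<alpha> + 1" "ttb < \<alpha>" | "tta \<le> \<alpha> + 1" "\<alpha> \<le> ttb"
    by linarith
  then show False
  proof cases
    case 1
    have "n / L2 < \<alpha> + 1 + \<delta>" using nX[OF X[OF 1(1)]] tb_less unfolding tb_def by linarith
    moreover have "\<alpha> + \<kappa> < n / R2" using nY[OF Y[OF 1(2)]] ta_gt unfolding ta_def by linarith
    ultimately show False using orbit_matching \<kappa>_ge by linarith
  next
    case 2
    have lt: "ttb < R2" using lttQ tb_gt by linarith
    have T3: "{n / R2<..<n / ttb} \<subseteq> U" and l3: "R2 - ttb < n / ttb - n / R2"
      using img[of ttb R2] expand[of ttb R2] 2 lt ttQ R2_le_L1 L1_le by auto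
    define c where "c = n / b + 1"
    have cnot: "c \<notin> U" using nb per unfolding c_def by blast
    have "n / R2 \<le> c" using nX[OF X[OF 2(1)]] orbit_matching unfolding c_def by simp
    have "n / (\<alpha> + 1) \<le> n / L2" using n_div_le_iff[of "\<alpha> + 1" L2] L2_pos L2_le \<alpha>_pos by simp
    then have c_less: "c < n / ttb"
      using l3 lttQ orbit_matching inverse_orbits unfolding c_def tb_def by linarith
    then have c_eq: "c = n / R2" using T3 cnot \<open>n / R2 \<le> c\<close> by (auto simp: le_less)
    have lt': "n / (\<alpha> + 1) + 1 < c" using lTQ b_bounds inverse_orbits unfolding c_def tb_def by linarith
    have "{n / (\<alpha> + 1) + 1<..<c} \<subseteq> U"
      using shift[OF img[of b "\<alpha> + 1"], of 1] b_gt b_bounds Q unfolding c_def by auto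
    moreover have "{c<..<n / ttb} \<subseteq> U" using T3 c_eq by simp
    ultimately show False using reg[OF lt' c_less] cnot by blast
  next
    case 3
    have lt: "L2 < tta" using lttP ta_less by linarith
    have T3: "{n / tta<..<n / L2} \<subseteq> U" and l3: "tta - L2 < n / L2 - n / tta"
      using img[of L2 tta] expand[of L2 tta] 3 lt ttP R1_le_L2 R1_ge by auto
    define c where "c = n / a - 1"
    have cnot: "c \<notin> U" using na per[of c] unfolding c_def by simp
    have "c \<le> n / L2" using nY[OF Y[OF 3(2)]] orbit_matching unfolding c_def by simp
    have "n / R2 \<le> n / \<alpha>" using n_div_le_iff[of R2 \<alpha>] R2_pos R2_ge \<alpha>_pos by simp
    then have c_gt: "n / tta < c"
      using l3 lttP orbit_matching inverse_orbits unfolding c_def ta_def by linarith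
    then have c_eq: "c = n / L2" using T3 cnot \<open>c \<le> n / L2\<close> by (auto simp: le_less)
    have lt': "c < n / \<alpha> - 1" using lTP a_gt inverse_orbits unfolding c_def ta_def by linarith
    have "{c<..<n / \<alpha> - 1} \<subseteq> U"
      using shift[OF img[of \<alpha> a], of "- 1"] a_gt a_le P unfolding c_def by auto
    moreover have "{n / tta<..<c} \<subseteq> U" using T3 c_eq by simp
    ultimately show False using reg[OF c_gt lt'] cnot by blast
  next
    case 4
    have lt: "L2 < tta" "ttb < R2" using lttP ta_less lttQ tb_gt by linarith+
    have T3: "{n / tta<..<n / L2} \<subseteq> U" and l3: "tta - L2 < n / L2 - n / tta"
      using img[of L2 tta] expand[of L2 tta] 4 lt ttP R1_le_L2 R1_ge by auto
    have T3': "{n / R2<..<n / ttb} \<subseteq> U" and l3': "R2 - ttb < n / ttb - n / R2"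
      using img[of ttb R2] expand[of ttb R2] 4 lt ttQ R2_le_L1 L1_le by auto
    have left: "{n / tta + 1<..<n / R2} \<subseteq> U" using shift[OF T3, of 1] orbit_matching by simp
    have lts: "n / tta + 1 < n / R2" "n / R2 < n / ttb" using l3 l3' lt orbit_matching by linarith+
    have "n / R2 \<in> U" using reg[OF lts left T3'] .
    moreover have "{n / tta + 1<..<n / ttb} \<subseteq> {n / tta + 1<..<n / R2} \<union> {n / R2} \<union> {n / R2<..<n / ttb}" by auto
    ultimately have "{n / tta + 1<..<n / ttb} \<subseteq> U" using left T3' by blast
    from max[OF this] show False using l3 l3' lttP lttQ lTP lTQ len orbit_matching by linarith
  qed
qed

end

section \<open>Invariant sets consist of vertical lines\<close>

text \<open>
  In terms of the relative distance \<open>\<bar>t - t'\<bar> / min t t'\<close> a single step contracts uniformly,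
  whereas for the usual distance the slope may come arbitrarily close to 1, when
  \<open>(\<alpha> + 1)\<^sup>2 = N\<close>. The lemma serves vertical lines, horizontal segments and truncated
  continued fractions.
\<close>

lemma relative_contraction:
  fixes n k c p t t' :: real
  assumes n: "n > 0" and k: "k \<ge> 1" and t: "0 \<le> t" "t \<le> c" "0 \<le> t'" "t' \<le> c" and p: "0 \<le> p"
    and le: "\<bar>t - t'\<bar> \<le> p * min t t'"
  shows "\<bar>n / (k + t) - n / (k + t')\<bar> \<le> p * (c / (1 + c)) * min (n / (k + t)) (n / (k + t'))"
proof -
  have *: "\<bar>n / (k + t) - n / (k + t')\<bar> \<le> p * (c / (1 + c)) * min (n / (k + t)) (n / (k + t'))"
    if tt: "t \<le> t'" "0 \<le> t" "t' \<le> c" "t' - t \<le> p * t" for t t'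
  proof -
    have pos: "k + t > 0" "k + t' > 0" using tt k by auto
    have ge: "n / (k + t') \<le> n / (k + t)" using tt n pos by (intro divide_left_mono) auto
    have "t * (1 + c) \<le> c * (k + t)" using tt k mult_mono[of t c 1 k] by (simp add: algebra_simps)
    then have "t / (k + t) \<le> c / (1 + c)" using pos tt by (simp add: pos_le_divide_eq pos_divide_le_eq)
    then have "(t' - t) / (k + t) \<le> p * (c / (1 + c))"
      using divide_right_mono[OF tt(4), of "k + t"] pos p mult_left_mono[of "t / (k + t)" "c / (1 + c)" p] by simp
    then have "(t' - t) / (k + t) * (n / (k + t')) \<le> p * (c / (1 + c)) * (n / (k + t'))"
      using n pos by (intro mult_right_mono) auto
    moreover have "n / (k + t) - n / (k + t') = (t' - t) / (k + t) * (n / (k + t'))"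
      using pos by (simp add: field_simps)
    moreover have "min (n / (k + t)) (n / (k + t')) = n / (k + t')" using ge by simp
    moreover have "\<bar>n / (k + t) - n / (k + t')\<bar> = n / (k + t) - n / (k + t')" using ge by simp
    ultimately show ?thesis by (simp only:)
  qed
  show ?thesis
  proof (cases "t \<le> t'")
    case True
    then show ?thesis using *[of t t'] t le by simp
  next
    case False
    then show ?thesis using *[of t' t] t le by (simp add: abs_minus_commute min.commute)
  qed
qed

lemma AE_lborel_translate:
  fixes v :: "'a::euclidean_space"
  assumes "AE z in lborel. Q z"
  shows "AE z in lborel. Q (z + v)"
proof -
  have "AE z in distr lborel borel ((+) v). Q z" using assms by (simp only: lborel_distr_plus)
  then have "AE z in lborel. Q (v + z)" by (rule AE_distrD[rotated]) simp
  then show ?thesis by (simp add: add.commute)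
qed

lemma emeasure_lborel_translate:
  fixes v :: "'a::euclidean_space"
  assumes "X \<in> sets borel"
  shows "emeasure lborel ((\<lambda>z. z + v) -` X) = emeasure lborel X"
proof -
  have "emeasure lborel X = emeasure (distr lborel borel ((+) v)) X" by (simp only: lborel_distr_plus)
  also have "\<dots> = emeasure lborel ((+) v -` X)" using assms by (subst emeasure_distr) auto
  also have "(+) v -` X = (\<lambda>z. z + v) -` X" by (auto simp: add.commute)
  finally show ?thesis by simp
qed

lemma measurable_funpow_borel [measurable (raw)]:
  fixes f :: "'a::topological_space \<Rightarrow> 'a"
  assumes "f \<in> borel_measurable borel"
  shows "(f ^^ m) \<in> borel_measurable borel"
proof (induction m)
  case (Suc m)
  then show ?case using measurable_comp[of "f ^^ m" borel borel f borel] assms by (simp only: funpow.simps)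
qed (simp add: id_def)

lemma distr_funpow:
  assumes "sets M = sets borel" "f \<in> borel_measurable borel" "distr M M f = M"
  shows "distr M M (f ^^ m) = M"
proof (induction m)
  case 0
  have "distr M M (\<lambda>x. x) = M" by (rule distr_id2) simp
  then show ?case by (simp add: id_def)
next
  case (Suc m)
  have meas: "g \<in> measurable M M" if "g \<in> borel_measurable borel" for g
    using that by (simp cong: measurable_cong_sets add: assms(1))
  have "distr (distr M M (f ^^ m)) M f = distr M M (f ^^ Suc m)"
    unfolding funpow.simps using meas[OF assms(2)] meas[OF measurable_funpow_borel[OF assms(2)]] by (rule distr_distr)
  then show ?case by (simp only: Suc assms(3))
qed

lemma AE_funpow:
  assumes "sets M = sets borel" "f \<in> borel_measurable borel" "distr M M f = M" "AE z in M. Q z"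
  shows "AE z in M. Q ((f ^^ m) z)"
proof (rule AE_distrD[of "f ^^ m" M M Q])
  show "(f ^^ m) \<in> measurable M M"
    using measurable_funpow_borel[OF assms(2)] by (simp cong: measurable_cong_sets add: assms(1))
  show "AE z in distr M M (f ^^ m). Q z" using assms(4) by (simp only: distr_funpow[OF assms(1-3)])
qed

lemma AE_invariant_funpow:
  assumes "sets M = sets borel" "f \<in> borel_measurable borel" "distr M M f = M" "AE z in M. f z \<in> W \<longleftrightarrow> z \<in> W"
  shows "AE z in M. (f ^^ m) z \<in> W \<longleftrightarrow> z \<in> W"
proof (induction m)
  case (Suc m)
  then show ?case using AE_funpow[OF assms, of m] by eventually_elim simp
qed simp

context matched_expansion begin

definition \<theta> :: real where "\<theta> = F / (1 + F)"

lemma F_pos: "F > 0" and \<theta>: "0 < \<theta>" "\<theta> < 1"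
  using heights unfolding \<theta>_def by (auto simp: field_simps)

lemma \<alpha>1_le_F: "\<alpha> + 1 \<le> F" using le_B F_def' by simp

definition dens_lower :: real where "dens_lower = H * n / (n + (\<alpha> + 1) * F)^2"
definition dens_upper :: real where "dens_upper = H / n"

lemma dens_bounds_pos: "dens_lower > 0" "dens_upper > 0"
proof -
  have "n + (\<alpha> + 1) * F > 0" using n_gt_1 \<alpha>_pos F_pos by (auto intro!: add_pos_pos)
  then show "dens_lower > 0" unfolding dens_lower_def using H_pos n_gt_1 by auto
  show "dens_upper > 0" unfolding dens_upper_def using H_pos n_gt_1 by auto
qed

lemma density_bounds:
  assumes "z \<in> open_stairs"
  shows "dens_lower \<le> H * mobius_density n z" "H * mobius_density n z \<le> dens_upper"
proof -
  obtain x y where xy: "z = (x, y)" by (cases z)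
  have b: "0 < x" "x < \<alpha> + 1" "0 < y" "y < F"
    using assms open_stairs_pos[OF assms] unfolding xy open_stairs_def by auto
  have p: "0 < x * y" using b by simp
  have q: "x * y \<le> (\<alpha> + 1) * F" using b by (intro mult_mono) auto
  have "n / (n + (\<alpha> + 1) * F)^2 \<le> n / (n + x * y)^2"
    using p q n_gt_1 by (intro divide_left_mono power_mono mult_pos_pos zero_less_power) auto
  then show "dens_lower \<le> H * mobius_density n z" 
    using mult_left_mono[of _ _ H] H_pos unfolding dens_lower_def mobius_density_def xy by fastforce
  have "n / (n + x * y)^2 \<le> n / n^2"
    using p n_gt_1 by (intro divide_left_mono power_mono mult_pos_pos zero_less_power) auto
  also have "\<dots> = 1 / n" by (simp add: power2_eq_square)
  finally have "H * (n / (n + x * y)^2) \<le> H * (1 / n)" using H_pos by (intro mult_left_mono) auto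
  then show "H * mobius_density n z \<le> dens_upper" unfolding dens_upper_def mobius_density_def xy by simp
qed

lemma AE_M0_iff: "(AE z in M0. Q z) \<longleftrightarrow> (AE z in lborel. z \<in> open_stairs \<longrightarrow> Q z)"
proof -
  have "0 < ennreal (H * mobius_density n z * indicator open_stairs z) \<longleftrightarrow> z \<in> open_stairs" for z
    using density_bounds(1)[of z] dens_bounds_pos by (auto simp: indicator_def)
  then show ?thesis unfolding M0_def by (subst AE_density) auto
qed

lemma M0_le_lborel:
  assumes [measurable]: "X \<in> sets borel"
  shows "emeasure M0 X \<le> ennreal dens_upper * emeasure lborel (open_stairs \<inter> X)"
proof -
  have "emeasure M0 X = (\<integral>\<^sup>+z. ennreal (H * mobius_density n z * indicator open_stairs z) * indicator X z \<partial>lborel)"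
    unfolding M0_def by (subst emeasure_density) auto
  also have "\<dots> \<le> (\<integral>\<^sup>+z. ennreal dens_upper * indicator (open_stairs \<inter> X) z \<partial>lborel)"
    using density_bounds(2) by (intro nn_integral_mono) (auto simp: indicator_def intro: ennreal_leI)
  also have "\<dots> = ennreal dens_upper * emeasure lborel (open_stairs \<inter> X)"
    by (rule nn_integral_cmult_indicator) simp
  finally show ?thesis .
qed

lemma lborel_le_M0:
  assumes [measurable]: "X \<in> sets borel"
  shows "ennreal dens_lower * emeasure lborel (open_stairs \<inter> X) \<le> emeasure M0 X"
proof -
  have "ennreal dens_lower * emeasure lborel (open_stairs \<inter> X) = (\<integral>\<^sup>+z. ennreal dens_lower * indicator (open_stairs \<inter> X) z \<partial>lborel)"
    by (rule nn_integral_cmult_indicator[symmetric]) simp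
  also have "\<dots> \<le> (\<integral>\<^sup>+z. ennreal (H * mobius_density n z * indicator open_stairs z) * indicator X z \<partial>lborel)"
    using density_bounds(1) by (intro nn_integral_mono) (auto simp: indicator_def intro: ennreal_leI)
  also have "\<dots> = emeasure M0 X"
    unfolding M0_def by (subst emeasure_density) auto
  finally show ?thesis .
qed

lemma M0_translate_bound:
  assumes X [measurable]: "X \<in> sets borel" and S [measurable]: "S \<in> sets borel" and "S \<subseteq> {z. z + v \<in> open_stairs}"
  shows "measure M0 (S \<inter> (\<lambda>z. z + v) -` X) \<le> dens_upper / dens_lower * measure M0 X"
proof -
  let ?t = "\<lambda>z. z + v"
  have t: "?t -` Y \<in> sets borel" if "Y \<in> sets borel" for Y
    using measurable_sets[of ?t borel borel Y] that by simp
  have "emeasure M0 (S \<inter> ?t -` X) \<le> ennreal dens_upper * emeasure lborel (open_stairs \<inter> (S \<inter> ?t -` X))"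
    using t[OF X] by (intro M0_le_lborel) auto
  also have "\<dots> \<le> ennreal dens_upper * emeasure lborel (?t -` (open_stairs \<inter> X))"
    using assms(3) t[of "open_stairs \<inter> X"] by (intro mult_left_mono emeasure_mono) auto
  also have "\<dots> = ennreal dens_upper * emeasure lborel (open_stairs \<inter> X)"
    by (subst emeasure_lborel_translate) simp_all
  also have "\<dots> = ennreal (dens_upper / dens_lower) * (ennreal dens_lower * emeasure lborel (open_stairs \<inter> X))"
    using dens_bounds_pos by (simp add: mult.assoc[symmetric] ennreal_mult[symmetric])
  also have "\<dots> \<le> ennreal (dens_upper / dens_lower) * emeasure M0 X"
    by (intro mult_left_mono lborel_le_M0) auto
  also have "\<dots> = ennreal (dens_upper / dens_lower * measure M0 X)"
    unfolding M0.emeasure_eq_measure using dens_bounds_pos by (intro ennreal_mult[symmetric]) auto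
  finally show ?thesis
    using dens_bounds_pos by (simp add: M0.emeasure_eq_measure ennreal_le_iff)
qed

lemma hopf_translation:
  assumes \<Phi>: "\<Phi> \<in> borel_measurable borel" "distr M0 M0 \<Phi> = M0"
    and W: "W \<in> sets borel" "AE z in M0. \<Phi> z \<in> W \<longleftrightarrow> z \<in> W"
    and S: "S \<in> sets borel" "S \<subseteq> {z. z + v \<in> open_stairs}"
    and contr: "\<And>m z. z \<in> S \<Longrightarrow> dist ((\<Phi> ^^ m) z) ((\<Phi> ^^ m) (z + v)) \<le> \<epsilon> m" and \<epsilon>: "\<epsilon> \<longlonglongrightarrow> 0"
  shows "AE z in M0. z \<in> S \<longrightarrow> z \<in> W \<longrightarrow> z + v \<in> W"
proof (rule hopf_argument[where \<Phi> = "\<lambda>m. \<Phi> ^^ m" and \<epsilon> = \<epsilon> and K = "dens_upper / dens_lower"])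
  show "finite_measure M0" by (rule M0.finite_measure_axioms)
  show "measure M0 (S \<inter> (\<lambda>z. z + v) -` X) \<le> dens_upper / dens_lower * measure M0 X" if "X \<in> sets borel" for X
    using M0_translate_bound[OF that S] .
  show "dens_upper / dens_lower \<ge> 0" using dens_bounds_pos by simp
  show "AE z in M0. (\<Phi> ^^ m) z \<in> W \<longleftrightarrow> z \<in> W" for m
    using AE_invariant_funpow[OF sets_M0 \<Phi> W(2)] .
  show "distr M0 M0 (\<Phi> ^^ m) = M0" for m using distr_funpow[OF sets_M0 \<Phi>] .
  show "(\<Phi> ^^ m) \<in> borel_measurable borel" for m using measurable_funpow_borel[OF \<Phi>(1)] .
qed (use assms in auto)

lemma digit_ge_1: "\<alpha> < x \<Longrightarrow> x < \<alpha> + 1 \<Longrightarrow> 1 \<le> real_of_int (digit N \<alpha> x)"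
proof -
  assume x: "\<alpha> < x" "x < \<alpha> + 1"
  have "n / (\<alpha> + 1) < n / x" using n_div_less_iff[of "\<alpha> + 1" x] x \<alpha>_pos by simp
  then have "1 \<le> n / x - \<alpha>" using inverse_orbits R1_ge \<delta>_ge by linarith
  then show ?thesis using x unfolding digit_def by (simp add: le_floor_iff)
qed

definition stays :: "(real \<times> real) set" where
  "stays = {z. \<forall>m. (TT ^^ m) z \<in> open_stairs}"

lemma stays_borel [measurable, simp]: "stays \<in> sets borel"
  unfolding stays_def by measurable

lemma AE_stays: "AE z in M0. z \<in> stays"
  unfolding stays_def mem_Collect_eq AE_all_countable
  using AE_funpow[OF sets_M0 TT_measurable distr_TT AE_M0_stairs] by blast

lemma vertical_contraction:
  assumes "z \<in> stays" "z' \<in> stays" "fst z = fst z'"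
  shows "fst ((TT ^^ m) z) = fst ((TT ^^ m) z') \<and>
    \<bar>snd ((TT ^^ m) z) - snd ((TT ^^ m) z')\<bar> \<le> F / A * \<theta> ^ m * min (snd ((TT ^^ m) z)) (snd ((TT ^^ m) z'))"
proof (induction m)
  case 0
  have "A < snd z" "snd z < F" "A < snd z'" "snd z' < F"
    using assms(1,2)[unfolded stays_def mem_Collect_eq, THEN spec[of _ 0]] unfolding open_stairs_def by auto
  moreover have "F / A * A \<le> F / A * min (snd z) (snd z')"
    using calculation A_pos F_pos by (intro mult_left_mono) auto
  ultimately show ?case using assms(3) A_pos by simp
next
  case (Suc m)
  let ?z = "(TT ^^ m) z" and ?z' = "(TT ^^ m) z'"
  have st: "?z \<in> open_stairs" "?z' \<in> open_stairs" using assms unfolding stays_def by auto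
  then have b: "\<alpha> < fst ?z" "fst ?z < \<alpha> + 1" "0 < snd ?z" "snd ?z < F" "0 < snd ?z'" "snd ?z' < F"
    using open_stairs_pos unfolding open_stairs_def by auto
  let ?k = "real_of_int (digit N \<alpha> (fst ?z))"
  have k: "?k \<ge> 1" using digit_ge_1 b by blast
  have "\<bar>n / (?k + snd ?z) - n / (?k + snd ?z')\<bar>
      \<le> F / A * \<theta> ^ m * (F / (1 + F)) * min (n / (?k + snd ?z)) (n / (?k + snd ?z'))"
    using b k Suc n_gt_1 F_pos A_pos \<theta> by (intro relative_contraction) auto
  then show ?case using Suc unfolding \<theta>_def[symmetric] by (simp add: TT_alt[of ?z] TT_alt[of ?z'] mult_ac)
qed

lemma dist_same_fst: "dist (x, y) (x, y') = \<bar>y - y'\<bar>" for x y y' :: real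
  by (simp add: dist_Pair_Pair dist_real_def)

lemma dist_same_snd: "dist (x, y) (x', y) = \<bar>x - x'\<bar>" for x x' y :: real
  by (simp add: dist_Pair_Pair dist_real_def)

lemma vertical_hopf:
  assumes W: "W \<in> sets borel" "AE z in M0. TT z \<in> W \<longleftrightarrow> z \<in> W"
  shows "AE z in lborel. z \<in> open_stairs \<longrightarrow> z + (0, h) \<in> open_stairs \<longrightarrow> z \<in> W \<longrightarrow> z + (0, h) \<in> W"
proof -
  define S where "S = {z \<in> stays. z + (0, h) \<in> stays}"
  have S: "S \<in> sets borel" unfolding S_def by measurable
  have stays_sub: "stays \<subseteq> open_stairs"
    unfolding stays_def by (auto dest: spec[of _ 0])
  have "AE z in M0. z \<in> S \<longrightarrow> z \<in> W \<longrightarrow> z + (0, h) \<in> W"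
  proof (rule hopf_translation[OF TT_measurable distr_TT W S])
    show "S \<subseteq> {z. z + (0, h) \<in> open_stairs}" unfolding S_def using stays_sub by auto
    show "(\<lambda>m. F / A * \<theta> ^ m * F) \<longlonglongrightarrow> 0"
      using \<theta> by (intro tendsto_mult_left_zero tendsto_mult_right_zero LIMSEQ_realpow_zero) auto
    fix m z assume z: "z \<in> S"
    let ?z = "(TT ^^ m) z" and ?z' = "(TT ^^ m) (z + (0, h))"
    have st: "z \<in> stays" "z + (0, h) \<in> stays" using z unfolding S_def by auto
    have c: "fst ?z = fst ?z'" "\<bar>snd ?z - snd ?z'\<bar> \<le> F / A * \<theta> ^ m * min (snd ?z) (snd ?z')"
      using vertical_contraction[OF st, of m] by auto
    have "?z \<in> open_stairs" using st unfolding stays_def by blast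
    then have "min (snd ?z) (snd ?z') \<le> F" unfolding open_stairs_def by auto
    then have "F / A * \<theta> ^ m * min (snd ?z) (snd ?z') \<le> F / A * \<theta> ^ m * F"
      using F_pos A_pos \<theta> by (intro mult_left_mono) auto
    moreover have "dist ?z ?z' = \<bar>snd ?z - snd ?z'\<bar>"
      using c(1) dist_same_fst[of "fst ?z" "snd ?z" "snd ?z'"] by (metis prod.collapse)
    ultimately show "dist ?z ?z' \<le> F / A * \<theta> ^ m * F" using c(2) by linarith
  qed
  then have 1: "AE z in lborel. z \<in> open_stairs \<longrightarrow> z \<in> S \<longrightarrow> z \<in> W \<longrightarrow> z + (0, h) \<in> W"
    unfolding AE_M0_iff .
  have 2: "AE z in lborel. z \<in> open_stairs \<longrightarrow> z \<in> stays" using AE_stays unfolding AE_M0_iff .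
  show ?thesis
    using 1 2 AE_lborel_translate[OF 2, of "(0, h)"]
    by eventually_elim (auto simp: S_def)
qed

text \<open>
  By \<open>vertical_hopf\<close> and Fubini, almost every vertical fibre lies in \<open>W\<close> up to a null set or
  misses it up to a null set; \<open>X\<close> collects the fibres of the first kind.
\<close>

lemma invariant_is_strip:
  assumes W: "W \<in> sets borel" "AE z in M0. TT z \<in> W \<longleftrightarrow> z \<in> W"
  obtains X where "X \<in> sets borel" "AE z in M0. z \<in> W \<longleftrightarrow> fst z \<in> X"
proof -
  note W(1) [measurable]
  define X where "X = {x. 0 < (\<integral>\<^sup>+y. indicator (open_stairs \<inter> W) (x, y) \<partial>lborel)}"
  have [measurable]: "(\<lambda>x. \<integral>\<^sup>+y. indicator (open_stairs \<inter> W) (x, y) \<partial>lborel) \<in> borel_measurable borel"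
  proof -
    have "(\<lambda>z. indicator (open_stairs \<inter> W) z :: ennreal) \<in> borel_measurable (lborel \<Otimes>\<^sub>M lborel)"
      unfolding lborel_prod by measurable
    from lborel.borel_measurable_nn_integral_fst[OF this] show ?thesis by simp
  qed
  have X: "X \<in> sets borel" unfolding X_def by measurable
  have "AE h in lborel. AE z in lborel. z \<in> open_stairs \<longrightarrow> z + (0, h) \<in> open_stairs \<longrightarrow> z \<in> W \<longrightarrow> z + (0, h) \<in> W"
    using vertical_hopf[OF W] by simp
  moreover have "{q \<in> space (lborel \<Otimes>\<^sub>M lborel :: (real \<times> real \<times> real) measure).
      snd q \<in> open_stairs \<longrightarrow> snd q + (0, fst q) \<in> open_stairs \<longrightarrow> snd q \<in> W \<longrightarrow> snd q + (0, fst q) \<in> W}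
     \<in> sets (lborel \<Otimes>\<^sub>M lborel)"
    by measurable
  ultimately have "AE z in lborel. AE h in lborel. z \<in> open_stairs \<longrightarrow> z + (0, h) \<in> open_stairs \<longrightarrow> z \<in> W \<longrightarrow> z + (0, h) \<in> W"
    by (subst (asm) lborel_pair.AE_commute) auto
  then have "AE z in lborel \<Otimes>\<^sub>M lborel. AE h in lborel. z \<in> open_stairs \<longrightarrow> z + (0, h) \<in> open_stairs \<longrightarrow> z \<in> W \<longrightarrow> z + (0, h) \<in> W"
    by (simp only: lborel_prod)
  from lborel_pair.AE_pair[OF this]
  have ae: "AE x in lborel. AE y in lborel. AE h in lborel. (x, y) \<in> open_stairs \<longrightarrow> (x, y) + (0, h) \<in> open_stairs \<longrightarrow>
     (x, y) \<in> W \<longrightarrow> (x, y) + (0, h) \<in> W" .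
  have "AE x in lborel. AE y in lborel. (x, y) \<in> open_stairs \<longrightarrow> ((x, y) \<in> W \<longleftrightarrow> x \<in> X)"
    using ae
  proof eventually_elim
    fix x assume x: "AE y in lborel. AE h in lborel. (x, y) \<in> open_stairs \<longrightarrow> (x, y) + (0, h) \<in> open_stairs \<longrightarrow>
     (x, y) \<in> W \<longrightarrow> (x, y) + (0, h) \<in> W"
    have int0: "(\<integral>\<^sup>+y. indicator (open_stairs \<inter> W) (x, y) \<partial>lborel) = 0 \<longleftrightarrow> (AE y in lborel. (x, y) \<notin> open_stairs \<inter> W)"
    proof (subst nn_integral_0_iff_AE)
      have "(\<lambda>y. (x, y)) \<in> borel_measurable (borel :: real measure)" by measurable
      then show "(\<lambda>y. indicator (open_stairs \<inter> W) (x, y) :: ennreal) \<in> borel_measurable lborel"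
        by (intro borel_measurable_indicator' ) auto
    qed (auto simp: indicator_def)
    show "AE y in lborel. (x, y) \<in> open_stairs \<longrightarrow> ((x, y) \<in> W \<longleftrightarrow> x \<in> X)"
    proof (cases "x \<in> X")
      case False
      then have "AE y in lborel. (x, y) \<notin> open_stairs \<inter> W" using int0 unfolding X_def by simp
      then show ?thesis by eventually_elim (use False in auto)
    next
      case True
      have "\<exists>y. (x, y) \<in> open_stairs \<inter> W \<and> (AE h in lborel. (x, y) \<in> open_stairs \<longrightarrow> (x, y) + (0, h) \<in> open_stairs \<longrightarrow>
         (x, y) \<in> W \<longrightarrow> (x, y) + (0, h) \<in> W)"
      proof (rule ccontr)
        assume no: "\<not> ?thesis"
        have "AE y in lborel. (x, y) \<notin> open_stairs \<inter> W"
          using x by eventually_elim (use no in blast)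
        then show False using int0 True unfolding X_def by simp
      qed
      then obtain y where y: "(x, y) \<in> open_stairs \<inter> W" "AE h in lborel. (x, y) \<in> open_stairs \<longrightarrow> (x, y) + (0, h) \<in> open_stairs \<longrightarrow>
         (x, y) \<in> W \<longrightarrow> (x, y) + (0, h) \<in> W" by blast
      have "AE h in lborel. (x, y + h) \<in> open_stairs \<longrightarrow> (x, y + h) \<in> W"
        using y(2) by eventually_elim (use y(1) in auto)
      from AE_lborel_translate[OF this, of "- y"]
      show ?thesis by eventually_elim (use True in auto)
    qed
  qed
  then have fibres: "AE x in lborel. AE y in lborel. (x, y) \<in> open_stairs \<longrightarrow> ((x, y) \<in> W \<longleftrightarrow> fst (x, y) \<in> X)"
    by simp
  have "AE z in lborel \<Otimes>\<^sub>M lborel. z \<in> open_stairs \<longrightarrow> (z \<in> W \<longleftrightarrow> fst z \<in> X)"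
  proof (rule lborel_pair.AE_pair_measure)
    have "{z. z \<in> open_stairs \<longrightarrow> (z \<in> W \<longleftrightarrow> fst z \<in> X)} \<in> sets (borel :: (real \<times> real) measure)"
      using X by measurable
    then show "{z \<in> space (lborel \<Otimes>\<^sub>M lborel). z \<in> open_stairs \<longrightarrow> (z \<in> W \<longleftrightarrow> fst z \<in> X)} \<in> sets (lborel \<Otimes>\<^sub>M lborel)"
      unfolding lborel_prod by simp
  qed (rule fibres)
  then have "AE z in M0. z \<in> W \<longleftrightarrow> fst z \<in> X" unfolding AE_M0_iff lborel_prod .
  then show ?thesis using that X by blast
qed

end

section \<open>Almost every point has a horizontal unstable leaf\<close>

lemma AE_reciprocal:
  fixes n p q :: real
  assumes n: "n > 0" and p: "0 < p" and pq: "p < q" and ae: "AE y in lborel. p < y \<longrightarrow> y < q \<longrightarrow> Q y"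
  shows "AE w in lborel. n / q < w \<longrightarrow> w < n / p \<longrightarrow> Q (n / w)"
proof -
  let ?N = "{y. p < y \<and> y < q \<and> \<not> Q y}"
  obtain Z where Z: "Z \<in> null_sets lborel" "{y \<in> space lborel. \<not> (p < y \<longrightarrow> y < q \<longrightarrow> Q y)} \<subseteq> Z"
    using ae unfolding eventually_ae_filter by auto
  have "Z \<in> null_sets lebesgue" using Z(1) by (rule null_sets_completionI)
  then have "negligible Z" by (simp add: negligible_iff_null_sets)
  then have "negligible ?N" by (rule negligible_subset) (use Z(2) in auto)
  then have "negligible ((\<lambda>y. n / y) ` ?N)"
  proof (rule negligible_differentiable_image_negligible[rotated])
    show "(\<lambda>y. n / y) differentiable_on ?N"
      using p by (auto simp: differentiable_on_def intro!: differentiable_divide)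
  qed simp
  then have "(\<lambda>y. n / y) ` ?N \<in> null_sets lebesgue" by (simp add: negligible_iff_null_sets)
  then have "AE w in lebesgue. w \<notin> (\<lambda>y. n / y) ` ?N" by (rule AE_not_in)
  then have "AE w in lborel. w \<notin> (\<lambda>y. n / y) ` ?N" by (simp add: AE_completion_iff)
  then show ?thesis
  proof eventually_elim
    fix w assume w: "w \<notin> (\<lambda>y. n / y) ` ?N"
    show "n / q < w \<longrightarrow> w < n / p \<longrightarrow> Q (n / w)"
    proof (intro impI)
      assume *: "n / q < w" "w < n / p"
      have "0 < n / q" using n p pq by simp
      then have w0: "w > 0" using * by simp
      then have "p < n / w" "n / w < q" using * p pq by (auto simp: field_simps)
      moreover have "n / (n / w) = w" using n by simp
      ultimately show "Q (n / w)" using w by (metis (mono_tags, lifting) image_eqI mem_Collect_eq)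
    qed
  qed
qed

text \<open>
  Countably many intervals with rational endpoints suffice.
\<close>

lemma locally_AE_imp_AE:
  fixes Q :: "real \<Rightarrow> bool"
  defines "U \<equiv> {x. \<exists>e>0. AE y in lborel. x - e < y \<longrightarrow> y < x + e \<longrightarrow> Q y}"
  shows "AE y in lborel. y \<in> U \<longrightarrow> Q y"
proof -
  have 1: "AE y in lborel. (AE w in lborel. of_rat p < w \<longrightarrow> w < of_rat q \<longrightarrow> Q w) \<longrightarrow> of_rat p < y \<longrightarrow> y < of_rat q \<longrightarrow> Q y" for p q
    by (cases "AE w in lborel. of_rat p < w \<longrightarrow> w < of_rat q \<longrightarrow> Q w") auto
  have "AE y in lborel. \<forall>p q. (AE w in lborel. of_rat p < w \<longrightarrow> w < of_rat q \<longrightarrow> Q w) \<longrightarrow> of_rat p < y \<longrightarrow> y < of_rat q \<longrightarrow> Q y"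
    using 1 by (subst AE_all_countable, intro allI, subst AE_all_countable, intro allI)
  then show ?thesis
  proof eventually_elim
    fix y assume y: "\<forall>p q. (AE w in lborel. of_rat p < w \<longrightarrow> w < of_rat q \<longrightarrow> Q w) \<longrightarrow> of_rat p < y \<longrightarrow> y < of_rat q \<longrightarrow> Q y"
    show "y \<in> U \<longrightarrow> Q y"
    proof
      assume "y \<in> U"
      then obtain e where e: "e > 0" "AE w in lborel. y - e < w \<longrightarrow> w < y + e \<longrightarrow> Q w" unfolding U_def by blast
      obtain p q where pq: "y - e < of_rat p" "of_rat p < y" "y < of_rat q" "of_rat q < y + e"
        using of_rat_dense[of "y - e" y] of_rat_dense[of y "y + e"] e(1) by auto
      have "AE w in lborel. of_rat p < w \<longrightarrow> w < of_rat q \<longrightarrow> Q w"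
        using e(2) by eventually_elim (use pq in auto)
      then show "Q y" using y pq by blast
    qed
  qed
qed

context matched_expansion begin

lemma shift_strip_stays:
  assumes "z \<in> open_stairs" "\<bar>x' - fst z\<bar> \<le> s" "\<forall>v \<in> {\<alpha>, \<alpha> + 1, R1, R2, L1, L2}. s < \<bar>fst z - v\<bar>"
  shows "(x', snd z) \<in> open_stairs"
proof -
  have v: "v \<in> {\<alpha>, \<alpha> + 1, R1, R2, L1, L2} \<Longrightarrow> (x' \<le> v \<longleftrightarrow> fst z \<le> v) \<and> (v \<le> x' \<longleftrightarrow> v \<le> fst z)" for v
    using assms(2,3) by (smt (verit))
  have "x' \<le> \<alpha> \<longleftrightarrow> fst z \<le> \<alpha>" "\<alpha> + 1 \<le> x' \<longleftrightarrow> \<alpha> + 1 \<le> fst z" "R2 \<le> x' \<longleftrightarrow> R2 \<le> fst z"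
    "L1 \<le> x' \<longleftrightarrow> L1 \<le> fst z" "x' \<le> L2 \<longleftrightarrow> fst z \<le> L2" "x' \<le> R1 \<longleftrightarrow> fst z \<le> R1"
    using v by blast+
  then show ?thesis
    using assms(1) unfolding open_stairs_def mem_Collect_eq fst_conv snd_conv by argo
qed

text \<open>
  The backward orbit of such a point keeps a distance from the vertical sides of the staircase that shrinks as fast as
  the inverse contracts; a horizontal segment of radius \<open>r\<close> around it is therefore never cut
  (\<open>roomy_leaf\<close>).
\<close>

definition roomy :: "real \<Rightarrow> (real \<times> real) set" where
  "roomy r = {z. \<forall>m. (inv_TT ^^ m) z \<in> slab_images \<and>
     (\<forall>v \<in> {\<alpha>, \<alpha> + 1, R1, R2, L1, L2}. r / \<alpha> * \<theta> ^ m * F < \<bar>fst ((inv_TT ^^ m) z) - v\<bar>)}"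

lemma roomy_borel [measurable, simp]: "roomy r \<in> sets borel"
  unfolding roomy_def by measurable

lemma roomy_leaf:
  assumes z: "z \<in> roomy r" and r: "0 < r" "\<bar>h\<bar> < r"
  shows "(inv_TT ^^ m) (z + (h, 0)) \<in> open_stairs \<and> snd ((inv_TT ^^ m) (z + (h, 0))) = snd ((inv_TT ^^ m) z) \<and>
    \<bar>fst ((inv_TT ^^ m) z) - fst ((inv_TT ^^ m) (z + (h, 0)))\<bar>
      \<le> r / \<alpha> * \<theta> ^ m * min (fst ((inv_TT ^^ m) z)) (fst ((inv_TT ^^ m) (z + (h, 0))))"
proof (induction m)
  case 0
  have zP: "z \<in> slab_images" and room: "\<forall>v \<in> {\<alpha>, \<alpha> + 1, R1, R2, L1, L2}. r / \<alpha> * F < \<bar>fst z - v\<bar>"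
    using z[unfolded roomy_def mem_Collect_eq, THEN spec[of _ 0]] by auto
  have zS: "z \<in> open_stairs" using zP slab_images_subset by blast
  have "r / \<alpha> * \<alpha> \<le> r / \<alpha> * F" using r \<alpha>_pos \<alpha>1_le_F by (intro mult_left_mono) auto
  then have "\<bar>fst (z + (h, 0)) - fst z\<bar> \<le> r / \<alpha> * F" using r \<alpha>_pos by simp
  from shift_strip_stays[OF zS this room]
  have st: "z + (h, 0) \<in> open_stairs" by (simp add: plus_prod_def)
  have ge: "\<alpha> \<le> fst z" "\<alpha> \<le> fst z + h" using st zS unfolding open_stairs_def by auto
  have "r / \<alpha> * \<alpha> \<le> r / \<alpha> * min (fst z) (fst z + h)"
    using r \<alpha>_pos ge by (intro mult_left_mono) auto
  then show ?case using st r \<alpha>_pos by simp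
next
  case (Suc m)
  let ?z = "(inv_TT ^^ m) z" and ?z' = "(inv_TT ^^ m) (z + (h, 0))"
  have "?z \<in> slab_images" using z unfolding roomy_def by blast
  then obtain k where k: "?z \<in> slab_image k" unfolding slab_images_def by blast
  have k1: "real k \<ge> 1" using slab_image_range[OF k] d_pos by auto
  have z'S: "?z' \<in> open_stairs" and eq: "snd ?z' = snd ?z"
    and close: "\<bar>fst ?z - fst ?z'\<bar> \<le> r / \<alpha> * \<theta> ^ m * min (fst ?z) (fst ?z')" using Suc by auto
  have b: "\<alpha> < fst ?z" "fst ?z < \<alpha> + 1" "\<alpha> < fst ?z'" "fst ?z' < \<alpha> + 1"
    using k z'S unfolding slab_image_def open_stairs_def by auto
  define w where "w = cobranch n (real k) ?z"
  define w' where "w' = cobranch n (real k) ?z'"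
  have w: "(inv_TT ^^ Suc m) z = w" using inv_TT_slab_image[OF k] unfolding w_def by simp
  have wS: "w \<in> open_stairs" using k unfolding slab_image_def w_def by simp
  have snd_eq: "snd w' = snd w" unfolding w_def w'_def cobranch_def using eq by simp
  have "\<bar>n / (real k + fst ?z) - n / (real k + fst ?z')\<bar>
      \<le> r / \<alpha> * \<theta> ^ m * (F / (1 + F)) * min (n / (real k + fst ?z)) (n / (real k + fst ?z'))"
    using n_gt_1 k1 b \<alpha>_pos \<alpha>1_le_F \<theta> r close by (intro relative_contraction) auto
  then have close': "\<bar>fst w - fst w'\<bar> \<le> r / \<alpha> * \<theta> ^ Suc m * min (fst w) (fst w')"
    unfolding w_def w'_def cobranch_def \<theta>_def[symmetric] by (simp add: mult_ac)
  have "fst w \<le> F" using wS \<alpha>1_le_F unfolding open_stairs_def by auto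
  then have "r / \<alpha> * \<theta> ^ Suc m * min (fst w) (fst w') \<le> r / \<alpha> * \<theta> ^ Suc m * F"
    using r \<alpha>_pos \<theta> by (intro mult_left_mono) auto
  then have "\<bar>fst w' - fst w\<bar> \<le> r / \<alpha> * \<theta> ^ Suc m * F" using close' by linarith
  moreover have "\<forall>v \<in> {\<alpha>, \<alpha> + 1, R1, R2, L1, L2}. r / \<alpha> * \<theta> ^ Suc m * F < \<bar>fst w - v\<bar>"
    using z w unfolding roomy_def by blast
  ultimately have "(fst w', snd w) \<in> open_stairs" using shift_strip_stays[OF wS] by blast
  then have w'S: "w' \<in> open_stairs" using snd_eq by (metis prod.collapse)
  then have "?z' \<in> slab_image k" using b unfolding slab_image_def w'_def by simp
  then have w': "(inv_TT ^^ Suc m) (z + (h, 0)) = w'" using inv_TT_slab_image unfolding w'_def by simp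
  show ?case unfolding w w' using w'S snd_eq close' by simp
qed

lemma horizontal_hopf:
  assumes W: "W \<in> sets borel" "AE z in M0. TT z \<in> W \<longleftrightarrow> z \<in> W" and r: "0 < r" "\<bar>h\<bar> < r"
  shows "AE z in M0. z \<in> roomy r \<longrightarrow> z \<in> W \<longrightarrow> z + (h, 0) \<in> W"
proof (rule hopf_translation[OF inv_TT_measurable distr_inv_TT W(1)])
  have "AE z in distr M0 M0 inv_TT. TT z \<in> W \<longleftrightarrow> z \<in> W" using W(2) by (simp only: distr_inv_TT)
  then have "AE z in M0. TT (inv_TT z) \<in> W \<longleftrightarrow> inv_TT z \<in> W"
    by (rule AE_distrD[rotated]) simp
  then show "AE z in M0. inv_TT z \<in> W \<longleftrightarrow> z \<in> W" using AE_inv_TT by eventually_elim auto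
  show "roomy r \<subseteq> {z. z + (h, 0) \<in> open_stairs}"
    using roomy_leaf[OF _ r, of _ 0] by auto
  show "(\<lambda>m. r / \<alpha> * \<theta> ^ m * F) \<longlonglongrightarrow> 0"
    using \<theta> by (intro tendsto_mult_left_zero tendsto_mult_right_zero LIMSEQ_realpow_zero) auto
  fix m z assume z: "z \<in> roomy r"
  let ?z = "(inv_TT ^^ m) z" and ?z' = "(inv_TT ^^ m) (z + (h, 0))"
  have c: "?z' \<in> open_stairs" "snd ?z' = snd ?z" "\<bar>fst ?z - fst ?z'\<bar> \<le> r / \<alpha> * \<theta> ^ m * min (fst ?z) (fst ?z')"
    using roomy_leaf[OF z r, of m] by auto
  have "min (fst ?z) (fst ?z') \<le> F" using c(1) \<alpha>1_le_F unfolding open_stairs_def by auto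
  then have "r / \<alpha> * \<theta> ^ m * min (fst ?z) (fst ?z') \<le> r / \<alpha> * \<theta> ^ m * F"
    using r \<alpha>_pos \<theta> by (intro mult_left_mono) auto
  moreover have "dist ?z ?z' = \<bar>fst ?z - fst ?z'\<bar>"
    using c(2) dist_same_snd[of "fst ?z" "snd ?z" "fst ?z'"] by (metis prod.collapse)
  ultimately show "dist ?z ?z' \<le> r / \<alpha> * \<theta> ^ m * F" using c(3) by linarith
qed simp

lemma measure_strip_le:
  assumes "s \<ge> 0"
  shows "measure M0 {z. \<bar>fst z - v\<bar> \<le> s} \<le> dens_upper * (2 * s * F)"
proof -
  let ?S = "{z :: real \<times> real. \<bar>fst z - v\<bar> \<le> s}"
  have S: "?S \<in> sets borel" by measurable
  have "emeasure M0 ?S \<le> ennreal dens_upper * emeasure lborel (open_stairs \<inter> ?S)" by (rule M0_le_lborel[OF S])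
  also have "\<dots> \<le> ennreal dens_upper * emeasure lborel ({v - s..v + s} \<times> {0..F})"
  proof (intro mult_left_mono emeasure_mono)
    show "open_stairs \<inter> ?S \<subseteq> {v - s..v + s} \<times> {0..F}"
      using A_pos unfolding open_stairs_def by (auto simp: abs_le_iff)
    show "{v - s..v + s} \<times> {0..F} \<in> sets lborel" by (simp add: borel_closed closed_Times)
  qed simp
  also have "emeasure lborel ({v - s..v + s} \<times> {0..F}) = emeasure lborel {v - s..v + s} * emeasure lborel {0..F}"
    unfolding lborel_prod[symmetric] by (rule lborel.emeasure_pair_measure_Times) auto
  also have "ennreal dens_upper * (emeasure lborel {v - s..v + s} * emeasure lborel {0..F}) = ennreal (dens_upper * (2 * s * F))"
    using assms F_pos dens_bounds_pos by (simp add: ennreal_mult[symmetric])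
  finally show ?thesis
    using assms F_pos dens_bounds_pos by (simp add: M0.emeasure_eq_measure)
qed

text \<open>
  By invariance, the \<open>m\<close>-th condition fails on a set no larger than the strips of width
  \<open>2 r \<theta>\<^sup>m F / \<alpha>\<close> around the six lines; these measures form a geometric series with sum
  proportional to \<open>r\<close>.
\<close>

lemma measure_not_roomy:
  assumes "r > 0"
  shows "measure M0 (- roomy r) \<le> 12 * dens_upper * F * F / (\<alpha> * (1 - \<theta>)) * r"
proof -
  let ?V = "{\<alpha>, \<alpha> + 1, R1, R2, L1, L2}"
  define s where "s m = r / \<alpha> * \<theta> ^ m * F" for m
  define T where "T m = - slab_images \<union> (\<Union>v\<in>?V. {z. \<bar>fst z - v\<bar> \<le> s m})" for m
  have s0: "s m \<ge> 0" for m unfolding s_def using assms \<alpha>_pos \<theta> F_pos by simp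
  have strip: "{z :: real \<times> real. \<bar>fst z - v\<bar> \<le> s m} \<in> sets borel" for v m by measurable
  have T: "T m \<in> sets borel" for m unfolding T_def using strip by auto
  \<comment> \<open>The six lines may coincide, so there are at most six of them.\<close>
  have P0: "measure M0 (- slab_images) = 0"
  proof -
    have "- slab_images \<in> null_sets M0" using AE_slab_images by (subst AE_iff_null_sets) auto
    then show ?thesis by (rule measure_eq_0_null_sets)
  qed
  have mT: "measure M0 (T m) \<le> 12 * dens_upper * F * s m" for m
  proof -
    have "measure M0 (T m) \<le> measure M0 (- slab_images) + measure M0 (\<Union>v\<in>?V. {z. \<bar>fst z - v\<bar> \<le> s m})"
      unfolding T_def using strip by (intro measure_Un_le) auto
    also have "\<dots> \<le> 0 + (\<Sum>v\<in>?V. measure M0 {z. \<bar>fst z - v\<bar> \<le> s m})"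
      using P0 strip by (intro add_mono measure_UNION_le) auto
    also have "\<dots> \<le> (\<Sum>v\<in>?V. dens_upper * (2 * s m * F))"
      using measure_strip_le[OF s0] by (simp only: add_0) (intro sum_mono)
    also have "\<dots> = card ?V * (dens_upper * (2 * s m * F))" by (rule sum_constant)
    also have "\<dots> \<le> 6 * (dens_upper * (2 * s m * F))"
    proof (intro mult_right_mono)
      have "card ?V \<le> 6" by (intro card_insert_le_m1[THEN order_trans] order_refl) auto
      then show "real (card ?V) \<le> 6" by simp
      show "0 \<le> dens_upper * (2 * s m * F)" using dens_bounds_pos s0 F_pos by simp
    qed
    finally show ?thesis by (simp add: mult_ac)
  qed
  define J where "J m = (inv_TT ^^ m) -` T m" for m
  have im: "(inv_TT ^^ m) \<in> borel_measurable borel" for m by measurable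
  have J: "J m \<in> sets M0" for m unfolding J_def using measurable_sets[OF im T, of m m] by simp
  have mJ: "measure M0 (J m) = measure M0 (T m)" for m
  proof -
    have "measure (distr M0 M0 (inv_TT ^^ m)) (T m) = measure M0 ((inv_TT ^^ m) -` T m \<inter> space M0)"
      using T im by (intro measure_distr) (simp_all cong: measurable_cong_sets)
    then show ?thesis
      unfolding J_def using distr_funpow[OF sets_M0 inv_TT_measurable distr_inv_TT, of m] by simp
  qed
  have s_sums: "(\<lambda>m. 12 * dens_upper * F * s m) sums (12 * dens_upper * F * F / (\<alpha> * (1 - \<theta>)) * r)"
  proof -
    have "(\<lambda>m. 12 * dens_upper * F * (r / \<alpha>) * F * \<theta> ^ m) sums (12 * dens_upper * F * (r / \<alpha>) * F * (1 / (1 - \<theta>)))"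
      using \<theta> by (intro sums_mult geometric_sums) auto
    then show ?thesis unfolding s_def by (simp add: mult_ac)
  qed
  have summ: "summable (\<lambda>m. measure M0 (J m))"
    using mT mJ by (intro summable_comparison_test'[OF sums_summable[OF s_sums]]) auto
  have "- roomy r \<subseteq> (\<Union>m. J m)"
    unfolding roomy_def J_def T_def s_def by (auto simp: not_less)
  then have "measure M0 (- roomy r) \<le> measure M0 (\<Union>m. J m)"
    using J by (intro M0.finite_measure_mono) auto
  also have "\<dots> \<le> (\<Sum>m. measure M0 (J m))"
    using J summ by (intro M0.finite_measure_subadditive_countably) auto
  also have "\<dots> \<le> (\<Sum>m. 12 * dens_upper * F * s m)"
    using mT mJ summ sums_summable[OF s_sums] by (intro suminf_le) auto
  also have "\<dots> = 12 * dens_upper * F * F / (\<alpha> * (1 - \<theta>)) * r" using s_sums by (rule sums_unique[symmetric])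
  finally show ?thesis .
qed

text \<open>
  For small \<open>r\<close> there are roomy points above \<open>X\<close>, and by \<open>horizontal_hopf\<close> and
  Fubini almost all points of the segment around one of them lie above \<open>X\<close> as well.
\<close>

lemma invariant_strip_contains_interval:
  assumes X: "X \<in> sets borel" "AE z in M0. TT z \<in> fst -` X \<longleftrightarrow> z \<in> fst -` X" "measure M0 (fst -` X) > 0"
  obtains x r where "r > 0" "\<alpha> \<le> x - r" "x + r \<le> \<alpha> + 1" "AE y in lborel. x - r < y \<longrightarrow> y < x + r \<longrightarrow> y \<in> X"
proof -
  let ?W = "fst -` X :: (real \<times> real) set"
  note X(1) [measurable]
  have W [measurable]: "?W \<in> sets borel" using measurable_sets[OF borel_pair_fst_snd(1) X(1)] by simp
  \<comment> \<open>With this radius the points that are not roomy have at most half the measure of the strip.\<close>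
  define Cst where "Cst = 12 * dens_upper * F * F / (\<alpha> * (1 - \<theta>))"
  have Cst: "Cst > 0" unfolding Cst_def using dens_bounds_pos F_pos \<alpha>_pos \<theta> by simp
  define r where "r = measure M0 ?W / (2 * Cst)"
  have r: "r > 0" unfolding r_def using X(3) Cst by simp
  have "AE h in lborel. AE z in M0. \<bar>h\<bar> < r \<longrightarrow> z \<in> roomy r \<longrightarrow> z \<in> ?W \<longrightarrow> z + (h, 0) \<in> ?W"
  proof (rule AE_I2)
    fix h :: real
    show "AE z in M0. \<bar>h\<bar> < r \<longrightarrow> z \<in> roomy r \<longrightarrow> z \<in> ?W \<longrightarrow> z + (h, 0) \<in> ?W"
      using horizontal_hopf[OF W X(2) r, of h] by (cases "\<bar>h\<bar> < r") auto
  qed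
  then have 1: "AE h in lborel. AE z in lborel. z \<in> open_stairs \<longrightarrow> \<bar>h\<bar> < r \<longrightarrow> z \<in> roomy r \<longrightarrow> z \<in> ?W \<longrightarrow> z + (h, 0) \<in> ?W"
    by (simp only: AE_M0_iff)
  have "{q \<in> space (lborel \<Otimes>\<^sub>M lborel :: (real \<times> real \<times> real) measure).
      snd q \<in> open_stairs \<longrightarrow> \<bar>fst q\<bar> < r \<longrightarrow> snd q \<in> roomy r \<longrightarrow> snd q \<in> ?W \<longrightarrow> snd q + (fst q, 0) \<in> ?W}
     \<in> sets (lborel \<Otimes>\<^sub>M lborel)"
    by measurable
  with 1 have "AE z in lborel. AE h in lborel. z \<in> open_stairs \<longrightarrow> \<bar>h\<bar> < r \<longrightarrow> z \<in> roomy r \<longrightarrow> z \<in> ?W \<longrightarrow> z + (h, 0) \<in> ?W"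
    by (subst (asm) lborel_pair.AE_commute) auto
  then have ae: "AE z in M0. AE h in lborel. \<bar>h\<bar> < r \<longrightarrow> z \<in> roomy r \<longrightarrow> z \<in> ?W \<longrightarrow> z + (h, 0) \<in> ?W"
    unfolding AE_M0_iff by eventually_elim auto
  have "\<exists>z. z \<in> ?W \<and> z \<in> roomy r \<and> (AE h in lborel. \<bar>h\<bar> < r \<longrightarrow> z \<in> roomy r \<longrightarrow> z \<in> ?W \<longrightarrow> z + (h, 0) \<in> ?W)"
  proof (rule ccontr)
    assume no: "\<not> ?thesis"
    have "AE z in M0. z \<in> ?W \<longrightarrow> z \<in> - roomy r"
      using ae by eventually_elim (use no in blast)
    then have "measure M0 ?W \<le> measure M0 (- roomy r)"
      by (intro M0.finite_measure_mono_AE) auto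
    also have "\<dots> \<le> Cst * r" using measure_not_roomy[OF r] unfolding Cst_def .
    also have "\<dots> = measure M0 ?W / 2" unfolding r_def using Cst by simp
    finally show False using X(3) by simp
  qed
  then obtain z where z: "z \<in> ?W" "z \<in> roomy r"
     "AE h in lborel. \<bar>h\<bar> < r \<longrightarrow> z \<in> roomy r \<longrightarrow> z \<in> ?W \<longrightarrow> z + (h, 0) \<in> ?W" by blast
  let ?x = "fst z"
  have "AE h in lborel. \<bar>h\<bar> < r \<longrightarrow> ?x + h \<in> X"
    using z(3) by eventually_elim (use z in auto)
  from AE_lborel_translate[OF this, of "- ?x"]
  have 2: "AE y in lborel. ?x - r < y \<longrightarrow> y < ?x + r \<longrightarrow> y \<in> X"
    by eventually_elim auto
  have "\<alpha> < ?x + h \<and> ?x + h < \<alpha> + 1" if "\<bar>h\<bar> < r" for h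
    using roomy_leaf[OF z(2) r that, of 0] unfolding open_stairs_def by auto
  note inside = this
  show ?thesis
  proof (rule that[of "r / 2" ?x])
    show "r / 2 > 0" using r by simp
    show "\<alpha> \<le> ?x - r / 2" "?x + r / 2 \<le> \<alpha> + 1" using inside[of "- r / 2"] inside[of "r / 2"] r by auto
    show "AE y in lborel. ?x - r / 2 < y \<longrightarrow> y < ?x + r / 2 \<longrightarrow> y \<in> X"
      using 2 by eventually_elim (use r in auto)
  qed
qed

end

section \<open>Ergodicity\<close>

context matched_expansion begin

definition wrap :: "real \<Rightarrow> real" where "wrap x = x - of_int \<lfloor>x - \<alpha>\<rfloor>"

lemma wrap_id: "\<alpha> < x \<Longrightarrow> x < \<alpha> + 1 \<Longrightarrow> wrap x = x"
proof -
  assume "\<alpha> < x" "x < \<alpha> + 1"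
  then have "\<lfloor>x - \<alpha>\<rfloor> = 0" by (intro floor_unique) auto
  then show "wrap x = x" unfolding wrap_def by simp
qed

lemma wrap_periodic: "wrap (x + 1) = wrap x"
proof -
  have "\<lfloor>x + 1 - \<alpha>\<rfloor> = \<lfloor>x - \<alpha>\<rfloor> + 1"
    using floor_add_int[of "x - \<alpha>" 1] by (simp add: algebra_simps)
  then show ?thesis unfolding wrap_def by simp
qed

lemma Tmap_wrap: "x \<noteq> \<alpha> \<Longrightarrow> Tmap N \<alpha> x = wrap (n / x)"
  unfolding Tmap_def wrap_def digit_def by simp

lemma AE_fibres:
  assumes "AE z in M0. Q (fst z)"
  shows "AE x in lborel. \<alpha> < x \<longrightarrow> x < \<alpha> + 1 \<longrightarrow> Q x"
proof -
  have "AE z in lborel \<Otimes>\<^sub>M lborel. z \<in> open_stairs \<longrightarrow> Q (fst z)"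
    using assms unfolding AE_M0_iff lborel_prod .
  from lborel_pair.AE_pair[OF this]
  have "AE x in lborel. AE y in lborel. (x, y) \<in> open_stairs \<longrightarrow> Q x" by simp
  then show ?thesis using AE_generic
  proof eventually_elim
    fix x assume ae: "AE y in lborel. (x, y) \<in> open_stairs \<longrightarrow> Q x" and g: "generic x"
    show "\<alpha> < x \<longrightarrow> x < \<alpha> + 1 \<longrightarrow> Q x"
    proof (intro impI, rule ccontr)
      assume x: "\<alpha> < x" "x < \<alpha> + 1" "\<not> Q x"
      from g obtain b t where bt: "b < t" "{y. (x, y) \<in> open_stairs} = {b<..<t}"
        by (rule fibre_bounds) (use x in auto)
      have "AE y in lborel. y \<notin> {b<..<t}"
        using ae by eventually_elim (use x bt(2) in auto)
      then have "{b<..<t} \<in> null_sets lborel" by (subst AE_iff_null_sets) auto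
      then have "emeasure lborel {b<..<t} = 0" by (rule null_setsD1)
      then show False using bt(1) by simp
    qed
  qed
qed

text \<open>
  The set \<open>U\<close> of points around which the periodic extension of \<open>X\<close> has full measure satisfies
  the hypotheses of \<open>invariant_open_set_is_everything\<close>. The regularity condition holds because a single
  point does not affect an almost everywhere statement.
\<close>

lemma invariant_strip_full:
  assumes X: "X \<in> sets borel" "AE z in M0. TT z \<in> fst -` X \<longleftrightarrow> z \<in> fst -` X" "measure M0 (fst -` X) > 0"
  shows "AE z in M0. fst z \<in> X"
proof -
  define Q where "Q y \<longleftrightarrow> wrap y \<in> X" for y
  define U where "U = {x. \<exists>e>0. AE y in lborel. x - e < y \<longrightarrow> y < x + e \<longrightarrow> Q y}"
  have U_I: "x \<in> U" if "p < x" "x < q" "AE y in lborel. p < y \<longrightarrow> y < q \<longrightarrow> Q y" for p x q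
  proof -
    have "AE y in lborel. x - min (x - p) (q - x) < y \<longrightarrow> y < x + min (x - p) (q - x) \<longrightarrow> Q y"
      using that(3) by eventually_elim auto
    then show ?thesis unfolding U_def using that(1,2) by (intro CollectI exI[of _ "min (x - p) (q - x)"]) auto
  qed
  have Q_per: "Q (y + 1) = Q y" for y unfolding Q_def wrap_periodic ..
  have "AE z in M0. Tmap N \<alpha> (fst z) \<in> X \<longleftrightarrow> fst z \<in> X" using X(2) by (simp add: TT_alt)
  from AE_fibres[OF this] have Q_inv: "AE x in lborel. \<alpha> < x \<longrightarrow> x < \<alpha> + 1 \<longrightarrow> Q (n / x) = Q x"
    by eventually_elim (auto simp: Q_def wrap_id Tmap_wrap[symmetric])
  have "AE y in lborel. y \<in> U \<longrightarrow> Q y" unfolding U_def by (rule locally_AE_imp_AE)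
  note U_AE = this
  have "U = UNIV"
  proof (rule invariant_open_set_is_everything)
    show "open U" unfolding open_contains_ball
    proof
      fix x assume "x \<in> U"
      then obtain e where e: "e > 0" "AE y in lborel. x - e < y \<longrightarrow> y < x + e \<longrightarrow> Q y" unfolding U_def by blast
      have "ball x e \<subseteq> U"
        using U_I[of "x - e" _ "x + e"] e(2) by (auto simp: ball_eq_greaterThanLessThan)
      then show "\<exists>e>0. ball x e \<subseteq> U" using e(1) by blast
    qed
    show "x \<in> U \<longleftrightarrow> x + 1 \<in> U" for x
    proof
      assume "x \<in> U"
      then obtain e where e: "e > 0" "AE y in lborel. x - e < y \<longrightarrow> y < x + e \<longrightarrow> Q y" unfolding U_def by blast
      have "AE y in lborel. x + 1 - e < y \<longrightarrow> y < x + 1 + e \<longrightarrow> Q y"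
        using AE_lborel_translate[OF e(2), of "- 1"] by eventually_elim (use Q_per[of "_ - 1"] in auto)
      then show "x + 1 \<in> U" using e(1) unfolding U_def by blast
    next
      assume "x + 1 \<in> U"
      then obtain e where e: "e > 0" "AE y in lborel. x + 1 - e < y \<longrightarrow> y < x + 1 + e \<longrightarrow> Q y" unfolding U_def by blast
      have "AE y in lborel. x - e < y \<longrightarrow> y < x + e \<longrightarrow> Q y"
        using AE_lborel_translate[OF e(2), of 1] by eventually_elim (use Q_per in auto)
      then show "x \<in> U" using e(1) unfolding U_def by blast
    qed
    show "x \<in> U \<longleftrightarrow> n / x \<in> U" if x: "\<alpha> < x" "x < \<alpha> + 1" for x
    proof
      assume "x \<in> U"
      then obtain e where e: "e > 0" "AE y in lborel. x - e < y \<longrightarrow> y < x + e \<longrightarrow> Q y" unfolding U_def by blast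
      define p where "p = max (x - e) \<alpha>"
      define q where "q = min (x + e) (\<alpha> + 1)"
      have pq: "\<alpha> \<le> p" "p < x" "x < q" "q \<le> \<alpha> + 1" unfolding p_def q_def using e x by auto
      have "AE y in lborel. p < y \<longrightarrow> y < q \<longrightarrow> Q (n / y)"
        using e(2) Q_inv by eventually_elim (auto simp: p_def q_def)
      then have "AE w in lborel. n / q < w \<longrightarrow> w < n / p \<longrightarrow> Q (n / (n / w))"
        using n_gt_1 pq \<alpha>_pos by (intro AE_reciprocal) auto
      then have "AE w in lborel. n / q < w \<longrightarrow> w < n / p \<longrightarrow> Q w" using n_gt_1 by simp
      moreover have "n / q < n / x" "n / x < n / p" using pq \<alpha>_pos n_gt_1 by (auto intro!: divide_strict_left_mono)
      ultimately show "n / x \<in> U" using U_I by blast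
    next
      assume "n / x \<in> U"
      then obtain e where e: "e > 0" "AE y in lborel. n / x - e < y \<longrightarrow> y < n / x + e \<longrightarrow> Q y" unfolding U_def by blast
      define p where "p = max (n / x - e) (n / (\<alpha> + 1))"
      define q where "q = min (n / x + e) (n / \<alpha>)"
      have "n / (\<alpha> + 1) < n / x" "n / x < n / \<alpha>" using x \<alpha>_pos n_gt_1 by (auto intro!: divide_strict_left_mono)
      then have pq: "n / (\<alpha> + 1) \<le> p" "p < n / x" "n / x < q" "q \<le> n / \<alpha>" unfolding p_def q_def using e by auto
      have "0 < n / (\<alpha> + 1)" using \<alpha>_pos n_gt_1 by simp
      then have p0: "p > 0" "q > 0" using pq by linarith+
      have "AE y in lborel. p < y \<longrightarrow> y < q \<longrightarrow> Q y"
        using e(2) by eventually_elim (auto simp: p_def q_def)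
      then have "AE w in lborel. n / q < w \<longrightarrow> w < n / p \<longrightarrow> Q (n / w)"
        using n_gt_1 pq p0 by (intro AE_reciprocal) auto
      moreover have "\<alpha> \<le> n / q" "n / p \<le> \<alpha> + 1" using pq p0 \<alpha>_pos by (simp_all add: field_simps)
      ultimately have "AE w in lborel. n / q < w \<longrightarrow> w < n / p \<longrightarrow> Q w"
        using Q_inv by (auto elim!: eventually_elim2)
      moreover have "n / q < x" "x < n / p" using pq p0 x \<alpha>_pos by (simp_all add: field_simps)
      ultimately show "x \<in> U" using U_I by blast
    qed
    show "x \<in> U" if "p < x" "x < q" "{p<..<x} \<subseteq> U" "{x<..<q} \<subseteq> U" for p x q
    proof (rule U_I[OF that(1,2)])
      show "AE y in lborel. p < y \<longrightarrow> y < q \<longrightarrow> Q y"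
        using U_AE AE_lborel_singleton[of x]
      proof eventually_elim
        fix y assume "y \<in> U \<longrightarrow> Q y" "y \<noteq> x"
        moreover from \<open>y \<noteq> x\<close> have "y < x \<or> x < y" by linarith
        ultimately show "p < y \<longrightarrow> y < q \<longrightarrow> Q y" using that(3,4) by auto
      qed
    qed
    obtain x r where xr: "r > 0" "\<alpha> \<le> x - r" "x + r \<le> \<alpha> + 1" "AE y in lborel. x - r < y \<longrightarrow> y < x + r \<longrightarrow> y \<in> X"
      using invariant_strip_contains_interval[OF X] by blast
    have "AE y in lborel. x - r < y \<longrightarrow> y < x + r \<longrightarrow> Q y"
      using xr(4) by eventually_elim (use xr wrap_id in \<open>auto simp: Q_def\<close>)
    then have "x \<in> U" unfolding U_def using xr(1) by blast
    then show "U \<noteq> {}" by blast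
  qed
  then have "AE y in lborel. Q y" using U_AE by simp
  then have "AE y in lborel. \<alpha> < y \<longrightarrow> y < \<alpha> + 1 \<longrightarrow> y \<in> X"
    by eventually_elim (use wrap_id in \<open>auto simp: Q_def\<close>)
  then have "AE x in lborel. AE y in (lborel :: real measure). \<alpha> < fst (x, y) \<longrightarrow> fst (x, y) < \<alpha> + 1 \<longrightarrow> fst (x, y) \<in> X"
    by eventually_elim simp
  then have "AE z in lborel \<Otimes>\<^sub>M (lborel :: real measure). \<alpha> < fst z \<longrightarrow> fst z < \<alpha> + 1 \<longrightarrow> fst z \<in> X"
  proof (rule lborel_pair.AE_pair_measure[rotated])
    have "{z :: real \<times> real. \<alpha> < fst z \<longrightarrow> fst z < \<alpha> + 1 \<longrightarrow> fst z \<in> X} \<in> sets borel"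
      using X(1) by measurable
    then show "{z \<in> space (lborel \<Otimes>\<^sub>M (lborel :: real measure)). \<alpha> < fst z \<longrightarrow> fst z < \<alpha> + 1 \<longrightarrow> fst z \<in> X} \<in> sets (lborel \<Otimes>\<^sub>M lborel)"
      unfolding lborel_prod by simp
  qed
  then show ?thesis unfolding AE_M0_iff lborel_prod
    by eventually_elim (auto simp: open_stairs_def)
qed

theorem M0_ergodic:
  assumes W: "W \<in> sets borel" "AE z in M0. TT z \<in> W \<longleftrightarrow> z \<in> W"
  shows "measure M0 W = 0 \<or> measure M0 W = 1"
proof -
  obtain X where X: "X \<in> sets borel" "AE z in M0. z \<in> W \<longleftrightarrow> fst z \<in> X"
    using invariant_is_strip[OF W] by blast
  have fX: "fst -` X \<in> sets (borel :: (real \<times> real) measure)"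
    using measurable_sets[OF borel_pair_fst_snd(1) X(1)] by simp
  have eq: "measure M0 W = measure M0 (fst -` X)"
    using X(2) W(1) fX by (intro M0.finite_measure_eq_AE) auto
  have "AE z in M0. TT z \<in> W \<longleftrightarrow> fst (TT z) \<in> X"
    using AE_funpow[OF sets_M0 TT_measurable distr_TT X(2), of 1] by simp
  then have inv: "AE z in M0. TT z \<in> fst -` X \<longleftrightarrow> z \<in> fst -` X"
    using X(2) W(2) by eventually_elim auto
  show ?thesis
  proof (cases "measure M0 (fst -` X) > 0")
    case True
    have "AE z in M0. z \<in> fst -` X" using invariant_strip_full[OF X(1) inv True] by simp
    then have "measure M0 (fst -` X) = 1" using fX by (intro M0.prob_eq_1[THEN iffD2]) auto
    then show ?thesis using eq by simp
  next
    case False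
    then show ?thesis using eq measure_nonneg[of M0 "fst -` X"] by simp
  qed
qed

end

section \<open>Maps defined almost everywhere\<close>

lemma ae_measure_preservingI:
  assumes g: "g \<in> measurable M M'" "distr M M' g = M'" and ae: "AE x in M. f x = g x"
  shows "ae_measure_preserving M M' f"
proof -
  obtain Z where Z: "Z \<in> null_sets M" "{x \<in> space M. f x \<noteq> g x} \<subseteq> Z"
    using ae unfolding eventually_ae_filter by auto
  let ?S = "space M - Z"
  have S: "?S \<in> sets M" using Z(1) by auto
  have eq: "\<And>x. x \<in> space (restrict_space M ?S) \<Longrightarrow> f x = g x"
    using Z(2) by (auto simp: space_restrict_space)
  have meas: "f \<in> measurable (restrict_space M ?S) M'"
  proof -
    have "f \<in> measurable (restrict_space M ?S) M' \<longleftrightarrow> g \<in> measurable (restrict_space M ?S) M'"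
      by (rule measurable_cong) (rule eq)
    then show ?thesis using measurable_restrict_space1[OF g(1)] by blast
  qed
  have "distr (restrict_space M ?S) M' f = M'"
  proof (rule measure_eqI)
    fix X assume "X \<in> sets (distr (restrict_space M ?S) M' f)"
    then have X: "X \<in> sets M'" by simp
    have gX: "g -` X \<inter> space M \<in> sets M" using g(1) X by (rule measurable_sets)
    have "f -` X \<inter> space (restrict_space M ?S) = (g -` X \<inter> space M) - Z"
      using Z(2) by (auto simp: space_restrict_space)
    then have "emeasure (distr (restrict_space M ?S) M' f) X = emeasure (restrict_space M ?S) ((g -` X \<inter> space M) - Z)"
      using meas X by (simp add: emeasure_distr)
    also have "\<dots> = emeasure M ((g -` X \<inter> space M) - Z)"
      using S sets.sets_into_space by (intro emeasure_restrict_space) auto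
    also have "\<dots> = emeasure M (g -` X \<inter> space M)"
      using Z(1) gX by (rule emeasure_Diff_null_set)
    also have "\<dots> = emeasure (distr M M' g) X" using g(1) X by (simp add: emeasure_distr)
    also have "\<dots> = emeasure M' X" by (simp only: g(2))
    finally show "emeasure (distr (restrict_space M ?S) M' f) X = emeasure M' X" .
  qed simp
  then show ?thesis using Z(1) meas unfolding ae_measure_preserving_def by blast
qed

text \<open>
  Redefining the map as a constant on the exceptional null set makes it measurable everywhere.
\<close>

lemma ae_measure_preservingE:
  assumes f: "ae_measure_preserving M M' f" and c: "c \<in> space M'"
  obtains g where "g \<in> measurable M M'" "distr M M' g = M'" "AE x in M. f x = g x"
proof -
  obtain Z where Z: "Z \<in> null_sets M" "f \<in> measurable (restrict_space M (space M - Z)) M'"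
      "distr (restrict_space M (space M - Z)) M' f = M'"
    using f unfolding ae_measure_preserving_def by blast
  let ?S = "space M - Z"
  have S: "?S \<in> sets M" using Z(1) by auto
  define g where "g x = (if x \<in> Z then c else f x)" for x
  have space: "f x \<in> space M'" if "x \<in> ?S" for x
    using measurable_space[OF Z(2)] that by (simp add: space_restrict_space)
  have pre: "f -` X \<inter> ?S \<in> sets M" if "X \<in> sets M'" for X
  proof -
    have "f -` X \<inter> space (restrict_space M ?S) \<in> sets (restrict_space M ?S)"
      using Z(2) that by (rule measurable_sets)
    then show ?thesis using S by (auto simp: sets_restrict_space_iff space_restrict_space Int_ac)
  qed
  have gpre: "g -` X \<inter> space M = (f -` X \<inter> ?S) \<union> (if c \<in> X then Z \<inter> space M else {})" for X
    unfolding g_def by (auto split: if_splits)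
  have Zs: "Z \<in> sets M" using Z(1) by auto
  have g: "g \<in> measurable M M'"
  proof (rule measurableI)
    show "g x \<in> space M'" if "x \<in> space M" for x using that c space unfolding g_def by auto
    show "g -` X \<inter> space M \<in> sets M" if "X \<in> sets M'" for X
      unfolding gpre using pre[OF that] Zs by auto
  qed
  have ae: "AE x in M. f x = g x"
    using AE_not_in[OF Z(1)] by eventually_elim (simp add: g_def)
  have "distr M M' g = M'"
  proof (rule measure_eqI)
    fix X assume "X \<in> sets (distr M M' g)"
    then have X: "X \<in> sets M'" by simp
    have gX: "g -` X \<inter> space M \<in> sets M" using g X by (rule measurable_sets)
    have "emeasure (distr M M' g) X = emeasure M (g -` X \<inter> space M)" using g X by (simp add: emeasure_distr)
    also have "\<dots> = emeasure M ((g -` X \<inter> space M) - Z)"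
      using Z(1) gX by (rule emeasure_Diff_null_set[symmetric])
    also have "(g -` X \<inter> space M) - Z = f -` X \<inter> ?S" unfolding g_def by auto
    also have "emeasure M (f -` X \<inter> ?S) = emeasure (restrict_space M ?S) (f -` X \<inter> ?S)"
      using S sets.sets_into_space by (intro emeasure_restrict_space[symmetric]) auto
    also have "\<dots> = emeasure (distr (restrict_space M ?S) M' f) X"
      using Z(2) X by (auto simp add: emeasure_distr space_restrict_space Int_ac intro!: arg_cong[where f = "emeasure _"])
    also have "\<dots> = emeasure M' X" by (simp only: Z(3))
    finally show "emeasure (distr M M' g) X = emeasure M' X" .
  qed simp
  then show ?thesis using that g ae by blast
qed

lemma ergodic_factor:
  assumes erg: "ergodic_system M T" and p: "p \<in> measurable M M'" "distr M M' p = M'"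
    and T': "T' \<in> measurable M' M'" and eq: "AE x in M. p (T x) = T' (p x)"
  shows "ergodic_system M' T'"
proof -
  have M: "prob_space M" "ae_measure_preserving M M T"
    and inv: "\<And>S. S \<in> sets M \<Longrightarrow> AE x in M. T x \<in> S \<longleftrightarrow> x \<in> S \<Longrightarrow> measure M S = 0 \<or> measure M S = 1"
    using erg unfolding ergodic_system_def by auto
  interpret prob_space M by fact
  obtain c where "c \<in> space M" using not_empty by blast
  then obtain g where g: "g \<in> measurable M M" "distr M M g = M" "AE x in M. T x = g x"
    using ae_measure_preservingE[OF M(2)] by blast
  have "distr M' M' T' = distr (distr M M' p) M' T'" by (simp only: p(2))
  also have "\<dots> = distr M M' (T' \<circ> p)" using T' p(1) by (rule distr_distr)
  also have "\<dots> = distr M M' (p \<circ> g)"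
  proof (rule distr_cong_AE)
    show "AE x in M. (T' \<circ> p) x = (p \<circ> g) x" using eq g(3) by eventually_elim simp
  qed (use T' p(1) g(1) in auto)
  also have "\<dots> = distr (distr M M g) M' p" using p(1) g(1) by (rule distr_distr[symmetric])
  also have "\<dots> = M'" by (simp only: g(2) p(2))
  finally have "ae_measure_preserving M' M' T'" using T' by (intro ae_measure_preservingI) auto
  moreover have "prob_space M'" using prob_space_distr[OF p(1)] by (simp only: p(2))
  moreover have "measure M' S = 0 \<or> measure M' S = 1"
    if S: "S \<in> sets M'" and ae: "AE x in M'. T' x \<in> S \<longleftrightarrow> x \<in> S" for S
  proof -
    let ?R = "p -` S \<inter> space M"
    have R: "?R \<in> sets M" using p(1) S by (rule measurable_sets)
    have "AE x in distr M M' p. T' x \<in> S \<longleftrightarrow> x \<in> S" using ae by (simp only: p(2))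
    then have "AE x in M. T' (p x) \<in> S \<longleftrightarrow> p x \<in> S" by (rule AE_distrD[OF p(1)])
    moreover have "AE x in M. T x \<in> space M \<and> x \<in> space M"
      using g(3) AE_space by eventually_elim (use measurable_space[OF g(1)] in auto)
    ultimately have "AE x in M. T x \<in> ?R \<longleftrightarrow> x \<in> ?R" using eq by eventually_elim auto
    then have "measure M ?R = 0 \<or> measure M ?R = 1" using inv R by blast
    moreover have "measure (distr M M' p) S = measure M ?R" using p(1) S by (rule measure_distr)
    ultimately show ?thesis by (simp only: p(2))
  qed
  ultimately show ?thesis unfolding ergodic_system_def by blast
qed

section \<open>The system on the polygon\<close>

context matched_expansion begin

abbreviation "Om \<equiv> \<Omega> N d i \<alpha>"
abbreviation "M \<equiv> mubar N d i \<alpha>"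
abbreviation "\<mu> \<equiv> mu N d i \<alpha>"

lemma \<Omega>_borel [measurable, simp]: "Om \<in> sets borel"
  by (rule borel_closed[OF closed_\<Omega>])

lemma sets_M: "sets M = sets (restrict_space borel Om)"
  unfolding mubar_def by (simp add: sets_restrict_space)

lemma space_M: "space M = Om"
  unfolding mubar_def by (simp add: space_restrict_space)

lemma sets_M_iff: "X \<in> sets M \<longleftrightarrow> X \<in> sets borel \<and> X \<subseteq> Om"
  unfolding sets_M by (subst sets_restrict_space_iff) auto

lemma dens2_eq: "dens2 N d i \<alpha> z = H * mobius_density n z * indicator Om z"
  unfolding dens2_def mobius_density_def H_def by (cases z) simp

lemma AE_M_iff: "(AE z in M. Q z) \<longleftrightarrow> (AE z in M0. Q z)"
proof -
  have m: "(\<lambda>z. ennreal (dens2 N d i \<alpha> z)) \<in> borel_measurable (restrict_space lborel Om)"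
    unfolding dens2_eq[abs_def] by (rule measurable_restrict_space1) measurable
  have "(AE z in M. Q z) \<longleftrightarrow> (AE z in lborel. z \<in> Om \<longrightarrow> 0 < ennreal (dens2 N d i \<alpha> z) \<longrightarrow> Q z)"
    unfolding mubar_def using m by (simp add: AE_density AE_restrict_space_iff)
  also have "\<dots> \<longleftrightarrow> (AE z in lborel. z \<in> open_stairs \<longrightarrow> Q z)"
  proof -
    have pos: "z \<in> open_stairs \<Longrightarrow> 0 < dens2 N d i \<alpha> z" for z
      using density_bounds(1)[of z] dens_bounds_pos open_stairs_subset_\<Omega> unfolding dens2_eq by auto
    have iff: "AE z in lborel. (z \<in> Om \<longrightarrow> 0 < ennreal (dens2 N d i \<alpha> z) \<longrightarrow> Q z) \<longleftrightarrow> (z \<in> open_stairs \<longrightarrow> Q z)"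
      using AE_\<Omega>_iff by eventually_elim (use pos in auto)
    show ?thesis
    proof
      assume "AE z in lborel. z \<in> Om \<longrightarrow> 0 < ennreal (dens2 N d i \<alpha> z) \<longrightarrow> Q z"
      then show "AE z in lborel. z \<in> open_stairs \<longrightarrow> Q z" using iff by eventually_elim blast
    next
      assume "AE z in lborel. z \<in> open_stairs \<longrightarrow> Q z"
      then show "AE z in lborel. z \<in> Om \<longrightarrow> 0 < ennreal (dens2 N d i \<alpha> z) \<longrightarrow> Q z" using iff by eventually_elim blast
    qed
  qed
  finally show ?thesis unfolding AE_M0_iff .
qed

lemma emeasure_M:
  assumes "X \<in> sets M"
  shows "emeasure M X = emeasure M0 X"
proof -
  have X: "X \<in> sets borel" "X \<subseteq> Om" using assms sets_M_iff by auto
  have m: "(\<lambda>z. ennreal (dens2 N d i \<alpha> z)) \<in> borel_measurable (restrict_space lborel Om)"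
    unfolding dens2_eq[abs_def] by (rule measurable_restrict_space1) measurable
  have "emeasure M X = (\<integral>\<^sup>+z. ennreal (dens2 N d i \<alpha> z) * indicator X z \<partial>restrict_space lborel Om)"
    unfolding mubar_def using m X by (intro emeasure_density) (auto simp: sets_restrict_space_iff)
  also have "\<dots> = (\<integral>\<^sup>+z. ennreal (dens2 N d i \<alpha> z) * indicator X z * indicator Om z \<partial>lborel)"
    by (rule nn_integral_restrict_space) simp
  also have "\<dots> = (\<integral>\<^sup>+z. ennreal (H * mobius_density n z * indicator open_stairs z) * indicator X z \<partial>lborel)"
    using AE_\<Omega>_iff by (intro nn_integral_cong_AE, eventually_elim) (auto simp: dens2_eq indicator_def)
  also have "\<dots> = emeasure M0 X"
    unfolding M0_def using X by (subst emeasure_density) auto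
  finally show ?thesis .
qed

lemma measure_M: "X \<in> sets M \<Longrightarrow> measure M X = measure M0 X"
  by (simp add: measure_def emeasure_M)

lemma AE_\<Omega>: "AE z in M0. z \<in> Om"
  using AE_M0_stairs by eventually_elim (use open_stairs_subset_\<Omega> in auto)

lemma prob_space_M: "prob_space M"
proof
  have "Om \<in> sets M" by (simp add: sets_M_iff)
  then have "emeasure M (space M) = emeasure M0 Om" by (simp add: space_M emeasure_M)
  also have "\<dots> = emeasure M0 (space M0)" using AE_\<Omega> by (intro emeasure_eq_AE) auto
  also have "\<dots> = 1" by (rule M0.emeasure_space_1)
  finally show "emeasure M (space M) = 1" .
qed

lemma ae_mp_M:
  assumes f: "f \<in> borel_measurable borel" "distr M0 M0 f = M0"
  shows "ae_measure_preserving M M f"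
proof -
  interpret M: prob_space M by (rule prob_space_M)
  obtain z0 where z0: "z0 \<in> Om" using M.not_empty by (auto simp: space_M)
  define g where "g z = (if f z \<in> Om then f z else z0)" for z
  have fO: "f -` Om \<in> sets borel" using measurable_sets[OF f(1) \<Omega>_borel] by simp
  have g0: "g \<in> borel_measurable borel"
    unfolding g_def[abs_def] using f(1) fO by (intro measurable_If) (auto simp: vimage_def)
  have g: "g \<in> measurable M M"
  proof (subst measurable_cong_sets[OF sets_M sets_M], rule measurable_restrict_space2)
    show "g \<in> space (restrict_space borel Om) \<rightarrow> Om" using z0 unfolding g_def by auto
    show "g \<in> measurable (restrict_space borel Om) borel" using g0 by (rule measurable_restrict_space1)
  qed
  have "AE z in M0. f z \<in> Om" using AE_funpow[OF sets_M0 f AE_\<Omega>, of 1] by simp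
  then have fg: "AE z in M0. f z = g z" by eventually_elim (simp add: g_def)
  have "distr M M g = M"
  proof (rule measure_eqI)
    fix X assume "X \<in> sets (distr M M g)"
    then have X: "X \<in> sets M" by simp
    then have Xb: "X \<in> sets borel" by (simp add: sets_M_iff)
    have gX: "g -` X \<inter> space M \<in> sets M" using g X by (rule measurable_sets)
    have fX: "f -` X \<in> sets borel" using measurable_sets[OF f(1) Xb] by simp
    have "emeasure (distr M M g) X = emeasure M (g -` X \<inter> space M)" using g X by (rule emeasure_distr)
    also have "\<dots> = emeasure M0 (g -` X \<inter> space M)" using gX by (rule emeasure_M)
    also have "\<dots> = emeasure M0 (f -` X)"
    proof (rule emeasure_eq_AE)
      show "AE z in M0. z \<in> g -` X \<inter> space M \<longleftrightarrow> z \<in> f -` X"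
        using fg AE_\<Omega> by eventually_elim (simp add: space_M)
    qed (use gX fX sets_M_iff in auto)
    also have "\<dots> = emeasure (distr M0 M0 f) X" using f(1) Xb by (subst emeasure_distr) auto
    also have "\<dots> = emeasure M X" using X by (simp only: f(2) emeasure_M)
    finally show "emeasure (distr M M g) X = emeasure M X" .
  qed simp
  then show ?thesis using g fg by (intro ae_measure_preservingI) (auto simp: AE_M_iff)
qed

lemma ergodic_M: "ergodic_system M TT"
proof -
  have "measure M S = 0 \<or> measure M S = 1" if "S \<in> sets M" "AE z in M. TT z \<in> S \<longleftrightarrow> z \<in> S" for S
    using M0_ergodic[of S] that by (simp add: measure_M AE_M_iff) (simp add: sets_M_iff)
  then show ?thesis
    unfolding ergodic_system_def using prob_space_M ae_mp_M[OF TT_measurable distr_TT] by blast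
qed

lemma invertible_M: "invertible_system M TT"
  unfolding invertible_system_def
proof (intro conjI exI)
  show "ae_measure_preserving M M TT" by (rule ae_mp_M[OF TT_measurable distr_TT])
  show "ae_measure_preserving M M inv_TT" by (rule ae_mp_M[OF inv_TT_measurable distr_inv_TT])
  show "AE z in M. inv_TT (TT z) = z" unfolding AE_M_iff using AE_TT by eventually_elim auto
  show "AE z in M. TT (inv_TT z) = z" unfolding AE_M_iff using AE_inv_TT by eventually_elim auto
qed

lemma sets_\<mu>: "sets \<mu> = sets (restrict_space borel {\<alpha>..\<alpha> + 1})"
  unfolding mu_def by simp

lemma fst_measurable: "fst \<in> measurable M \<mu>"
proof (subst measurable_cong_sets[OF sets_M sets_\<mu>], rule measurable_restrict_space2)
  show "fst \<in> space (restrict_space borel Om) \<rightarrow> {\<alpha>..\<alpha> + 1}"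
    using \<Omega>_subset_closed_stairs unfolding closed_stairs_def by auto
  show "fst \<in> measurable (restrict_space borel Om) borel" by (rule measurable_restrict_space1) measurable
qed

lemma distr_fst: "distr M \<mu> fst = \<mu>"
proof -
  have "distr M \<mu> fst = distr M (restrict_space borel {\<alpha>..\<alpha> + 1}) fst"
    by (rule distr_cong) (simp_all add: sets_\<mu>)
  then show ?thesis by (simp add: mu_def)
qed

lemma factor_M: "factor_map M TT \<mu> (Tmap N \<alpha>) fst"
  unfolding factor_map_def
  using ae_measure_preservingI[OF fst_measurable distr_fst] by (simp add: TT_alt)

lemma Tmap_range: "x \<in> {\<alpha>..\<alpha> + 1} \<Longrightarrow> Tmap N \<alpha> x \<in> {\<alpha>..\<alpha> + 1}"
proof (cases "x = \<alpha> \<and> n / \<alpha> - \<alpha> \<in> \<int>")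
  case True
  then have "real_of_int \<lfloor>n / \<alpha> - \<alpha>\<rfloor> = n / \<alpha> - \<alpha>" by (simp add: of_int_floor)
  then show ?thesis using True unfolding Tmap_def digit_def by simp
next
  case False
  then have "digit N \<alpha> x = \<lfloor>n / x - \<alpha>\<rfloor>" unfolding digit_def by simp
  then show ?thesis unfolding Tmap_def by (simp, linarith)
qed

lemma Tmap_measurable_\<mu>: "Tmap N \<alpha> \<in> measurable \<mu> \<mu>"
proof (subst measurable_cong_sets[OF sets_\<mu> sets_\<mu>], rule measurable_restrict_space2)
  show "Tmap N \<alpha> \<in> space (restrict_space borel {\<alpha>..\<alpha> + 1}) \<rightarrow> {\<alpha>..\<alpha> + 1}"
    using Tmap_range by (auto simp: space_restrict_space)
  show "Tmap N \<alpha> \<in> measurable (restrict_space borel {\<alpha>..\<alpha> + 1}) borel"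
    by (rule measurable_restrict_space1[OF Tmap_measurable])
qed

lemma ergodic_\<mu>: "ergodic_system \<mu> (Tmap N \<alpha>)"
  using ergodic_factor[OF ergodic_M fst_measurable distr_fst Tmap_measurable_\<mu>] by (simp add: TT_alt)

lemma dens1_nonneg: "AE x in restrict_space lborel {\<alpha>..\<alpha> + 1}. 0 \<le> dens1 N d i \<alpha> x"
proof -
  have "AE x in lborel. 0 \<le> dens1 N d i \<alpha> x"
    using AE_generic by eventually_elim (use H_pos stairs_density_nonneg in \<open>auto simp: dens1_eq\<close>)
  then show ?thesis by (subst AE_restrict_space_iff) (auto elim: eventually_mono)
qed

lemma \<mu>_density: "\<mu> = density (restrict_space lborel {\<alpha>..\<alpha> + 1}) (\<lambda>x. ennreal (dens1 N d i \<alpha> x))"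
proof (rule measure_eqI)
  let ?I = "{\<alpha>..\<alpha> + 1}"
  show "sets \<mu> = sets (density (restrict_space lborel ?I) (\<lambda>x. ennreal (dens1 N d i \<alpha> x)))"
    by (simp add: sets_\<mu> sets_restrict_space)
  fix X assume X: "X \<in> sets \<mu>"
  then have Xb: "X \<in> sets borel" and XI: "X \<subseteq> ?I" unfolding sets_\<mu> by (auto simp: sets_restrict_space_iff)
  note Xb [measurable]
  have fX: "fst -` X \<in> sets (borel :: (real \<times> real) measure)"
    using measurable_sets[OF borel_pair_fst_snd(1) Xb] by simp
  have fX': "fst -` X \<inter> space M \<in> sets M" using measurable_sets[OF fst_measurable X] .
  have "emeasure \<mu> X = emeasure (distr M \<mu> fst) X" by (simp only: distr_fst)
  also have "\<dots> = emeasure M (fst -` X \<inter> space M)" using fst_measurable X by (rule emeasure_distr)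
  also have "\<dots> = emeasure M0 (fst -` X \<inter> space M)" using fX' by (rule emeasure_M)
  also have "\<dots> = emeasure M0 (fst -` X)"
    using AE_\<Omega> fX fX' sets_M_iff by (intro emeasure_eq_AE) (auto simp: space_M)
  also have "\<dots> = ennreal H * (\<integral>\<^sup>+x. ennreal (stairs_density x) * indicator X x \<partial>lborel)"
    using fX emeasure_strip[OF Xb] by (simp add: emeasure_M0)
  also have "\<dots> = (\<integral>\<^sup>+x. ennreal H * (ennreal (stairs_density x) * indicator X x) \<partial>lborel)"
    by (rule nn_integral_cmult[symmetric]) measurable
  also have "\<dots> = (\<integral>\<^sup>+x. ennreal (dens1 N d i \<alpha> x) * indicator X x * indicator ?I x \<partial>lborel)"
  proof (rule nn_integral_cong)
    fix x
    have "ennreal (H * stairs_density x) = ennreal H * ennreal (stairs_density x)"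
      using H_pos by (intro ennreal_mult') auto
    then show "ennreal H * (ennreal (stairs_density x) * indicator X x) = ennreal (dens1 N d i \<alpha> x) * indicator X x * indicator ?I x"
      using XI by (auto simp: dens1_eq indicator_def)
  qed
  also have "\<dots> = (\<integral>\<^sup>+x. ennreal (dens1 N d i \<alpha> x) * indicator X x \<partial>restrict_space lborel ?I)"
    by (rule nn_integral_restrict_space[symmetric]) simp
  also have "\<dots> = emeasure (density (restrict_space lborel ?I) (\<lambda>x. ennreal (dens1 N d i \<alpha> x))) X"
  proof (rule emeasure_density[symmetric])
    show "(\<lambda>x. ennreal (dens1 N d i \<alpha> x)) \<in> borel_measurable (restrict_space lborel ?I)"
      unfolding dens1_eq by (rule measurable_restrict_space1) measurable
    show "X \<in> sets (restrict_space lborel ?I)" using Xb XI by (simp add: sets_restrict_space_iff)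
  qed
  finally show "emeasure \<mu> X = emeasure (density (restrict_space lborel ?I) (\<lambda>x. ennreal (dens1 N d i \<alpha> x))) X" .
qed

text \<open>
  In the sub-\<open>\<sigma>\<close>-algebra the first coordinate and the inverse map are measurable up to null sets,
  hence so are the first coordinates of all past points and their digits. The truncated continued fractions of these
  digits converge to the second coordinate, which is therefore measurable as well.
\<close>

lemma minimal_M:
  assumes sub: "subalgebra M \<F>" and null: "null_sets M \<subseteq> sets \<F>"
    and inv: "invertible_system (restr_to_subalg M \<F>) TT"
    and fac: "factor_map (restr_to_subalg M \<F>) TT \<mu> (Tmap N \<alpha>) fst"
  shows "sets \<F> = sets M"
proof -
  interpret M: prob_space M by (rule prob_space_M)
  let ?R = "restr_to_subalg M \<F>"
  have spF: "space \<F> = Om" and FM: "sets \<F> \<subseteq> sets M" using sub unfolding subalgebra_def space_M by auto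
  have setsR: "sets ?R = sets \<F>" using sub by (rule sets_restr_to_subalg)
  have spR: "space ?R = Om" by (simp add: space_restr_to_subalg space_M)
  have R_to_M: "AE z in M. Q z" if "AE z in ?R. Q z" for Q using AE_restr_to_subalg[OF sub that] .
  have M_to_R: "AE z in ?R. Q z" if ae: "AE z in M. Q z" for Q
  proof -
    obtain Z where Z: "Z \<in> null_sets M" "{z \<in> space M. \<not> Q z} \<subseteq> Z" using ae unfolding eventually_ae_filter by auto
    have "Z \<in> sets \<F>" using Z(1) null by blast
    then have "Z \<in> null_sets ?R"
      using Z(1) emeasure_restr_to_subalg[OF sub] setsR by (simp add: null_sets_def)
    then show ?thesis using Z(2) unfolding eventually_ae_filter by (auto simp: spR space_M)
  qed
  \<comment> \<open>A Borel function that agrees almost everywhere with an \<open>\<F>\<close>-measurable one is itself \<open>\<F>\<close>-measurable.\<close>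
  have F_AE: "f \<in> borel_measurable \<F>"
    if f: "f \<in> borel_measurable M" and g: "g \<in> borel_measurable \<F>" and ae: "AE z in M. f z = g z" for f g :: "real \<times> real \<Rightarrow> real"
  proof (rule measurableI)
    fix Y :: "real set" assume Y: "Y \<in> sets borel"
    obtain Z where Z: "Z \<in> null_sets M" "{z \<in> space M. f z \<noteq> g z} \<subseteq> Z" using ae unfolding eventually_ae_filter by auto
    have ZF: "Z \<in> sets \<F>" using Z(1) null by blast
    have fY: "f -` Y \<inter> space M \<in> sets M" using f Y by (rule measurable_sets)
    then have "(f -` Y \<inter> space M) \<inter> Z \<in> null_sets M" using Z(1) by (intro null_set_Int1)
    then have 1: "(f -` Y \<inter> space M) \<inter> Z \<in> sets \<F>" using null by blast
    have 2: "g -` Y \<inter> space \<F> - Z \<in> sets \<F>" using measurable_sets[OF g Y] ZF by auto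
    have "f -` Y \<inter> space \<F> = (g -` Y \<inter> space \<F> - Z) \<union> ((f -` Y \<inter> space M) \<inter> Z)"
      using Z(2) by (auto simp: spF space_M)
    then show "f -` Y \<inter> space \<F> \<in> sets \<F>" using 1 2 by simp
  qed simp
  have M_borel: "f \<in> borel_measurable M" if "f \<in> borel_measurable borel" for f :: "real \<times> real \<Rightarrow> real"
    unfolding measurable_cong_sets[OF sets_M refl] using that by (rule measurable_restrict_space1)

  have "ae_measure_preserving ?R \<mu> fst" using fac unfolding factor_map_def by blast
  moreover have "\<alpha> \<in> space \<mu>" unfolding mu_def by (simp add: space_restrict_space)
  ultimately obtain p where p: "p \<in> measurable ?R \<mu>" "AE z in ?R. fst z = p z"
    by (rule ae_measure_preservingE)
  have "p \<in> measurable \<F> (restrict_space borel {\<alpha>..\<alpha> + 1})"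
    using p(1) by (simp only: measurable_cong_sets[OF setsR sets_\<mu>])
  then have "p \<in> borel_measurable \<F>" by (simp only: measurable_restrict_space2_iff)
  then have fst_F: "fst \<in> borel_measurable \<F>"
    by (rule F_AE[OF M_borel[OF borel_pair_fst_snd(1)] _ R_to_M[OF p(2)]])

  obtain S where S: "ae_measure_preserving ?R ?R S" "AE z in ?R. TT (S z) = z"
    using inv unfolding invertible_system_def by blast
  obtain c where c: "c \<in> space ?R" using M.not_empty by (auto simp: spR space_M)
  obtain s where s: "s \<in> measurable ?R ?R" "distr ?R ?R s = ?R" "AE z in ?R. S z = s z"
    using ae_measure_preservingE[OF S(1) c] by blast
  have s_F: "s \<in> measurable \<F> \<F>" using s(1) by (simp only: measurable_cong_sets[OF setsR setsR])
  have sm_F: "(s ^^ m) \<in> measurable \<F> \<F>" for m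
  proof (induction m)
    case (Suc m)
    show ?case unfolding funpow.simps by (rule measurable_comp[OF Suc s_F])
  qed (simp add: id_def)
  have along: "AE z in M. Q ((s ^^ m) z)" if "AE z in M. Q z" for Q m
    using that
  proof (induction m arbitrary: Q)
    case (Suc m)
    have "AE z in distr ?R ?R s. Q z" using M_to_R[OF Suc.prems] by (simp only: s(2))
    then have "AE z in ?R. Q (s z)" by (rule AE_distrD[OF s(1)])
    from Suc.IH[OF R_to_M[OF this]] show ?case by simp
  qed simp
  have "AE z in M. TT (s z) = z" using R_to_M[OF S(2)] R_to_M[OF s(3)] by eventually_elim simp
  then have forward_step: "AE z in M. \<forall>m. TT ((s ^^ Suc m) z) = (s ^^ m) z"
    using along[of "\<lambda>z. TT (s z) = z"] unfolding AE_all_countable by simp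
  have stay: "AE z in M. \<forall>m. (s ^^ m) z \<in> open_stairs"
    using along[of "\<lambda>z. z \<in> open_stairs"] AE_M0_stairs unfolding AE_all_countable AE_M_iff by blast

  \<comment> \<open>The continued fraction of the past digits, cut off after \<open>j\<close> steps with the tail \<open>A\<close>.\<close>
  define dig where "dig m z = real_of_int (digit N \<alpha> (fst ((s ^^ m) z)))" for m z
  define cf where "cf = rec_nat (\<lambda>m z. A) (\<lambda>j f m z. n / (dig (Suc m) z + f (Suc m) z))"
  have cf_0: "cf 0 m z = A" and cf_Suc: "cf (Suc j) m z = n / (dig (Suc m) z + cf j (Suc m) z)" for j m z
    unfolding cf_def by simp_all
  have dig_F: "dig m \<in> borel_measurable \<F>" for m
  proof -
    have "(\<lambda>z. fst ((s ^^ m) z)) \<in> borel_measurable \<F>"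
      using measurable_comp[OF sm_F fst_F] by (simp add: comp_def)
    from measurable_compose[OF this digit_measurable] show ?thesis unfolding dig_def .
  qed
  have cf_F: "cf j m \<in> borel_measurable \<F>" for j m
  proof (induction j arbitrary: m)
    case (Suc j)
    then show ?case using dig_F unfolding cf_Suc[abs_def] by (intro borel_measurable_divide borel_measurable_add) auto
  qed (simp add: cf_0[abs_def])
  define q where "q = n / (1 + n)"
  have q: "0 < q" "q < 1" unfolding q_def using n_gt_1 by auto
  have F_le_n: "F \<le> n" using B_eq \<delta>_ge B_pos mult_left_mono[of 1 "B + \<delta>" "B + 1"] F_def' by simp
  have approx: "AE z in M. \<forall>j m. 0 < cf j m z \<and> cf j m z \<le> n \<and>
      \<bar>snd ((s ^^ m) z) - cf j m z\<bar> \<le> F / A * q ^ j * min (snd ((s ^^ m) z)) (cf j m z)"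
    using forward_step stay
  proof eventually_elim
    fix z assume forward_step: "\<forall>m. TT ((s ^^ Suc m) z) = (s ^^ m) z" and stay: "\<forall>m. (s ^^ m) z \<in> open_stairs"
    have b: "\<alpha> < fst ((s ^^ m) z)" "fst ((s ^^ m) z) < \<alpha> + 1" "A < snd ((s ^^ m) z)" "snd ((s ^^ m) z) < F" for m
      using stay unfolding open_stairs_def by auto
    have dig1: "dig m z \<ge> 1" for m unfolding dig_def using digit_ge_1 b by blast
    have step: "snd ((s ^^ m) z) = n / (dig (Suc m) z + snd ((s ^^ Suc m) z))" for m
      using forward_step[THEN spec[of _ m]] unfolding TT_alt dig_def by (metis snd_conv)
    have "0 < cf j m z \<and> cf j m z \<le> n \<and>
      \<bar>snd ((s ^^ m) z) - cf j m z\<bar> \<le> F / A * q ^ j * min (snd ((s ^^ m) z)) (cf j m z)" for j m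
    proof (induction j arbitrary: m)
      case 0
      have "A \<le> n" using heights F_le_n by linarith
      moreover have "F / A * A = F" using A_pos by simp
      ultimately show ?case using b[of m] A_pos by (simp add: cf_0)
    next
      case (Suc j)
      have IH: "0 < cf j (Suc m) z" "cf j (Suc m) z \<le> n"
        "\<bar>snd ((s ^^ Suc m) z) - cf j (Suc m) z\<bar> \<le> F / A * q ^ j * min (snd ((s ^^ Suc m) z)) (cf j (Suc m) z)"
        using Suc[of "Suc m"] by blast+
      have k: "dig (Suc m) z \<ge> 1" by (rule dig1)
      have "\<bar>n / (dig (Suc m) z + snd ((s ^^ Suc m) z)) - n / (dig (Suc m) z + cf j (Suc m) z)\<bar>
        \<le> F / A * q ^ j * (n / (1 + n)) *
          min (n / (dig (Suc m) z + snd ((s ^^ Suc m) z))) (n / (dig (Suc m) z + cf j (Suc m) z))"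
      proof (rule relative_contraction)
        show "0 \<le> snd ((s ^^ Suc m) z)" "snd ((s ^^ Suc m) z) \<le> n" using b[of "Suc m"] A_pos F_le_n by linarith+
        show "0 \<le> F / A * q ^ j" using F_pos A_pos q by simp
      qed (use n_gt_1 k IH in auto)
      then have "\<bar>snd ((s ^^ m) z) - cf (Suc j) m z\<bar> \<le> F / A * q ^ j * q * min (snd ((s ^^ m) z)) (cf (Suc j) m z)"
        unfolding step[of m] cf_Suc q_def[symmetric] .
      moreover have "0 < cf (Suc j) m z" unfolding cf_Suc using n_gt_1 k IH(1) by (intro divide_pos_pos) auto
      moreover have "cf (Suc j) m z \<le> n"
      proof -
        have "n / (dig (Suc m) z + cf j (Suc m) z) \<le> n / 1" using n_gt_1 k IH(1) by (intro divide_left_mono) auto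
        then show ?thesis unfolding cf_Suc by simp
      qed
      ultimately show ?case by (simp add: mult_ac)
    qed
    then show "\<forall>j m. 0 < cf j m z \<and> cf j m z \<le> n \<and>
      \<bar>snd ((s ^^ m) z) - cf j m z\<bar> \<le> F / A * q ^ j * min (snd ((s ^^ m) z)) (cf j m z)" by blast
  qed
  have "AE z in M. snd z = lim (\<lambda>j. cf j 0 z)"
    using approx
  proof eventually_elim
    fix z assume *: "\<forall>j m. 0 < cf j m z \<and> cf j m z \<le> n \<and>
      \<bar>snd ((s ^^ m) z) - cf j m z\<bar> \<le> F / A * q ^ j * min (snd ((s ^^ m) z)) (cf j m z)"
    have "(\<lambda>j. cf j 0 z) \<longlonglongrightarrow> snd z"
    proof (rule LIM_zero_cancel, rule tendsto_0_le[of "\<lambda>j. F / A * q ^ j * n" _ _ 1])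
      show "(\<lambda>j. F / A * q ^ j * n) \<longlonglongrightarrow> 0"
        using q by (intro tendsto_mult_left_zero tendsto_mult_right_zero LIMSEQ_realpow_zero) auto
      show "\<forall>\<^sub>F j in sequentially. norm (cf j 0 z - snd z) \<le> norm (F / A * q ^ j * n) * 1"
      proof (intro always_eventually allI)
        fix j
        have "\<bar>snd z - cf j 0 z\<bar> \<le> F / A * q ^ j * min (snd z) (cf j 0 z)" using *[THEN spec, THEN spec, of j 0] by simp
        also have "\<dots> \<le> F / A * q ^ j * n"
          using *[THEN spec, THEN spec, of j 0] F_pos A_pos q by (intro mult_left_mono) auto
        also have "\<dots> \<le> \<bar>F / A * q ^ j * n\<bar>" by (rule abs_ge_self)
        finally show "norm (cf j 0 z - snd z) \<le> norm (F / A * q ^ j * n) * 1"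
          by (simp only: real_norm_def abs_minus_commute[of "cf j 0 z"] mult_1_right)
      qed
    qed
    then show "snd z = lim (\<lambda>j. cf j 0 z)" by (simp add: limI)
  qed
  then have snd_F: "snd \<in> borel_measurable \<F>"
    by (rule F_AE[OF M_borel[OF borel_pair_fst_snd(2)] borel_measurable_lim_metric[OF cf_F]])
  have "sets M \<subseteq> sets \<F>"
  proof
    fix Y assume "Y \<in> sets M"
    then have Y: "Y \<in> sets borel" "Y \<subseteq> Om" using sets_M_iff by auto
    have "(\<lambda>z. (fst z, snd z)) \<in> borel_measurable \<F>" using fst_F snd_F by (rule borel_measurable_pair)
    from measurable_sets[OF this Y(1)] show "Y \<in> sets \<F>" using Y(2) by (simp add: spF Int_absorb2)
  qed
  then show ?thesis using FM by blast
qed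

lemma natural_extension_M: "natural_extension M TT \<mu> (Tmap N \<alpha>) fst"
  unfolding natural_extension_def using invertible_M factor_M minimal_M by blast

end

theorem theorem6:
  fixes N d i :: nat and \<alpha> :: real
  assumes "N \<ge> 2" and "d \<ge> 1" and "i \<ge> 2"
    and "real N = real d * real (d + i) / (real i - 1)"
    and "\<alpha> \<in> closure (X_set N d i)"
  shows
    "prob_space (mubar N d i \<alpha>)
     \<and> ae_measure_preserving (mubar N d i \<alpha>) (mubar N d i \<alpha>) (TTmap N \<alpha>)
     \<and> ergodic_system (mubar N d i \<alpha>) (TTmap N \<alpha>)
     \<and> ergodic_system (mu N d i \<alpha>) (Tmap N \<alpha>)
     \<and> natural_extension (mubar N d i \<alpha>) (TTmap N \<alpha>) (mu N d i \<alpha>) (Tmap N \<alpha>) fst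
     \<and> (AE x in restrict_space lborel {\<alpha>..\<alpha> + 1}. 0 \<le> dens1 N d i \<alpha> x)
     \<and> mu N d i \<alpha> =
         density (restrict_space lborel {\<alpha>..\<alpha> + 1}) (\<lambda>x. ennreal (dens1 N d i \<alpha> x))"
proof -
  interpret matching_parameters N d i
    using assms(2-4) by unfold_locales (auto simp: field_simps)
  interpret matched_expansion N d i \<alpha>
    using closure_X_set_subset assms(5) by unfold_locales auto
  show ?thesis
    using prob_space_M ae_mp_M[OF TT_measurable distr_TT] ergodic_M ergodic_\<mu> natural_extension_M
      dens1_nonneg \<mu>_density by blast
qed

end
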